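(* Let $\mathbf{k}$ be a commutative ring and let $\mathfrak{g}$ be a Lie $\mathbf{k}$-algebra which, as a $\mathbf{k}$-module, is the direct sum $\mathfrak{g}=\mathfrak{g}_1\oplus\mathfrak{g}_2$ of two Lie subalgebras $\mathfrak{g}_1,\mathfrak{g}_2$. Let $j_i:\mathfrak{g}_i\to\mathfrak{g}$ be the inclusions and $p_i:\mathfrak{g}\to\mathfrak{g}_i$ the associated projections, so that $j_1p_1+j_2p_2=\mathrm{Id}_{\mathfrak{g}}$. Let $\sigma:\mathfrak{g}\to\mathcal{U}(\mathfrak{g})$, $\sigma_i:\mathfrak{g}_i\to\mathcal{U}(\mathfrak{g}_i)$ be the canonical maps into the universal enveloping algebras, $\mathcal{U}(j_i):\mathcal{U}(\mathfrak{g}_i)\to\mathcal{U}(\mathfrak{g})$ the induced algebra morphisms, $\psi_1:T(\mathfrak{g}_1)\to\mathcal{U}(\mathfrak{g}_1)$ the canonical quotient map from the tensor algebra, and $\mu$ the multiplication of $\mathcal{U}(\mathfrak{g})$. All tensor products are over $\mathbf{k}$. Then: (i) There exists a unique $\mathbf{k}$-linear map $\Phi:\mathfrak{g}\otimes T(\mathfrak{g}_1)\otimes\mathcal{U}(\mathfrak{g}_2)\to T(\mathfrak{g}_1)\otimes\mathcal{U}(\mathfrak{g}_2)$, written $g\ast_T(t\otimes m):=\Phi(g\otimes t\otimes m)$, such that $$g\ast_T(1_{T(\mathfrak{g}_1)}\otimes m)=p_1(g)\otimes m+1_{T(\mathfrak{g}_1)}\otimes \sigma_2(p_2(g))\,m$$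 for all $(g,m)\in\mathfrak{g}\times\mathcal{U}(\mathfrak{g}_2)$ (where $p_1(g)$ is viewed in $T_1(\mathfrak{g}_1)=\mathfrak{g}_1$), and $$g\ast_T(x\otimes t\otimes m)=[g,j_1(x)]\ast_T(t\otimes m)+x\cdot\big(g\ast_T(t\otimes m)\big)$$ for all $(g,x,t,m)\in\mathfrak{g}\times\mathfrak{g}_1\times T(\mathfrak{g}_1)\times\mathcal{U}(\mathfrak{g}_2)$, where $x\cdot(-)$ denotes left multiplication by $x$ in the first tensor factor $T(\mathfrak{g}_1)$. (ii) $\Phi\big(\mathfrak{g}\otimes T_{\le n}(\mathfrak{g}_1)\otimes\mathcal{U}(\mathfrak{g}_2)\big)\subset T_{\le n+1}(\mathfrak{g}_1)\otimes\mathcal{U}(\mathfrak{g}_2)$ for all $n\ge 0$. (iii) (a) For all $(g,t,m)\in\mathfrak{g}\times T(\mathfrak{g}_1)\times\mathcal{U}(\mathfrak{g}_2)$, $g\ast_T(t\otimes m)=\big(g\ast_T(t\otimes 1_{\mathcal{U}(\mathfrak{g}_2)})\big)\cdot m$, where $\cdot m$ is right multiplication by $m$ in the factor $\mathcal{U}(\mathfrak{g}_2)$. (b) Setting $\mu^T_{state}=\mu\circ(\mathcal{U}(j_1)\otimes\mathcal{U}(j_2))\circ(\psi_1\otimes \mathrm{Id}_{\mathcal{U}(\mathfrak{g}_2)})$, for all $(g,t,m)\in\mathfrak{g}\times T(\mathfrak{g}_1)\times\mathcal{U}(\mathfrak{g}_2)$, $$\mu^T_{state}(g\ast_T(t\otimes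 m))=\sigma(g)\,\mu^T_{state}(t\otimes m)=\sigma(g)\,\mu^T_{state}(t\otimes 1_{\mathcal{U}(\mathfrak{g}_2)})\,\mathcal{U}(j_2)(m).$$ (iv) There is a unique map $\Phi_U:\mathfrak{g}\otimes\mathcal{U}(\mathfrak{g}_1)\otimes\mathcal{U}(\mathfrak{g}_2)\to\mathcal{U}(\mathfrak{g}_1)\otimes\mathcal{U}(\mathfrak{g}_2)$ such that $\Phi_U\circ(\mathrm{Id}_{\mathfrak{g}}\otimes\psi_1\otimes\mathrm{Id}_{\mathcal{U}(\mathfrak{g}_2)})=(\psi_1\otimes\mathrm{Id}_{\mathcal{U}(\mathfrak{g}_2)})\circ\Phi$.
   Context: $T(\mathfrak{g}_1)$ is the tensor algebra of the $\mathbf{k}$-module $\mathfrak{g}_1$, graded by tensor degree, with $T_n(\mathfrak{g}_1)$ its degree-$n$ part and $T_{\le n}(\mathfrak{g}_1)=\bigoplus_{k\le n}T_k(\mathfrak{g}_1)$. The space $T(\mathfrak{g}_1)\otimes\mathcal{U}(\mathfrak{g}_2)$ is a left $T(\mathfrak{g}_1)$-module by left multiplication on the first factor and a right $\mathcal{U}(\mathfrak{g}_2)$-module by right multiplication on the second factor; similarly for $\mathcal{U}(\mathfrak{g}_1)\otimes\mathcal{U}(\mathfrak{g}_2)$. *)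

theory Defs
  imports "HOL-Algebra.Module" "HOL-Algebra.QuotRing"
begin

text \<open>Modules are \<^type>\<open>module_ext\<close> records over a commutative ring record \<open>R\<close>. For records
  that are only modules, the fields \<open>mult\<close> and \<open>one\<close> carry no meaning.\<close>

section \<open>Linear maps, generated submodules, quotients, direct sums\<close>

text \<open>Maps are \<open>undefined\<close> outside the carrier of their source, so that equality of maps is
  equality of HOL functions.\<close>

definition linear_maps ::
  "('k, 'r) ring_scheme \<Rightarrow> ('k, 'a, 'x) module_scheme \<Rightarrow> ('k, 'b, 'y) module_scheme \<Rightarrow> ('a \<Rightarrow> 'b) set"
  where "linear_maps R M N =
    {f \<in> carrier M \<rightarrow>\<^sub>E carrier N.
       (\<forall>x\<in>carrier M. \<forall>y\<in>carrier M. f (x \<oplus>\<^bsub>M\<^esub> y) = f x \<oplus>\<^bsub>N\<^esub> f y) \<and>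
       (\<forall>c\<in>carrier R. \<forall>x\<in>carrier M. f (c \<odot>\<^bsub>M\<^esub> x) = c \<odot>\<^bsub>N\<^esub> f x)}"

definition algebra_maps ::
  "('k, 'r) ring_scheme \<Rightarrow> ('k, 'a, 'x) module_scheme \<Rightarrow> ('k, 'b, 'y) module_scheme \<Rightarrow> ('a \<Rightarrow> 'b) set"
  where "algebra_maps R A B = linear_maps R A B \<inter> ring_hom A B"

definition gen_submodule ::
  "('k, 'r) ring_scheme \<Rightarrow> ('k, 'a, 'x) module_scheme \<Rightarrow> 'a set \<Rightarrow> 'a set"
  where "gen_submodule R M S = \<Inter>{H. submodule H R M \<and> S \<subseteq> H}"

text \<open>The quotient \<open>M/N\<close> as the set of cosets. If \<open>N\<close> is a two-sided ideal of an algebra \<open>M\<close>,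
  this is the quotient algebra.\<close>

definition quot_module :: "('k, 'a, 'x) module_scheme \<Rightarrow> 'a set \<Rightarrow> ('k, 'a set) module"
  where "quot_module M N =
    \<lparr>carrier = carrier (M Quot N), mult = mult (M Quot N), one = one (M Quot N),
     zero = zero (M Quot N), add = add (M Quot N),
     smult = (\<lambda>c X. \<Union>x\<in>X. N +>\<^bsub>M\<^esub> (c \<odot>\<^bsub>M\<^esub> x))\<rparr>"

definition internal_direct_sum :: "('k, 'a, 'x) module_scheme \<Rightarrow> 'a set \<Rightarrow> 'a set \<Rightarrow> bool"
  where "internal_direct_sum M A B \<longleftrightarrow> carrier M = A <+>\<^bsub>M\<^esub> B \<and> A \<inter> B = {\<zero>\<^bsub>M\<^esub>}"

text \<open>Projection onto \<open>A\<close> along \<open>B\<close>.\<close>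

definition dsum_proj :: "('k, 'a, 'x) module_scheme \<Rightarrow> 'a set \<Rightarrow> 'a set \<Rightarrow> 'a \<Rightarrow> 'a"
  where "dsum_proj M A B x = (THE a. a \<in> A \<and> (\<exists>b\<in>B. x = a \<oplus>\<^bsub>M\<^esub> b))"

section \<open>Free modules and tensor products\<close>

text \<open>The free module on \<open>X\<close>: finitely supported functions, vanishing outside \<open>X\<close>.\<close>

definition free_module :: "('k, 'r) ring_scheme \<Rightarrow> 'a set \<Rightarrow> ('k, 'a \<Rightarrow> 'k) module"
  where "free_module R X =
    \<lparr>carrier = {f. range f \<subseteq> carrier R \<and> finite {x. f x \<noteq> \<zero>\<^bsub>R\<^esub>} \<and> {x. f x \<noteq> \<zero>\<^bsub>R\<^esub>} \<subseteq> X},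
     mult = undefined, one = undefined,
     zero = (\<lambda>x. \<zero>\<^bsub>R\<^esub>), add = (\<lambda>f g x. f x \<oplus>\<^bsub>R\<^esub> g x), smult = (\<lambda>c f x. c \<otimes>\<^bsub>R\<^esub> f x)\<rparr>"

definition free_gen :: "('k, 'r) ring_scheme \<Rightarrow> 'a \<Rightarrow> 'a \<Rightarrow> 'k"
  where "free_gen R x = (\<lambda>y. if y = x then \<one>\<^bsub>R\<^esub> else \<zero>\<^bsub>R\<^esub>)"

definition bilinear_relations ::
  "('k, 'r) ring_scheme \<Rightarrow> ('k, 'a, 'x) module_scheme \<Rightarrow> ('k, 'b, 'y) module_scheme \<Rightarrow> ('a \<times> 'b \<Rightarrow> 'k) set"
  where "bilinear_relations R M N =
    (let F = free_module R (carrier M \<times> carrier N); e = (\<lambda>x y. free_gen R (x, y)) in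
      {e (x \<oplus>\<^bsub>M\<^esub> x') y \<ominus>\<^bsub>F\<^esub> (e x y \<oplus>\<^bsub>F\<^esub> e x' y) | x x' y.
         x \<in> carrier M \<and> x' \<in> carrier M \<and> y \<in> carrier N} \<union>
      {e x (y \<oplus>\<^bsub>N\<^esub> y') \<ominus>\<^bsub>F\<^esub> (e x y \<oplus>\<^bsub>F\<^esub> e x y') | x y y'.
         x \<in> carrier M \<and> y \<in> carrier N \<and> y' \<in> carrier N} \<union>
      {e (c \<odot>\<^bsub>M\<^esub> x) y \<ominus>\<^bsub>F\<^esub> (c \<odot>\<^bsub>F\<^esub> e x y) | c x y.
         c \<in> carrier R \<and> x \<in> carrier M \<and> y \<in> carrier N} \<union>
      {e x (c \<odot>\<^bsub>N\<^esub> y) \<ominus>\<^bsub>F\<^esub> (c \<odot>\<^bsub>F\<^esub> e x y) | c x y.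
         c \<in> carrier R \<and> x \<in> carrier M \<and> y \<in> carrier N})"

definition tensor_kernel ::
  "('k, 'r) ring_scheme \<Rightarrow> ('k, 'a, 'x) module_scheme \<Rightarrow> ('k, 'b, 'y) module_scheme \<Rightarrow> ('a \<times> 'b \<Rightarrow> 'k) set"
  where "tensor_kernel R M N =
    gen_submodule R (free_module R (carrier M \<times> carrier N)) (bilinear_relations R M N)"

definition tensor_prod ::
  "('k, 'r) ring_scheme \<Rightarrow> ('k, 'a, 'x) module_scheme \<Rightarrow> ('k, 'b, 'y) module_scheme
    \<Rightarrow> ('k, ('a \<times> 'b \<Rightarrow> 'k) set) module"
  where "tensor_prod R M N =
    quot_module (free_module R (carrier M \<times> carrier N)) (tensor_kernel R M N)"

text \<open>The pure tensor \<open>x \<otimes> y\<close>.\<close>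

definition pure_tensor ::
  "('k, 'r) ring_scheme \<Rightarrow> ('k, 'a, 'x) module_scheme \<Rightarrow> ('k, 'b, 'y) module_scheme
    \<Rightarrow> 'a \<Rightarrow> 'b \<Rightarrow> ('a \<times> 'b \<Rightarrow> 'k) set"
  where "pure_tensor R M N x y =
    tensor_kernel R M N +>\<^bsub>free_module R (carrier M \<times> carrier N)\<^esub> free_gen R (x, y)"

text \<open>The image of \<open>A \<otimes> B\<close> in \<open>tensor_prod R M N\<close>, for submodules \<open>A\<close> of \<open>M\<close> and \<open>B\<close> of \<open>N\<close>.\<close>

definition tensor_image ::
  "('k, 'r) ring_scheme \<Rightarrow> ('k, 'a, 'x) module_scheme \<Rightarrow> ('k, 'b, 'y) module_scheme
    \<Rightarrow> 'a set \<Rightarrow> 'b set \<Rightarrow> ('a \<times> 'b \<Rightarrow> 'k) set set"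
  where "tensor_image R M N A B =
    gen_submodule R (tensor_prod R M N) {pure_tensor R M N x y | x y. x \<in> A \<and> y \<in> B}"

text \<open>The linear map out of the tensor product induced by a bilinear map \<open>b\<close>.\<close>

definition tensor_lift ::
  "('k, 'r) ring_scheme \<Rightarrow> ('k, 'a, 'x) module_scheme \<Rightarrow> ('k, 'b, 'y) module_scheme
    \<Rightarrow> ('k, 'c, 'z) module_scheme \<Rightarrow> ('a \<Rightarrow> 'b \<Rightarrow> 'c) \<Rightarrow> ('a \<times> 'b \<Rightarrow> 'k) set \<Rightarrow> 'c"
  where "tensor_lift R M N P b =
    (THE h. h \<in> linear_maps R (tensor_prod R M N) P \<and>
       (\<forall>x\<in>carrier M. \<forall>y\<in>carrier N. h (pure_tensor R M N x y) = b x y))"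

text \<open>The map \<open>f \<otimes> g\<close> from \<open>tensor_prod R M N\<close> to \<open>tensor_prod R M' N'\<close>.\<close>

definition tensor_map ::
  "('k, 'r) ring_scheme \<Rightarrow> ('k, 'a, 'x) module_scheme \<Rightarrow> ('k, 'b, 'y) module_scheme
    \<Rightarrow> ('k, 'c, 'z) module_scheme \<Rightarrow> ('k, 'd, 'w) module_scheme
    \<Rightarrow> ('a \<Rightarrow> 'c) \<Rightarrow> ('b \<Rightarrow> 'd) \<Rightarrow> ('a \<times> 'b \<Rightarrow> 'k) set \<Rightarrow> ('c \<times> 'd \<Rightarrow> 'k) set"
  where "tensor_map R M N M' N' f g =
    tensor_lift R M N (tensor_prod R M' N') (\<lambda>x y. pure_tensor R M' N' (f x) (g y))"

text \<open>For algebras \<open>A\<close> and \<open>B\<close>: left multiplication by \<open>a\<close> on the first factor and right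
  multiplication by \<open>b\<close> on the second factor of \<open>tensor_prod R A B\<close>.\<close>

definition tensor_lmult ::
  "('k, 'r) ring_scheme \<Rightarrow> ('k, 'a, 'x) module_scheme \<Rightarrow> ('k, 'b, 'y) module_scheme
    \<Rightarrow> 'a \<Rightarrow> ('a \<times> 'b \<Rightarrow> 'k) set \<Rightarrow> ('a \<times> 'b \<Rightarrow> 'k) set"
  where "tensor_lmult R A B a = tensor_map R A B A B (\<lambda>t. a \<otimes>\<^bsub>A\<^esub> t) (\<lambda>m. m)"

definition tensor_rmult ::
  "('k, 'r) ring_scheme \<Rightarrow> ('k, 'a, 'x) module_scheme \<Rightarrow> ('k, 'b, 'y) module_scheme
    \<Rightarrow> ('a \<times> 'b \<Rightarrow> 'k) set \<Rightarrow> 'b \<Rightarrow> ('a \<times> 'b \<Rightarrow> 'k) set"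
  where "tensor_rmult R A B z b = tensor_map R A B A B (\<lambda>t. t) (\<lambda>m. m \<otimes>\<^bsub>B\<^esub> b) z"

section \<open>The tensor algebra\<close>

text \<open>The free algebra on \<open>X\<close>: the free module on words in \<open>X\<close>, with multiplication extending
  concatenation of words.\<close>

definition free_algebra :: "('k, 'r) ring_scheme \<Rightarrow> 'a set \<Rightarrow> ('k, 'a list \<Rightarrow> 'k) module"
  where "free_algebra R X = (free_module R (lists X))
    \<lparr>mult := (\<lambda>f g w. \<Oplus>\<^bsub>R\<^esub>i\<in>{..length w}. f (take i w) \<otimes>\<^bsub>R\<^esub> g (drop i w)),
     one := free_gen R []\<rparr>"

text \<open>The ideal generated by the linearity relations is spanned by the multilinearity relations
  between words of the same length \<open>n\<close>, for all \<open>n\<close>. So \<open>tensor_algebra R M\<close> is the direct sum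
  of the tensor powers of \<open>M\<close>, the word \<open>[x1, ..., xn]\<close> representing \<open>x1 \<otimes> ... \<otimes> xn\<close>.\<close>

definition linear_relations ::
  "('k, 'r) ring_scheme \<Rightarrow> ('k, 'a, 'x) module_scheme \<Rightarrow> ('a list \<Rightarrow> 'k) set"
  where "linear_relations R M =
    (let F = free_algebra R (carrier M); e = (\<lambda>x. free_gen R [x]) in
      {e (x \<oplus>\<^bsub>M\<^esub> y) \<ominus>\<^bsub>F\<^esub> (e x \<oplus>\<^bsub>F\<^esub> e y) | x y. x \<in> carrier M \<and> y \<in> carrier M} \<union>
      {e (c \<odot>\<^bsub>M\<^esub> x) \<ominus>\<^bsub>F\<^esub> (c \<odot>\<^bsub>F\<^esub> e x) | c x. c \<in> carrier R \<and> x \<in> carrier M})"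

definition tensor_ideal ::
  "('k, 'r) ring_scheme \<Rightarrow> ('k, 'a, 'x) module_scheme \<Rightarrow> ('a list \<Rightarrow> 'k) set"
  where "tensor_ideal R M = Idl\<^bsub>free_algebra R (carrier M)\<^esub> (linear_relations R M)"

definition tensor_algebra ::
  "('k, 'r) ring_scheme \<Rightarrow> ('k, 'a, 'x) module_scheme \<Rightarrow> ('k, ('a list \<Rightarrow> 'k) set) module"
  where "tensor_algebra R M = quot_module (free_algebra R (carrier M)) (tensor_ideal R M)"

text \<open>The identification of \<open>M\<close> with the degree-one part of its tensor algebra.\<close>

definition tensor_incl ::
  "('k, 'r) ring_scheme \<Rightarrow> ('k, 'a, 'x) module_scheme \<Rightarrow> 'a \<Rightarrow> ('a list \<Rightarrow> 'k) set"
  where "tensor_incl R M x = tensor_ideal R M +>\<^bsub>free_algebra R (carrier M)\<^esub> free_gen R [x]"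

definition tensor_degree ::
  "('k, 'r) ring_scheme \<Rightarrow> ('k, 'a, 'x) module_scheme \<Rightarrow> nat \<Rightarrow> ('a list \<Rightarrow> 'k) set set"
  where "tensor_degree R M n =
    {tensor_ideal R M +>\<^bsub>free_algebra R (carrier M)\<^esub> f | f.
       f \<in> carrier (free_algebra R (carrier M)) \<and> (\<forall>w. f w \<noteq> \<zero>\<^bsub>R\<^esub> \<longrightarrow> length w = n)}"

definition tensor_degree_le ::
  "('k, 'r) ring_scheme \<Rightarrow> ('k, 'a, 'x) module_scheme \<Rightarrow> nat \<Rightarrow> ('a list \<Rightarrow> 'k) set set"
  where "tensor_degree_le R M n =
    {\<Oplus>\<^bsub>tensor_algebra R M\<^esub>k\<in>{..n}. t k | t. \<forall>k\<le>n. t k \<in> tensor_degree R M k}"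

section \<open>Lie algebras and universal enveloping algebras\<close>

record ('k, 'a) lie_algebra = "('k, 'a) module" +
  bracket :: "'a \<Rightarrow> 'a \<Rightarrow> 'a"

locale lie_algebra = module R L
  for R :: "('k, 'r) ring_scheme" and L :: "('k, 'a, 'l) lie_algebra_scheme" +
  assumes bracket_closed:
      "\<lbrakk>x \<in> carrier L; y \<in> carrier L\<rbrakk> \<Longrightarrow> bracket L x y \<in> carrier L"
    and bracket_add_left: "\<lbrakk>x \<in> carrier L; y \<in> carrier L; z \<in> carrier L\<rbrakk> \<Longrightarrow>
      bracket L (x \<oplus>\<^bsub>L\<^esub> y) z = bracket L x z \<oplus>\<^bsub>L\<^esub> bracket L y z"
    and bracket_add_right: "\<lbrakk>x \<in> carrier L; y \<in> carrier L; z \<in> carrier L\<rbrakk> \<Longrightarrow>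
      bracket L x (y \<oplus>\<^bsub>L\<^esub> z) = bracket L x y \<oplus>\<^bsub>L\<^esub> bracket L x z"
    and bracket_smult_left: "\<lbrakk>c \<in> carrier R; x \<in> carrier L; y \<in> carrier L\<rbrakk> \<Longrightarrow>
      bracket L (c \<odot>\<^bsub>L\<^esub> x) y = c \<odot>\<^bsub>L\<^esub> bracket L x y"
    and bracket_smult_right: "\<lbrakk>c \<in> carrier R; x \<in> carrier L; y \<in> carrier L\<rbrakk> \<Longrightarrow>
      bracket L x (c \<odot>\<^bsub>L\<^esub> y) = c \<odot>\<^bsub>L\<^esub> bracket L x y"
    and bracket_self: "x \<in> carrier L \<Longrightarrow> bracket L x x = \<zero>\<^bsub>L\<^esub>"
    and jacobi: "\<lbrakk>x \<in> carrier L; y \<in> carrier L; z \<in> carrier L\<rbrakk> \<Longrightarrow>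
      bracket L x (bracket L y z) \<oplus>\<^bsub>L\<^esub> bracket L y (bracket L z x) \<oplus>\<^bsub>L\<^esub>
        bracket L z (bracket L x y) = \<zero>\<^bsub>L\<^esub>"

text \<open>The Lie algebra with underlying set a Lie subalgebra \<open>H\<close> is \<open>L\<lparr>carrier := H\<rparr>\<close>.\<close>

locale lie_subalgebra = submodule H R L
  for H and R :: "('k, 'r) ring_scheme" and L :: "('k, 'a, 'l) lie_algebra_scheme" +
  assumes subalgebra_bracket_closed: "\<lbrakk>x \<in> H; y \<in> H\<rbrakk> \<Longrightarrow> bracket L x y \<in> H"

definition uea_ideal ::
  "('k, 'r) ring_scheme \<Rightarrow> ('k, 'a, 'l) lie_algebra_scheme \<Rightarrow> ('a list \<Rightarrow> 'k) set set"
  where "uea_ideal R L =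
    (let T = tensor_algebra R L; i = tensor_incl R L in
      Idl\<^bsub>T\<^esub> {(i x \<otimes>\<^bsub>T\<^esub> i y \<ominus>\<^bsub>T\<^esub> i y \<otimes>\<^bsub>T\<^esub> i x) \<ominus>\<^bsub>T\<^esub> i (bracket L x y) | x y.
        x \<in> carrier L \<and> y \<in> carrier L})"

definition uea ::
  "('k, 'r) ring_scheme \<Rightarrow> ('k, 'a, 'l) lie_algebra_scheme \<Rightarrow> ('k, ('a list \<Rightarrow> 'k) set set) module"
  where "uea R L = quot_module (tensor_algebra R L) (uea_ideal R L)"

text \<open>The quotient map from the tensor algebra, and the canonical map from \<open>L\<close>.\<close>

definition uea_proj ::
  "('k, 'r) ring_scheme \<Rightarrow> ('k, 'a, 'l) lie_algebra_scheme
    \<Rightarrow> ('a list \<Rightarrow> 'k) set \<Rightarrow> ('a list \<Rightarrow> 'k) set set"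
  where "uea_proj R L t = uea_ideal R L +>\<^bsub>tensor_algebra R L\<^esub> t"

definition uea_incl ::
  "('k, 'r) ring_scheme \<Rightarrow> ('k, 'a, 'l) lie_algebra_scheme \<Rightarrow> 'a \<Rightarrow> ('a list \<Rightarrow> 'k) set set"
  where "uea_incl R L x = uea_proj R L (tensor_incl R L x)"

text \<open>The algebra morphism of enveloping algebras induced by a Lie algebra morphism \<open>f\<close>.\<close>

definition uea_map ::
  "('k, 'r) ring_scheme \<Rightarrow> ('k, 'a, 'l) lie_algebra_scheme \<Rightarrow> ('k, 'b, 'm) lie_algebra_scheme
    \<Rightarrow> ('a \<Rightarrow> 'b) \<Rightarrow> ('a list \<Rightarrow> 'k) set set \<Rightarrow> ('b list \<Rightarrow> 'k) set set"
  where "uea_map R L L' f =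
    (THE h. h \<in> algebra_maps R (uea R L) (uea R L') \<and>
       (\<forall>x\<in>carrier L. h (uea_incl R L x) = uea_incl R L' (f x)))"

end

(* The recursion for the action says that t |-> (g |-> g * (t (x) m)) intertwines left multiplication
   by x in g1 with the operator (x.f)(g) = f [g, x] + x f(g) on W = Hom(g, T(g1) (x) U(g2)). Since T(g1)
   is the tensor algebra, these operators make W a T(g1)-module, and Phi is read off the orbit of
   f_m(g) = p1 g (x) m + 1 (x) sigma2(p2 g) m. Uniqueness and (ii), (iii) follow by induction on t, with
   g universally quantified. On Hom(g, U(g1) (x) U(g2)) the same operators respect the bracket, by the
   Jacobi identity, so this is a U(g1)-module. The same construction then gives Phi_U directly, without
   describing the kernel of psi1 (x) Id; it agrees with Phi by induction on t and is unique since
   Id (x) psi1 (x) Id is surjective. *)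

theory Submission
  imports Defs
begin

section \<open>Linear and bilinear maps\<close>

text \<open>The recursion imitates left multiplication in U(g): there
  \<open>g x = [g, x] + x g\<close>, and \<open>g = p1 g + p2 g\<close> distributes \<open>g\<close>
  over the two factors once no letter is left to pass. The obstacle is that for a fixed
  \<open>g\<close> the recursion calls itself at \<open>[g, x]\<close>, so it is not iteration of an
  operator on T(g1) \<otimes> U(g2); taking as value a function of all of g makes it a recursion in
  \<open>t\<close> alone, hence the Hom module. T(g1) is a quotient of a free algebra and U(g1) a
  quotient of T(g1). An action on a module factors through such a quotient when the ideal
  annihilates the whole module, so the action is built on all of Hom and not only on the orbits of
  the functions \<open>f_m\<close>. Over a general k neither a basis of g1 nor flatness of U(g2) is
  available, which makes the kernel of psi1 \<otimes> Id awkward to handle; the construction is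
  therefore carried out for an abstract first algebra \<open>A\<close> and specialised
  twice.\<close>

text \<open>Unlike \<^const>\<open>linear_maps\<close>, this puts no condition on values outside the carrier.\<close>

definition is_linear ::
  "('k, 'r) ring_scheme \<Rightarrow> ('k, 'a, 'x) module_scheme \<Rightarrow> ('k, 'b, 'y) module_scheme \<Rightarrow> ('a \<Rightarrow> 'b) \<Rightarrow> bool"
  where "is_linear R M N f \<longleftrightarrow>
    (\<forall>x\<in>carrier M. f x \<in> carrier N) \<and>
    (\<forall>x\<in>carrier M. \<forall>y\<in>carrier M. f (x \<oplus>\<^bsub>M\<^esub> y) = f x \<oplus>\<^bsub>N\<^esub> f y) \<and>
    (\<forall>c\<in>carrier R. \<forall>x\<in>carrier M. f (c \<odot>\<^bsub>M\<^esub> x) = c \<odot>\<^bsub>N\<^esub> f x)"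

definition is_bilinear ::
  "('k, 'r) ring_scheme \<Rightarrow> ('k, 'a, 'x) module_scheme \<Rightarrow> ('k, 'b, 'y) module_scheme \<Rightarrow>
    ('k, 'c, 'z) module_scheme \<Rightarrow> ('a \<Rightarrow> 'b \<Rightarrow> 'c) \<Rightarrow> bool"
  where "is_bilinear R M N P b \<longleftrightarrow>
    (\<forall>x\<in>carrier M. is_linear R N P (b x)) \<and> (\<forall>y\<in>carrier N. is_linear R M P (\<lambda>x. b x y))"

lemma is_linearI:
  assumes "\<And>x. x \<in> carrier M \<Longrightarrow> f x \<in> carrier N"
    and "\<And>x y. \<lbrakk>x \<in> carrier M; y \<in> carrier M\<rbrakk> \<Longrightarrow> f (x \<oplus>\<^bsub>M\<^esub> y) = f x \<oplus>\<^bsub>N\<^esub> f y"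
    and "\<And>c x. \<lbrakk>c \<in> carrier R; x \<in> carrier M\<rbrakk> \<Longrightarrow> f (c \<odot>\<^bsub>M\<^esub> x) = c \<odot>\<^bsub>N\<^esub> f x"
  shows "is_linear R M N f"
  using assms by (simp add: is_linear_def)

lemma is_linearD:
  assumes "is_linear R M N f"
  shows "x \<in> carrier M \<Longrightarrow> f x \<in> carrier N"
    and "\<lbrakk>x \<in> carrier M; y \<in> carrier M\<rbrakk> \<Longrightarrow> f (x \<oplus>\<^bsub>M\<^esub> y) = f x \<oplus>\<^bsub>N\<^esub> f y"
    and "\<lbrakk>c \<in> carrier R; x \<in> carrier M\<rbrakk> \<Longrightarrow> f (c \<odot>\<^bsub>M\<^esub> x) = c \<odot>\<^bsub>N\<^esub> f x"
  using assms by (simp_all add: is_linear_def)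

lemma is_bilinearI:
  assumes "\<And>x. x \<in> carrier M \<Longrightarrow> is_linear R N P (b x)"
    and "\<And>y. y \<in> carrier N \<Longrightarrow> is_linear R M P (\<lambda>x. b x y)"
  shows "is_bilinear R M N P b"
  using assms by (simp add: is_bilinear_def)

lemma is_bilinearD:
  assumes "is_bilinear R M N P b"
  shows "x \<in> carrier M \<Longrightarrow> is_linear R N P (b x)"
    and "y \<in> carrier N \<Longrightarrow> is_linear R M P (\<lambda>x. b x y)"
  using assms by (simp_all add: is_bilinear_def)

lemma is_bilinear_closed:
  "\<lbrakk>is_bilinear R M N P b; x \<in> carrier M; y \<in> carrier N\<rbrakk> \<Longrightarrow> b x y \<in> carrier P"
  by (meson is_bilinearD(1) is_linearD(1))

lemma is_linear_cong:
  assumes "module R M" and "is_linear R M N f" and "\<And>x. x \<in> carrier M \<Longrightarrow> f x = g x"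
  shows "is_linear R M N g"
proof -
  interpret M: module R M by fact
  show ?thesis
    using is_linearD[OF assms(2)] assms(3) by (simp add: is_linear_def)
qed

lemma linear_maps_iff:
  "f \<in> linear_maps R M N \<longleftrightarrow> is_linear R M N f \<and> f \<in> extensional (carrier M)"
  by (auto simp: linear_maps_def is_linear_def PiE_def)

lemma linear_maps_is_linear: "f \<in> linear_maps R M N \<Longrightarrow> is_linear R M N f"
  by (simp add: linear_maps_iff)

lemma restrict_linear_maps:
  assumes "module R M" and "is_linear R M N f"
  shows "restrict f (carrier M) \<in> linear_maps R M N"
  unfolding linear_maps_iff using is_linear_cong[OF assms, of "restrict f (carrier M)"] by simp

lemma linear_maps_eqI:
  assumes "f \<in> linear_maps R M N" and "g \<in> linear_maps R M N"
    and "\<And>x. x \<in> carrier M \<Longrightarrow> f x = g x"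
  shows "f = g"
  using assms by (meson extensionalityI linear_maps_iff)

lemma is_linear_id: "is_linear R M M (\<lambda>x. x)"
  by (simp add: is_linear_def)

lemma is_linear_comp:
  assumes "is_linear R M N f" and "is_linear R N P g"
  shows "is_linear R M P (\<lambda>x. g (f x))"
  using is_linearD[OF assms(1)] is_linearD[OF assms(2)] by (simp add: is_linear_def)

lemma module_zero_eqI:
  assumes "module R M" and "x \<in> carrier M" and "x \<oplus>\<^bsub>M\<^esub> x = x"
  shows "x = \<zero>\<^bsub>M\<^esub>"
proof -
  interpret M: module R M by fact
  show ?thesis using assms(2,3) M.M.add.r_cancel_one' by metis
qed

lemma is_linear_zero:
  assumes "module R M" and "module R N" and "is_linear R M N f"
  shows "f \<zero>\<^bsub>M\<^esub> = \<zero>\<^bsub>N\<^esub>"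
proof -
  interpret M: module R M by fact
  show ?thesis
    using is_linearD(1,2)[OF assms(3), of "\<zero>\<^bsub>M\<^esub>"] is_linearD(2)[OF assms(3), of "\<zero>\<^bsub>M\<^esub>" "\<zero>\<^bsub>M\<^esub>"]
    by (intro module_zero_eqI[OF assms(2)]) simp_all
qed

text \<open>Reduces negatives to scalars: compatibility with, or closure under, scalar
  multiplication then covers subtraction, which is why neither \<open>is_linear\<close> nor
  \<open>submoduleI_smult\<close> has a clause for it.\<close>

lemma module_minus_eq:
  assumes "module R M" and "x \<in> carrier M"
  shows "\<ominus>\<^bsub>M\<^esub> x = (\<ominus>\<^bsub>R\<^esub> \<one>\<^bsub>R\<^esub>) \<odot>\<^bsub>M\<^esub> x"
proof -
  interpret M: module R M by fact
  show ?thesis using assms(2) by (simp add: M.smult_l_minus)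
qed

lemma is_linear_minus:
  assumes "module R M" and "module R N" and "is_linear R M N f"
    and "x \<in> carrier M" and "y \<in> carrier M"
  shows "f (x \<ominus>\<^bsub>M\<^esub> y) = f x \<ominus>\<^bsub>N\<^esub> f y"
proof -
  interpret M: module R M by fact
  interpret N: module R N by fact
  show ?thesis
    using is_linearD[OF assms(3)] assms(4,5)
    by (simp add: a_minus_def module_minus_eq[OF assms(1)] module_minus_eq[OF assms(2)])
qed

lemma module_diff_zero_iff:
  assumes "module R M" and "x \<in> carrier M" and "y \<in> carrier M"
  shows "x \<ominus>\<^bsub>M\<^esub> y = \<zero>\<^bsub>M\<^esub> \<longleftrightarrow> x = y"
proof -
  interpret M: module R M by fact
  show ?thesis using assms(2,3)
    by (metis M.M.add.inv_closed M.M.minus_equality M.M.minus_minus M.M.r_neg a_minus_def)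
qed

lemma is_linear_add:
  assumes "module R N" and "is_linear R M N f" and "is_linear R M N g"
  shows "is_linear R M N (\<lambda>x. f x \<oplus>\<^bsub>N\<^esub> g x)"
proof -
  interpret N: module R N by fact
  show ?thesis
    using is_linearD[OF assms(2)] is_linearD[OF assms(3)]
    by (auto simp: is_linear_def N.smult_r_distr N.M.a_ac)
qed

lemma is_linear_smult:
  assumes "module R N" and "is_linear R M N f" and "c \<in> carrier R"
  shows "is_linear R M N (\<lambda>x. c \<odot>\<^bsub>N\<^esub> f x)"
proof -
  interpret N: module R N by fact
  show ?thesis
    using is_linearD[OF assms(2)] assms(3)
    by (auto simp: is_linear_def N.smult_r_distr N.smult_assoc1[symmetric] N.R.m_comm)
qed

lemma is_linear_const_zero:
  assumes "module R N"
  shows "is_linear R M N (\<lambda>x. \<zero>\<^bsub>N\<^esub>)"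
proof -
  interpret N: module R N by fact
  show ?thesis by (simp add: is_linear_def)
qed

section \<open>Submodules\<close>

lemma submoduleI_smult:
  assumes "module R M" and "H \<subseteq> carrier M" and "\<zero>\<^bsub>M\<^esub> \<in> H"
    and "\<And>x y. \<lbrakk>x \<in> H; y \<in> H\<rbrakk> \<Longrightarrow> x \<oplus>\<^bsub>M\<^esub> y \<in> H"
    and "\<And>c x. \<lbrakk>c \<in> carrier R; x \<in> H\<rbrakk> \<Longrightarrow> c \<odot>\<^bsub>M\<^esub> x \<in> H"
  shows "submodule H R M"
proof -
  interpret M: module R M by fact
  show ?thesis
    using assms(2-5) module_minus_eq[OF assms(1)] by (intro M.submoduleI) auto
qed

lemma submoduleD:
  assumes "submodule H R M"
  shows "H \<subseteq> carrier M" and "\<zero>\<^bsub>M\<^esub> \<in> H"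
    and "\<lbrakk>x \<in> H; y \<in> H\<rbrakk> \<Longrightarrow> x \<oplus>\<^bsub>M\<^esub> y \<in> H"
    and "\<lbrakk>c \<in> carrier R; x \<in> H\<rbrakk> \<Longrightarrow> c \<odot>\<^bsub>M\<^esub> x \<in> H"
  using submodule.axioms(1)[OF assms] submodule.smult_closed[OF assms] subgroup.subset
  by (fastforce dest: subgroup.one_closed subgroup.m_closed)+

lemma submodule_minus:
  assumes "module R M" and "submodule H R M" and "x \<in> H" and "y \<in> H"
  shows "x \<ominus>\<^bsub>M\<^esub> y \<in> H"
proof -
  interpret M: module R M by fact
  have "y \<in> carrier M" using submoduleD(1)[OF assms(2)] assms(4) by blast
  then show ?thesis
    using assms(3,4) unfolding a_minus_def module_minus_eq[OF assms(1) \<open>y \<in> carrier M\<close>]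
    by (intro submoduleD(3,4)[OF assms(2)]) auto
qed

lemma submodule_vimage:
  assumes "module R M" and "module R N" and "is_linear R M N f" and "submodule H R N"
  shows "submodule {x \<in> carrier M. f x \<in> H} R M"
proof -
  interpret M: module R M by fact
  show ?thesis
    using submoduleD[OF assms(4)] is_linearD[OF assms(3)] is_linear_zero[OF assms(1-3)]
    by (intro submoduleI_smult[OF assms(1)]) auto
qed

lemma submodule_image:
  assumes "module R M" and "module R N" and "is_linear R M N f" and "submodule H R M"
  shows "submodule (f ` H) R N"
proof -
  note H = submoduleD[OF assms(4)] and f = is_linearD[OF assms(3)]
  have HM: "x \<in> carrier M" if "x \<in> H" for x using H(1) that by blast
  show ?thesis
  proof (intro submoduleI_smult[OF assms(2)])
    show "f ` H \<subseteq> carrier N" using HM f(1) by blast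
    show "\<zero>\<^bsub>N\<^esub> \<in> f ` H" using is_linear_zero[OF assms(1-3)] H(2) by (metis imageI)
  next
    fix x y assume "x \<in> f ` H" "y \<in> f ` H"
    then obtain u v where "u \<in> H" "v \<in> H" "x = f u" "y = f v" by blast
    then have "x \<oplus>\<^bsub>N\<^esub> y = f (u \<oplus>\<^bsub>M\<^esub> v)" using f(2) HM by simp
    then show "x \<oplus>\<^bsub>N\<^esub> y \<in> f ` H" using H(3) \<open>u \<in> H\<close> \<open>v \<in> H\<close> by blast
  next
    fix c x assume c: "c \<in> carrier R" and "x \<in> f ` H"
    then obtain u where "u \<in> H" "x = f u" by blast
    then have "c \<odot>\<^bsub>N\<^esub> x = f (c \<odot>\<^bsub>M\<^esub> u)" using f(3) HM c by simp
    then show "c \<odot>\<^bsub>N\<^esub> x \<in> f ` H" using H(4) \<open>u \<in> H\<close> c by blast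
  qed
qed

text \<open>Turns agreement of two linear maps into membership in a submodule, the form in which the
  induction principles for free modules and tensor products can be applied.\<close>

lemma submodule_equalizer:
  assumes "module R M" and "module R N" and "is_linear R M N f" and "is_linear R M N g"
  shows "submodule {x \<in> carrier M. f x = g x} R M"
proof -
  interpret M: module R M by fact
  show ?thesis
    using is_linearD[OF assms(3)] is_linearD[OF assms(4)]
      is_linear_zero[OF assms(1-3)] is_linear_zero[OF assms(1,2,4)]
    by (intro submoduleI_smult[OF assms(1)]) auto
qed

lemma submodule_zero:
  assumes "module R M"
  shows "submodule {\<zero>\<^bsub>M\<^esub>} R M"
proof -
  interpret M: module R M by fact
  show ?thesis by (intro submoduleI_smult[OF assms]) auto
qed

lemma submodule_finsum:
  assumes "module R M" and "submodule H R M" and "finite A" and "\<And>i. i \<in> A \<Longrightarrow> f i \<in> H"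
  shows "(\<Oplus>\<^bsub>M\<^esub>i\<in>A. f i) \<in> H"
proof -
  interpret M: module R M by fact
  note H = submoduleD[OF assms(2)]
  from assms(3,4) show ?thesis
  proof (induction A rule: finite_induct)
    case empty then show ?case using H(2) by simp
  next
    case (insert a A)
    moreover have "f \<in> A \<rightarrow> carrier M" "f a \<in> carrier M" using insert.prems H(1) by blast+
    ultimately show ?case using H(3) by simp
  qed
qed

lemma gen_submodule_submodule:
  assumes "module R M" and "S \<subseteq> carrier M"
  shows "submodule (gen_submodule R M S) R M"
proof -
  interpret M: module R M by fact
  \<comment> \<open>The whole module is one of the submodules being intersected, so the family is
    nonempty and the intersection stays inside the carrier.\<close>
  have "submodule (carrier M) R M" by (rule M.carrier_is_submodule)
  then show ?thesis
    using assms(2) unfolding gen_submodule_def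
    by (intro submoduleI_smult[OF assms(1)]) (auto intro: submoduleD(2-4))
qed

lemma gen_submodule_subset: "S \<subseteq> gen_submodule R M S"
  unfolding gen_submodule_def by blast

lemma gen_submodule_incl: "x \<in> S \<Longrightarrow> x \<in> gen_submodule R M S"
  by (rule subsetD[OF gen_submodule_subset])

lemma gen_submodule_minimal: "\<lbrakk>submodule H R M; S \<subseteq> H\<rbrakk> \<Longrightarrow> gen_submodule R M S \<subseteq> H"
  unfolding gen_submodule_def by blast

section \<open>The module of linear maps\<close>

text \<open>The pointwise operations are cut off outside \<open>carrier M\<close> because
  \<open>linear_maps\<close> demands the value \<open>undefined\<close> there, which pointwise
  operations would not preserve.\<close>

definition hom_module ::
  "('k, 'r) ring_scheme \<Rightarrow> ('k, 'a, 'x) module_scheme \<Rightarrow> ('k, 'b, 'y) module_scheme \<Rightarrow> ('k, 'a \<Rightarrow> 'b) module"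
  where "hom_module R M N =
    \<lparr>carrier = linear_maps R M N, mult = undefined, one = undefined,
     zero = restrict (\<lambda>x. \<zero>\<^bsub>N\<^esub>) (carrier M),
     add = (\<lambda>f g. restrict (\<lambda>x. f x \<oplus>\<^bsub>N\<^esub> g x) (carrier M)),
     smult = (\<lambda>c f. restrict (\<lambda>x. c \<odot>\<^bsub>N\<^esub> f x) (carrier M))\<rparr>"

lemma hom_module_simps [simp]:
  "carrier (hom_module R M N) = linear_maps R M N"
  "x \<in> carrier M \<Longrightarrow> \<zero>\<^bsub>hom_module R M N\<^esub> x = \<zero>\<^bsub>N\<^esub>"
  "x \<in> carrier M \<Longrightarrow> (f \<oplus>\<^bsub>hom_module R M N\<^esub> g) x = f x \<oplus>\<^bsub>N\<^esub> g x"
  "x \<in> carrier M \<Longrightarrow> (c \<odot>\<^bsub>hom_module R M N\<^esub> f) x = c \<odot>\<^bsub>N\<^esub> f x"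
  by (simp_all add: hom_module_def)

lemma hom_module_module:
  assumes "module R M" and "module R N"
  shows "module R (hom_module R M N)"
proof -
  interpret M: module R M by fact
  interpret N: module R N by fact
  let ?H = "hom_module R M N"
  have zero: "\<zero>\<^bsub>?H\<^esub> \<in> carrier ?H"
    using restrict_linear_maps[OF assms(1) is_linear_const_zero[OF assms(2)]]
    by (simp add: hom_module_def)
  have add: "f \<oplus>\<^bsub>?H\<^esub> g \<in> carrier ?H" if "f \<in> carrier ?H" "g \<in> carrier ?H" for f g
    using that restrict_linear_maps[OF assms(1) is_linear_add[OF assms(2)], of f g]
    by (simp add: hom_module_def linear_maps_is_linear)
  have smult: "c \<odot>\<^bsub>?H\<^esub> f \<in> carrier ?H" if "c \<in> carrier R" "f \<in> carrier ?H" for c f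
    using that restrict_linear_maps[OF assms(1) is_linear_smult[OF assms(2)], of f c]
    by (simp add: hom_module_def linear_maps_is_linear)
  have closed: "f x \<in> carrier N" if "f \<in> carrier ?H" "x \<in> carrier M" for f x
    using that linear_maps_is_linear is_linearD(1) by fastforce
  have eqI: "f = g" if "f \<in> carrier ?H" "g \<in> carrier ?H" "\<And>x. x \<in> carrier M \<Longrightarrow> f x = g x" for f g
    using that linear_maps_eqI[of f R M N g] by simp
  show ?thesis
  proof (rule moduleI)
    show "cring R" ..
    show "abelian_group ?H"
    proof (rule abelian_groupI)
      \<comment> \<open>The negative of \<open>f\<close> is taken to be the scalar multiple by minus
        one, so that its linearity and extensionality come from closure under scalars.\<close>
      fix f assume f: "f \<in> carrier ?H"
      have "(\<ominus>\<^bsub>R\<^esub> \<one>\<^bsub>R\<^esub>) \<odot>\<^bsub>?H\<^esub> f \<oplus>\<^bsub>?H\<^esub> f = \<zero>\<^bsub>?H\<^esub>"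
        using f closed[OF f]
        by (intro eqI add smult zero)
          (simp_all add: module_minus_eq[OF assms(2), symmetric] N.M.l_neg)
      then show "\<exists>g\<in>carrier ?H. g \<oplus>\<^bsub>?H\<^esub> f = \<zero>\<^bsub>?H\<^esub>"
        using smult[OF _ f] by blast
    qed (use add zero in \<open>auto intro!: eqI simp: closed N.M.a_ac simp del: hom_module_simps(1)\<close>)
  qed (use add zero smult in \<open>auto intro!: eqI
      simp: closed N.smult_l_distr N.smult_r_distr N.smult_assoc1 simp del: hom_module_simps(1)\<close>)
qed

section \<open>Quotient modules\<close>

lemma submodule_abelian_subgroup:
  assumes "module R M" and "submodule N R M"
  shows "abelian_subgroup N M"
proof -
  interpret M: module R M by fact
  show ?thesis
    by (intro abelian_subgroupI3 additive_subgroupI submodule.axioms(1)[OF assms(2)]) unfold_locales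
qed

lemma coset_eq_iff:
  assumes "module R M" and "submodule N R M" and "x \<in> carrier M" and "y \<in> carrier M"
  shows "N +>\<^bsub>M\<^esub> x = N +>\<^bsub>M\<^esub> y \<longleftrightarrow> x \<ominus>\<^bsub>M\<^esub> y \<in> N"
proof -
  interpret N: abelian_subgroup N M by (rule submodule_abelian_subgroup[OF assms(1,2)])
  have "x \<in> N +>\<^bsub>M\<^esub> y \<longleftrightarrow> x \<ominus>\<^bsub>M\<^esub> y \<in> N"
    unfolding a_minus_def by (rule N.a_rcos_module[OF assms(4,3)])
  then show ?thesis
    using N.a_rcos_self[OF assms(3)] N.a_repr_independence'[OF _ assms(4), of x] by auto
qed

lemma quot_module_carrier:
  "carrier (quot_module M N) = (\<lambda>x. N +>\<^bsub>M\<^esub> x) ` carrier M"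
  by (auto simp: quot_module_def FactRing_def A_RCOSETS_defs a_r_coset_def)

lemma quot_module_zero: "\<zero>\<^bsub>quot_module M N\<^esub> = N"
  by (simp add: quot_module_def FactRing_def)

lemma quot_module_one: "\<one>\<^bsub>quot_module M N\<^esub> = N +>\<^bsub>M\<^esub> \<one>\<^bsub>M\<^esub>"
  by (simp add: quot_module_def FactRing_def)

lemma coset_zero:
  assumes "module R M" and "submodule N R M"
  shows "N +>\<^bsub>M\<^esub> \<zero>\<^bsub>M\<^esub> = N"
proof -
  interpret N: abelian_subgroup N M by (rule submodule_abelian_subgroup[OF assms])
  show ?thesis by (simp add: N.a_rcos_const)
qed

lemma coset_add:
  assumes "module R M" and "submodule N R M" and "x \<in> carrier M" and "y \<in> carrier M"
  shows "(N +>\<^bsub>M\<^esub> x) \<oplus>\<^bsub>quot_module M N\<^esub> (N +>\<^bsub>M\<^esub> y) = N +>\<^bsub>M\<^esub> (x \<oplus>\<^bsub>M\<^esub> y)"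
proof -
  interpret N: abelian_subgroup N M by (rule submodule_abelian_subgroup[OF assms(1,2)])
  show ?thesis using assms(3,4) by (simp add: quot_module_def FactRing_def N.a_rcos_sum)
qed

text \<open>The scalar action on cosets is defined as a union over representatives. It collapses to
  a single coset because \<open>c\<close> carries a difference lying in \<open>N\<close> to one
  lying in \<open>N\<close>.\<close>

lemma coset_smult:
  assumes "module R M" and "submodule N R M" and "c \<in> carrier R" and "x \<in> carrier M"
  shows "c \<odot>\<^bsub>quot_module M N\<^esub> (N +>\<^bsub>M\<^esub> x) = N +>\<^bsub>M\<^esub> (c \<odot>\<^bsub>M\<^esub> x)"
proof -
  interpret M: module R M by fact
  interpret N: abelian_subgroup N M by (rule submodule_abelian_subgroup[OF assms(1,2)])
  have "N +>\<^bsub>M\<^esub> (c \<odot>\<^bsub>M\<^esub> y) = N +>\<^bsub>M\<^esub> (c \<odot>\<^bsub>M\<^esub> x)" if "y \<in> N +>\<^bsub>M\<^esub> x" for y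
  proof -
    have y: "y \<in> carrier M" using that assms(4) N.a_elemrcos_carrier by blast
    then have "y \<ominus>\<^bsub>M\<^esub> x \<in> N" using that N.a_rcos_module[OF assms(4) y] by (simp add: a_minus_def)
    then have "c \<odot>\<^bsub>M\<^esub> (y \<ominus>\<^bsub>M\<^esub> x) \<in> N" using submoduleD(4)[OF assms(2)] assms(3) by blast
    moreover have "c \<odot>\<^bsub>M\<^esub> (y \<ominus>\<^bsub>M\<^esub> x) = c \<odot>\<^bsub>M\<^esub> y \<ominus>\<^bsub>M\<^esub> c \<odot>\<^bsub>M\<^esub> x"
      using y assms(3,4) by (simp add: a_minus_def M.smult_r_distr M.smult_r_minus)
    ultimately show ?thesis using coset_eq_iff[OF assms(1,2)] y assms(3,4) by simp
  qed
  moreover have "x \<in> N +>\<^bsub>M\<^esub> x" using assms(4) by (rule N.a_rcos_self)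
  ultimately have "(\<Union>y\<in>N +>\<^bsub>M\<^esub> x. N +>\<^bsub>M\<^esub> (c \<odot>\<^bsub>M\<^esub> y)) = N +>\<^bsub>M\<^esub> (c \<odot>\<^bsub>M\<^esub> x)"
    by (intro UN_constant_eq ballI)
  then show ?thesis unfolding quot_module_def by simp
qed

lemma is_linear_coset:
  assumes "module R M" and "submodule N R M"
  shows "is_linear R M (quot_module M N) (\<lambda>x. N +>\<^bsub>M\<^esub> x)"
  using coset_add[OF assms] coset_smult[OF assms]
  by (intro is_linearI) (auto simp: quot_module_carrier)

lemma quot_module_module:
  assumes "module R M" and "submodule N R M"
  shows "module R (quot_module M N)"
proof -
  interpret M: module R M by fact
  note [simp] = coset_add[OF assms] coset_smult[OF assms] quot_module_carrier
  have z: "\<zero>\<^bsub>quot_module M N\<^esub> = N +>\<^bsub>M\<^esub> \<zero>\<^bsub>M\<^esub>"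
    by (simp add: quot_module_zero coset_zero[OF assms])
  show ?thesis
  proof (rule moduleI)
    show "cring R" ..
    show "abelian_group (quot_module M N)"
    proof (rule abelian_groupI)
      fix X assume "X \<in> carrier (quot_module M N)"
      then obtain x where x: "x \<in> carrier M" "X = N +>\<^bsub>M\<^esub> x" by auto
      then have "(N +>\<^bsub>M\<^esub> (\<ominus>\<^bsub>M\<^esub> x)) \<oplus>\<^bsub>quot_module M N\<^esub> X = \<zero>\<^bsub>quot_module M N\<^esub>"
        by (simp add: z M.M.l_neg)
      then show "\<exists>Y\<in>carrier (quot_module M N). Y \<oplus>\<^bsub>quot_module M N\<^esub> X = \<zero>\<^bsub>quot_module M N\<^esub>"
        using x(1) by auto
    qed (auto simp: z M.M.a_ac)
  qed (auto simp: M.smult_l_distr M.smult_r_distr M.smult_assoc1)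
qed

lemma quot_module_lift:
  assumes "module R M" and "submodule N R M" and "module R P" and "is_linear R M P f"
    and "\<And>n. n \<in> N \<Longrightarrow> f n = \<zero>\<^bsub>P\<^esub>"
  shows "\<exists>h\<in>linear_maps R (quot_module M N) P. \<forall>x\<in>carrier M. h (N +>\<^bsub>M\<^esub> x) = f x"
proof -
  interpret M: module R M by fact
  \<comment> \<open>The value at a coset is read off an arbitrary representative; two
    representatives differ by an element of \<open>N\<close>, on which \<open>f\<close>
    vanishes.\<close>
  define h where "h X = f (SOME x. x \<in> carrier M \<and> X = N +>\<^bsub>M\<^esub> x)" for X
  have h: "h (N +>\<^bsub>M\<^esub> x) = f x" if x: "x \<in> carrier M" for x
  proof -
    define y where "y = (SOME y. y \<in> carrier M \<and> N +>\<^bsub>M\<^esub> x = N +>\<^bsub>M\<^esub> y)"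
    have y: "y \<in> carrier M \<and> N +>\<^bsub>M\<^esub> x = N +>\<^bsub>M\<^esub> y" unfolding y_def by (rule someI) (use x in simp)
    then have "x \<ominus>\<^bsub>M\<^esub> y \<in> N" using coset_eq_iff[OF assms(1,2) x] by blast
    then have "f x \<ominus>\<^bsub>P\<^esub> f y = \<zero>\<^bsub>P\<^esub>"
      using assms(5) is_linear_minus[OF assms(1,3,4) x] y by metis
    then have "f x = f y"
      using module_diff_zero_iff[OF assms(3)] is_linearD(1)[OF assms(4)] x y by blast
    then show ?thesis unfolding h_def y_def by simp
  qed
  have "is_linear R (quot_module M N) P h"
    using is_linearD[OF assms(4)]
    by (intro is_linearI)
      (auto simp: quot_module_carrier coset_add[OF assms(1,2)] coset_smult[OF assms(1,2)] h)
  then have "restrict h (carrier (quot_module M N)) \<in> linear_maps R (quot_module M N) P"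
    by (rule restrict_linear_maps[OF quot_module_module[OF assms(1,2)]])
  moreover have "restrict h (carrier (quot_module M N)) (N +>\<^bsub>M\<^esub> x) = f x" if "x \<in> carrier M" for x
    using that h by (simp add: quot_module_carrier)
  ultimately show ?thesis by blast
qed

section \<open>Free modules\<close>

lemma free_module_carrier_iff:
  "f \<in> carrier (free_module R X) \<longleftrightarrow>
    (\<forall>x. f x \<in> carrier R) \<and> finite {x. f x \<noteq> \<zero>\<^bsub>R\<^esub>} \<and> (\<forall>x. f x \<noteq> \<zero>\<^bsub>R\<^esub> \<longrightarrow> x \<in> X)"
  by (auto simp: free_module_def)

lemma free_module_ops [simp]:
  "(f \<oplus>\<^bsub>free_module R X\<^esub> g) x = f x \<oplus>\<^bsub>R\<^esub> g x"
  "\<zero>\<^bsub>free_module R X\<^esub> x = \<zero>\<^bsub>R\<^esub>"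
  "(c \<odot>\<^bsub>free_module R X\<^esub> f) x = c \<otimes>\<^bsub>R\<^esub> f x"
  by (simp_all add: free_module_def)

lemma free_module_module:
  assumes "cring R"
  shows "module R (free_module R X)"
proof -
  interpret R: cring R by fact
  let ?F = "free_module R X"
  have add: "f \<oplus>\<^bsub>?F\<^esub> g \<in> carrier ?F" if "f \<in> carrier ?F" "g \<in> carrier ?F" for f g
  proof -
    have "{x. f x \<oplus>\<^bsub>R\<^esub> g x \<noteq> \<zero>\<^bsub>R\<^esub>} \<subseteq> {x. f x \<noteq> \<zero>\<^bsub>R\<^esub>} \<union> {x. g x \<noteq> \<zero>\<^bsub>R\<^esub>}" by auto
    then have "finite {x. f x \<oplus>\<^bsub>R\<^esub> g x \<noteq> \<zero>\<^bsub>R\<^esub>}"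
      using that by (auto simp: free_module_carrier_iff intro: finite_subset)
    then show ?thesis using that by (force simp: free_module_carrier_iff)
  qed
  have smult: "c \<odot>\<^bsub>?F\<^esub> f \<in> carrier ?F" if "c \<in> carrier R" "f \<in> carrier ?F" for c f
  proof -
    have "{x. c \<otimes>\<^bsub>R\<^esub> f x \<noteq> \<zero>\<^bsub>R\<^esub>} \<subseteq> {x. f x \<noteq> \<zero>\<^bsub>R\<^esub>}" using that by auto
    then have "finite {x. c \<otimes>\<^bsub>R\<^esub> f x \<noteq> \<zero>\<^bsub>R\<^esub>}"
      using that by (auto simp: free_module_carrier_iff intro: finite_subset)
    then show ?thesis using that by (force simp: free_module_carrier_iff)
  qed
  have zero: "\<zero>\<^bsub>?F\<^esub> \<in> carrier ?F" by (simp add: free_module_carrier_iff)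
  have val: "f x \<in> carrier R" if "f \<in> carrier ?F" for f x
    using that by (simp add: free_module_carrier_iff)
  show ?thesis
  proof (rule moduleI)
    show "cring R" ..
    show "abelian_group ?F"
    proof (rule abelian_groupI)
      fix f assume f: "f \<in> carrier ?F"
      have "(\<ominus>\<^bsub>R\<^esub> \<one>\<^bsub>R\<^esub>) \<odot>\<^bsub>?F\<^esub> f \<oplus>\<^bsub>?F\<^esub> f = \<zero>\<^bsub>?F\<^esub>"
        using val[OF f] by (intro ext) (simp add: R.l_minus R.l_neg)
      then show "\<exists>g\<in>carrier ?F. g \<oplus>\<^bsub>?F\<^esub> f = \<zero>\<^bsub>?F\<^esub>" using smult[OF _ f] by blast
    qed (use add zero in \<open>auto intro!: ext simp: val R.a_ac\<close>)
  qed (use add smult in \<open>auto intro!: ext simp: val R.l_distr R.r_distr R.m_assoc\<close>)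
qed

lemma free_gen_closed:
  assumes "cring R" and "x \<in> X"
  shows "free_gen R x \<in> carrier (free_module R X)"
proof -
  interpret R: cring R by fact
  have "finite {y. free_gen R x y \<noteq> \<zero>\<^bsub>R\<^esub>}"
    by (rule finite_subset[of _ "{x}"]) (auto simp: free_gen_def)
  then show ?thesis using assms(2) by (auto simp: free_module_carrier_iff free_gen_def)
qed

text \<open>Induction on the support: resetting the value at one point \<open>a\<close> to zero
  shrinks the support, and adding back \<open>f a\<close> times the generator of \<open>a\<close>
  recovers \<open>f\<close>.\<close>

lemma free_module_induct:
  assumes "cring R" and "submodule H R (free_module R X)"
    and "\<And>x. x \<in> X \<Longrightarrow> free_gen R x \<in> H" and "f \<in> carrier (free_module R X)"
  shows "f \<in> H"
proof -
  interpret R: cring R by fact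
  note H = submoduleD[OF assms(2)]
  have "f \<in> H" if "finite A" "f \<in> carrier (free_module R X)" "{x. f x \<noteq> \<zero>\<^bsub>R\<^esub>} = A" for A f
    using that
  proof (induction A arbitrary: f rule: finite_induct)
    case empty
    then have "f = \<zero>\<^bsub>free_module R X\<^esub>" by (intro ext) auto
    with H(2) show ?case by (rule back_subst[OF _ sym])
  next
    case (insert a A)
    define g where "g = (\<lambda>x. if x = a then \<zero>\<^bsub>R\<^esub> else f x)"
    have f: "f x \<in> carrier R" "f x \<noteq> \<zero>\<^bsub>R\<^esub> \<Longrightarrow> x \<in> X" "f x \<noteq> \<zero>\<^bsub>R\<^esub> \<longleftrightarrow> x = a \<or> x \<in> A" for x
      using insert.prems unfolding free_module_carrier_iff by blast+
    note val = f(1)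
    have fa: "f a \<in> carrier R" "a \<in> X" using f(1)[of a] f(2,3)[of a] by blast+
    have gx: "g x \<noteq> \<zero>\<^bsub>R\<^esub> \<longleftrightarrow> x \<in> A" for x
      using f(3)[of x] insert.hyps(2) by (auto simp: g_def)
    then have sg: "{x. g x \<noteq> \<zero>\<^bsub>R\<^esub>} = A" by blast
    have "g x \<in> carrier R" for x using f(1) by (simp add: g_def)
    then have "g \<in> carrier (free_module R X)"
      using insert.hyps(1) sg gx f(2,3) unfolding free_module_carrier_iff by metis
    then have "g \<in> H" using insert.IH sg by blast
    moreover have "f a \<odot>\<^bsub>free_module R X\<^esub> free_gen R a \<in> H" using H(4) assms(3) fa by blast
    ultimately have "g \<oplus>\<^bsub>free_module R X\<^esub> (f a \<odot>\<^bsub>free_module R X\<^esub> free_gen R a) \<in> H" by (rule H(3))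
    moreover have "g \<oplus>\<^bsub>free_module R X\<^esub> (f a \<odot>\<^bsub>free_module R X\<^esub> free_gen R a) = f"
      using val by (intro ext) (simp add: g_def free_gen_def)
    ultimately show ?case by simp
  qed
  then show ?thesis using assms(4) by (auto simp: free_module_carrier_iff)
qed

lemma free_module_lift:
  assumes "module R N" and "\<And>x. x \<in> X \<Longrightarrow> f x \<in> carrier N"
  shows "\<exists>h\<in>linear_maps R (free_module R X) N. \<forall>x\<in>X. h (free_gen R x) = f x"
proof -
  interpret N: module R N by fact
  let ?F = "free_module R X"
  have F: "module R ?F" by (rule free_module_module) unfold_locales
  interpret F: module R ?F by (rule F)
  define h where "h \<phi> = (\<Oplus>\<^bsub>N\<^esub>x\<in>{x. \<phi> x \<noteq> \<zero>\<^bsub>R\<^esub>}. \<phi> x \<odot>\<^bsub>N\<^esub> f x)" for \<phi>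
  \<comment> \<open>Different functions have different supports; allowing any finite
    \<open>B\<close> that contains the support gives a common index set on which their sums can be
    compared.\<close>
  have h_eq: "h \<phi> = (\<Oplus>\<^bsub>N\<^esub>x\<in>B. \<phi> x \<odot>\<^bsub>N\<^esub> f x)"
    if "finite B" "{x. \<phi> x \<noteq> \<zero>\<^bsub>R\<^esub>} \<subseteq> B" "B \<subseteq> X" "\<And>x. \<phi> x \<in> carrier R" for \<phi> B
    unfolding h_def using that assms(2)
    by (intro N.M.add.finprod_mono_neutral_cong_left) (auto intro: N.smult_closed)
  have val: "\<phi> x \<in> carrier R" if "\<phi> \<in> carrier ?F" for \<phi> x
    using that by (simp add: free_module_carrier_iff)
  have terms: "(\<lambda>x. \<phi> x \<odot>\<^bsub>N\<^esub> f x) \<in> B \<rightarrow> carrier N" if "B \<subseteq> X" "\<phi> \<in> carrier ?F" for \<phi> B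
    using that assms(2) val by (auto intro!: N.smult_closed)
  have supp: "finite {x. \<phi> x \<noteq> \<zero>\<^bsub>R\<^esub>}" "{x. \<phi> x \<noteq> \<zero>\<^bsub>R\<^esub>} \<subseteq> X" if "\<phi> \<in> carrier ?F" for \<phi>
    using that by (auto simp: free_module_carrier_iff)
  have "is_linear R ?F N h"
  proof (rule is_linearI)
    fix \<phi> assume "\<phi> \<in> carrier ?F"
    then show "h \<phi> \<in> carrier N"
      unfolding h_def by (intro N.M.finsum_closed terms supp)
  next
    fix \<phi> \<psi> assume c: "\<phi> \<in> carrier ?F" "\<psi> \<in> carrier ?F"
    define B where "B = {x. \<phi> x \<noteq> \<zero>\<^bsub>R\<^esub>} \<union> {x. \<psi> x \<noteq> \<zero>\<^bsub>R\<^esub>}"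
    have B: "finite B" "B \<subseteq> X" "{x. \<phi> x \<noteq> \<zero>\<^bsub>R\<^esub>} \<subseteq> B" "{x. \<psi> x \<noteq> \<zero>\<^bsub>R\<^esub>} \<subseteq> B"
      "{x. (\<phi> \<oplus>\<^bsub>?F\<^esub> \<psi>) x \<noteq> \<zero>\<^bsub>R\<^esub>} \<subseteq> B"
      using supp[OF c(1)] supp[OF c(2)] by (auto simp: B_def)
    have "h (\<phi> \<oplus>\<^bsub>?F\<^esub> \<psi>) = (\<Oplus>\<^bsub>N\<^esub>x\<in>B. (\<phi> \<oplus>\<^bsub>?F\<^esub> \<psi>) x \<odot>\<^bsub>N\<^esub> f x)"
      using B c val by (intro h_eq) auto
    also have "\<dots> = (\<Oplus>\<^bsub>N\<^esub>x\<in>B. \<phi> x \<odot>\<^bsub>N\<^esub> f x \<oplus>\<^bsub>N\<^esub> \<psi> x \<odot>\<^bsub>N\<^esub> f x)"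
      using B(2) c val assms(2)
      by (intro N.M.finsum_cong') (auto simp: N.smult_l_distr intro!: N.M.a_closed N.smult_closed)
    also have "\<dots> = (\<Oplus>\<^bsub>N\<^esub>x\<in>B. \<phi> x \<odot>\<^bsub>N\<^esub> f x) \<oplus>\<^bsub>N\<^esub> (\<Oplus>\<^bsub>N\<^esub>x\<in>B. \<psi> x \<odot>\<^bsub>N\<^esub> f x)"
      using terms[OF B(2)] c by (intro N.M.finsum_addf) auto
    also have "\<dots> = h \<phi> \<oplus>\<^bsub>N\<^esub> h \<psi>"
      using B c val h_eq[of B \<phi>] h_eq[of B \<psi>] by simp
    finally show "h (\<phi> \<oplus>\<^bsub>?F\<^esub> \<psi>) = h \<phi> \<oplus>\<^bsub>N\<^esub> h \<psi>" .
  next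
    fix c \<phi> assume c: "c \<in> carrier R" "\<phi> \<in> carrier ?F"
    define B where "B = {x. \<phi> x \<noteq> \<zero>\<^bsub>R\<^esub>}"
    have B: "finite B" "B \<subseteq> X" using supp[OF c(2)] by (auto simp: B_def)
    have "h (c \<odot>\<^bsub>?F\<^esub> \<phi>) = (\<Oplus>\<^bsub>N\<^esub>x\<in>B. (c \<odot>\<^bsub>?F\<^esub> \<phi>) x \<odot>\<^bsub>N\<^esub> f x)"
      using B c val by (intro h_eq) (auto simp: B_def)
    also have "\<dots> = (\<Oplus>\<^bsub>N\<^esub>x\<in>B. c \<odot>\<^bsub>N\<^esub> (\<phi> x \<odot>\<^bsub>N\<^esub> f x))"
      using B(2) c val assms(2)
      by (intro N.M.finsum_cong') (auto simp: N.smult_assoc1 intro!: N.smult_closed)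
    also have "\<dots> = c \<odot>\<^bsub>N\<^esub> h \<phi>"
      unfolding h_def B_def[symmetric] using c B terms[OF B(2) c(2)]
      by (intro N.finsum_smult_ldistr[symmetric]) auto
    finally show "h (c \<odot>\<^bsub>?F\<^esub> \<phi>) = c \<odot>\<^bsub>N\<^esub> h \<phi>" .
  qed
  then have "restrict h (carrier ?F) \<in> linear_maps R ?F N" by (rule restrict_linear_maps[OF F])
  moreover have "restrict h (carrier ?F) (free_gen R x) = f x" if x: "x \<in> X" for x
  proof -
    \<comment> \<open>The index set is \<open>{x}\<close> rather than the support, which is empty
      when \<open>R\<close> is the zero ring.\<close>
    have "h (free_gen R x) = (\<Oplus>\<^bsub>N\<^esub>y\<in>{x}. free_gen R x y \<odot>\<^bsub>N\<^esub> f y)"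
      using x by (intro h_eq) (auto simp: free_gen_def)
    then show ?thesis
      using x assms(2) free_gen_closed[OF N.R.is_cring x] by (simp add: free_gen_def)
  qed
  ultimately show ?thesis by blast
qed

section \<open>Tensor products\<close>

lemma bilinear_relations_subset:
  assumes "module R M" and "module R N"
  shows "bilinear_relations R M N \<subseteq> carrier (free_module R (carrier M \<times> carrier N))"
proof -
  interpret M: module R M by fact
  interpret N: module R N by fact
  let ?F = "free_module R (carrier M \<times> carrier N)"
  interpret F: module R ?F by (rule free_module_module[OF M.R.is_cring])
  have "free_gen R (x, y) \<in> carrier ?F" if "x \<in> carrier M" "y \<in> carrier N" for x y
    using that by (intro free_gen_closed M.R.is_cring) simp
  then show ?thesis
    unfolding bilinear_relations_def Let_def
    by (auto intro!: F.M.minus_closed F.M.a_closed F.smult_closed M.M.a_closed N.M.a_closed)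
qed

lemma tensor_kernel_submodule:
  assumes "module R M" and "module R N"
  shows "submodule (tensor_kernel R M N) R (free_module R (carrier M \<times> carrier N))"
proof -
  interpret M: module R M by fact
  show ?thesis unfolding tensor_kernel_def
    by (rule gen_submodule_submodule[OF free_module_module[OF M.R.is_cring]
          bilinear_relations_subset[OF assms]])
qed

lemma tensor_prod_module:
  assumes "module R M" and "module R N"
  shows "module R (tensor_prod R M N)"
proof -
  interpret M: module R M by fact
  show ?thesis unfolding tensor_prod_def
    by (rule quot_module_module[OF free_module_module[OF M.R.is_cring] tensor_kernel_submodule[OF assms]])
qed

text \<open>Each clause of bilinearity is one of the four families of relations that generate the
  kernel; the chains of \<open>UnI1\<close> and \<open>UnI2\<close> select the family.\<close>

lemma pure_tensor_bilinear:
  assumes "module R M" and "module R N"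
  shows "is_bilinear R M N (tensor_prod R M N) (pure_tensor R M N)"
proof -
  interpret M: module R M by fact
  interpret N: module R N by fact
  let ?F = "free_module R (carrier M \<times> carrier N)"
  let ?K = "tensor_kernel R M N"
  note F = free_module_module[OF M.R.is_cring, of "carrier M \<times> carrier N"]
  note K = tensor_kernel_submodule[OF assms]
  interpret F: module R ?F by (rule F)
  have e: "free_gen R (x, y) \<in> carrier ?F" if "x \<in> carrier M" "y \<in> carrier N" for x y
    using that by (intro free_gen_closed M.R.is_cring) simp
  have rel: "\<phi> \<in> ?K" if "\<phi> \<in> bilinear_relations R M N" for \<phi>
    using that unfolding tensor_kernel_def by (rule gen_submodule_incl)
  have eq: "?K +>\<^bsub>?F\<^esub> \<phi> = ?K +>\<^bsub>?F\<^esub> \<psi>"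
    if "\<phi> \<ominus>\<^bsub>?F\<^esub> \<psi> \<in> bilinear_relations R M N" "\<phi> \<in> carrier ?F" "\<psi> \<in> carrier ?F" for \<phi> \<psi>
    using coset_eq_iff[OF F K that(2,3)] rel[OF that(1)] by blast
  note simps = pure_tensor_def tensor_prod_def coset_add[OF F K] coset_smult[OF F K] e
  have closed: "pure_tensor R M N x y \<in> carrier (tensor_prod R M N)"
    if "x \<in> carrier M" "y \<in> carrier N" for x y
    using e[OF that] by (simp add: pure_tensor_def tensor_prod_def quot_module_carrier)
  show ?thesis
  proof (intro is_bilinearI is_linearI closed)
    fix x y y' assume c: "x \<in> carrier M" "y \<in> carrier N" "y' \<in> carrier N"
    have "free_gen R (x, y \<oplus>\<^bsub>N\<^esub> y') \<ominus>\<^bsub>?F\<^esub> (free_gen R (x, y) \<oplus>\<^bsub>?F\<^esub> free_gen R (x, y'))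
        \<in> bilinear_relations R M N"
      unfolding bilinear_relations_def Let_def by (rule UnI1, rule UnI1, rule UnI2, use c in blast)
    from eq[OF this] show "pure_tensor R M N x (y \<oplus>\<^bsub>N\<^esub> y') =
        pure_tensor R M N x y \<oplus>\<^bsub>tensor_prod R M N\<^esub> pure_tensor R M N x y'"
      using c by (simp add: simps)
  next
    fix x c y assume c: "x \<in> carrier M" "c \<in> carrier R" "y \<in> carrier N"
    have "free_gen R (x, c \<odot>\<^bsub>N\<^esub> y) \<ominus>\<^bsub>?F\<^esub> (c \<odot>\<^bsub>?F\<^esub> free_gen R (x, y)) \<in> bilinear_relations R M N"
      unfolding bilinear_relations_def Let_def by (rule UnI2, use c in blast)
    from eq[OF this] show "pure_tensor R M N x (c \<odot>\<^bsub>N\<^esub> y) =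
        c \<odot>\<^bsub>tensor_prod R M N\<^esub> pure_tensor R M N x y"
      using c by (simp add: simps)
  next
    fix y x x' assume c: "y \<in> carrier N" "x \<in> carrier M" "x' \<in> carrier M"
    have "free_gen R (x \<oplus>\<^bsub>M\<^esub> x', y) \<ominus>\<^bsub>?F\<^esub> (free_gen R (x, y) \<oplus>\<^bsub>?F\<^esub> free_gen R (x', y))
        \<in> bilinear_relations R M N"
      unfolding bilinear_relations_def Let_def by (rule UnI1, rule UnI1, rule UnI1, use c in blast)
    from eq[OF this] show "pure_tensor R M N (x \<oplus>\<^bsub>M\<^esub> x') y =
        pure_tensor R M N x y \<oplus>\<^bsub>tensor_prod R M N\<^esub> pure_tensor R M N x' y"
      using c by (simp add: simps)
  next
    fix y c x assume c: "y \<in> carrier N" "c \<in> carrier R" "x \<in> carrier M"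
    have "free_gen R (c \<odot>\<^bsub>M\<^esub> x, y) \<ominus>\<^bsub>?F\<^esub> (c \<odot>\<^bsub>?F\<^esub> free_gen R (x, y)) \<in> bilinear_relations R M N"
      unfolding bilinear_relations_def Let_def by (rule UnI1, rule UnI2, use c in blast)
    from eq[OF this] show "pure_tensor R M N (c \<odot>\<^bsub>M\<^esub> x) y =
        c \<odot>\<^bsub>tensor_prod R M N\<^esub> pure_tensor R M N x y"
      using c by (simp add: simps)
  qed
qed

lemmas pure_tensor_closed = is_bilinear_closed[OF pure_tensor_bilinear]

text \<open>The preimage of \<open>H\<close> in the free module is a submodule, and it contains the
  free generators because their cosets are the pure tensors.\<close>

lemma tensor_prod_induct:
  assumes "module R M" and "module R N" and "submodule H R (tensor_prod R M N)"
    and "\<And>x y. \<lbrakk>x \<in> carrier M; y \<in> carrier N\<rbrakk> \<Longrightarrow> pure_tensor R M N x y \<in> H"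
    and "z \<in> carrier (tensor_prod R M N)"
  shows "z \<in> H"
proof -
  interpret M: module R M by fact
  let ?F = "free_module R (carrier M \<times> carrier N)"
  let ?K = "tensor_kernel R M N"
  note F = free_module_module[OF M.R.is_cring, of "carrier M \<times> carrier N"]
  note K = tensor_kernel_submodule[OF assms(1,2)]
  obtain \<phi> where \<phi>: "\<phi> \<in> carrier ?F" "z = ?K +>\<^bsub>?F\<^esub> \<phi>"
    using assms(5) by (auto simp: tensor_prod_def quot_module_carrier)
  have "submodule {\<phi> \<in> carrier ?F. ?K +>\<^bsub>?F\<^esub> \<phi> \<in> H} R ?F"
    using assms(3) unfolding tensor_prod_def
    by (intro submodule_vimage[OF F quot_module_module[OF F K] is_linear_coset[OF F K]])
  then have "\<phi> \<in> {\<phi> \<in> carrier ?F. ?K +>\<^bsub>?F\<^esub> \<phi> \<in> H}"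
  proof (rule free_module_induct[OF M.R.is_cring _ _ \<phi>(1)])
    fix p assume "p \<in> carrier M \<times> carrier N"
    then show "free_gen R p \<in> {\<phi> \<in> carrier ?F. ?K +>\<^bsub>?F\<^esub> \<phi> \<in> H}"
      using assms(4) free_gen_closed[OF M.R.is_cring, of p] by (auto simp: pure_tensor_def)
  qed
  then show ?thesis using \<phi>(2) by simp
qed

lemma tensor_prod_linear_eqI:
  assumes "module R M" and "module R N" and "module R P"
    and "is_linear R (tensor_prod R M N) P f" and "is_linear R (tensor_prod R M N) P g"
    and "\<And>x y. \<lbrakk>x \<in> carrier M; y \<in> carrier N\<rbrakk> \<Longrightarrow> f (pure_tensor R M N x y) = g (pure_tensor R M N x y)"
    and "z \<in> carrier (tensor_prod R M N)"
  shows "f z = g z"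
  using tensor_prod_induct[OF assms(1,2) submodule_equalizer[OF tensor_prod_module[OF assms(1,2)] assms(3-5)] _ assms(7)]
    assms(6) pure_tensor_closed[OF assms(1,2)] by blast

lemma tensor_prod_lift_ex:
  assumes "module R M" and "module R N" and "module R P" and "is_bilinear R M N P b"
  shows "\<exists>h\<in>linear_maps R (tensor_prod R M N) P.
    \<forall>x\<in>carrier M. \<forall>y\<in>carrier N. h (pure_tensor R M N x y) = b x y"
proof -
  interpret M: module R M by fact
  interpret N: module R N by fact
  interpret P: module R P by fact
  let ?F = "free_module R (carrier M \<times> carrier N)"
  let ?K = "tensor_kernel R M N"
  note F = free_module_module[OF M.R.is_cring, of "carrier M \<times> carrier N"]
  note K = tensor_kernel_submodule[OF assms(1,2)]
  interpret F: module R ?F by (rule F)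
  have b: "b x y \<in> carrier P" if "x \<in> carrier M" "y \<in> carrier N" for x y
    using is_bilinear_closed[OF assms(4) that] .
  have "\<exists>f\<in>linear_maps R ?F P. \<forall>p\<in>carrier M \<times> carrier N. f (free_gen R p) = b (fst p) (snd p)"
    using b by (intro free_module_lift[OF assms(3)]) auto
  then obtain f where f: "f \<in> linear_maps R ?F P"
    "\<forall>p\<in>carrier M \<times> carrier N. f (free_gen R p) = b (fst p) (snd p)" by blast
  have fe: "f (free_gen R (x, y)) = b x y" if "x \<in> carrier M" "y \<in> carrier N" for x y
    using f(2) that by auto
  note fl = linear_maps_is_linear[OF f(1)]
  note fD = is_linearD[OF fl] is_linear_minus[OF F assms(3) fl]
  have e: "free_gen R (x, y) \<in> carrier ?F" if "x \<in> carrier M" "y \<in> carrier N" for x y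
    using that by (intro free_gen_closed M.R.is_cring) simp
  \<comment> \<open>The kernel of \<open>f\<close>, written as the preimage of the zero submodule.
    By minimality of \<open>gen_submodule\<close> it contains the whole tensor kernel as soon as it
    contains the bilinear relations.\<close>
  have S: "submodule {\<phi> \<in> carrier ?F. f \<phi> \<in> {\<zero>\<^bsub>P\<^esub>}} R ?F"
    by (intro submodule_vimage[OF F assms(3) fl submodule_zero[OF assms(3)]])
  note bD = is_linearD(2,3)[OF is_bilinearD(1)[OF assms(4)]] is_linearD(2,3)[OF is_bilinearD(2)[OF assms(4)]]
  have "f \<phi> = \<zero>\<^bsub>P\<^esub>" if "\<phi> \<in> bilinear_relations R M N" for \<phi>
    using that unfolding bilinear_relations_def Let_def
    by (elim UnE CollectE exE conjE) (simp_all add: fD e fe module_diff_zero_iff[OF assms(3)] b bD)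
  then have "?K \<subseteq> {\<phi> \<in> carrier ?F. f \<phi> \<in> {\<zero>\<^bsub>P\<^esub>}}"
    unfolding tensor_kernel_def
    using bilinear_relations_subset[OF assms(1,2)] by (intro gen_submodule_minimal[OF S]) auto
  then have "f n = \<zero>\<^bsub>P\<^esub>" if "n \<in> ?K" for n using that by blast
  from quot_module_lift[OF F K assms(3) fl this] obtain h where h: "h \<in> linear_maps R (quot_module ?F ?K) P"
    "\<forall>\<phi>\<in>carrier ?F. h (?K +>\<^bsub>?F\<^esub> \<phi>) = f \<phi>"
    by blast
  then have "h \<in> linear_maps R (tensor_prod R M N) P"
    "\<forall>x\<in>carrier M. \<forall>y\<in>carrier N. h (pure_tensor R M N x y) = b x y"
    using e fe by (simp_all add: tensor_prod_def pure_tensor_def)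
  then show ?thesis by blast
qed

text \<open>Justifies the definite description: pure tensors span, and membership in
  \<open>linear_maps\<close> fixes the values outside the carrier, so the lift is unique as a HOL
  function.\<close>

lemma tensor_lift:
  assumes "module R M" and "module R N" and "module R P" and "is_bilinear R M N P b"
  shows "tensor_lift R M N P b \<in> linear_maps R (tensor_prod R M N) P"
    and "\<lbrakk>x \<in> carrier M; y \<in> carrier N\<rbrakk> \<Longrightarrow> tensor_lift R M N P b (pure_tensor R M N x y) = b x y"
proof -
  let ?Q = "\<lambda>h. h \<in> linear_maps R (tensor_prod R M N) P \<and>
    (\<forall>x\<in>carrier M. \<forall>y\<in>carrier N. h (pure_tensor R M N x y) = b x y)"
  from tensor_prod_lift_ex[OF assms] obtain h where h: "?Q h" by blast
  have "h' = h" if h': "?Q h'" for h'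
  proof (rule linear_maps_eqI)
    show "h' \<in> linear_maps R (tensor_prod R M N) P" "h \<in> linear_maps R (tensor_prod R M N) P"
      using h h' by simp_all
    then have l: "is_linear R (tensor_prod R M N) P h'" "is_linear R (tensor_prod R M N) P h"
      by (simp_all add: linear_maps_is_linear)
    show "h' z = h z" if "z \<in> carrier (tensor_prod R M N)" for z
    proof (rule tensor_prod_linear_eqI[OF assms(1-3) l _ that])
      fix x y assume "x \<in> carrier M" "y \<in> carrier N"
      then show "h' (pure_tensor R M N x y) = h (pure_tensor R M N x y)" using h h' by simp
    qed
  qed
  with h have "tensor_lift R M N P b = h"
    unfolding tensor_lift_def by (intro the_equality)
  then show "tensor_lift R M N P b \<in> linear_maps R (tensor_prod R M N) P"
    and "\<lbrakk>x \<in> carrier M; y \<in> carrier N\<rbrakk> \<Longrightarrow> tensor_lift R M N P b (pure_tensor R M N x y) = b x y"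
    using h by simp_all
qed

lemma pure_tensor_comp_bilinear:
  assumes "module R M'" and "module R N'" and "is_linear R M M' f" and "is_linear R N N' g"
  shows "is_bilinear R M N (tensor_prod R M' N') (\<lambda>x y. pure_tensor R M' N' (f x) (g y))"
proof (rule is_bilinearI)
  note p = pure_tensor_bilinear[OF assms(1,2)]
  fix x assume "x \<in> carrier M"
  then show "is_linear R N (tensor_prod R M' N') (\<lambda>y. pure_tensor R M' N' (f x) (g y))"
    by (intro is_linear_comp[OF assms(4)] is_bilinearD(1)[OF p] is_linearD(1)[OF assms(3)])
next
  note p = pure_tensor_bilinear[OF assms(1,2)]
  fix y assume "y \<in> carrier N"
  then have "g y \<in> carrier N'" by (rule is_linearD(1)[OF assms(4)])
  from is_linear_comp[OF assms(3) is_bilinearD(2)[OF p this]]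
  show "is_linear R M (tensor_prod R M' N') (\<lambda>x. pure_tensor R M' N' (f x) (g y))" .
qed

lemma tensor_map:
  assumes "module R M" and "module R N" and "module R M'" and "module R N'"
    and "is_linear R M M' f" and "is_linear R N N' g"
  shows "tensor_map R M N M' N' f g \<in> linear_maps R (tensor_prod R M N) (tensor_prod R M' N')"
    and "\<lbrakk>x \<in> carrier M; y \<in> carrier N\<rbrakk> \<Longrightarrow>
      tensor_map R M N M' N' f g (pure_tensor R M N x y) = pure_tensor R M' N' (f x) (g y)"
  unfolding tensor_map_def
  by (intro tensor_lift[OF assms(1,2) tensor_prod_module[OF assms(3,4)]
      pure_tensor_comp_bilinear[OF assms(3-6)]])+

text \<open>The image is a submodule, and it contains every pure tensor of the target because each
  factor lifts separately. Surjectivity is what makes a map on the target determined by its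
  composite with the tensor map.\<close>

lemma tensor_map_surj:
  assumes "module R M" and "module R N" and "module R M'" and "module R N'"
    and "is_linear R M M' f" and "is_linear R N N' g"
    and "f ` carrier M = carrier M'" and "g ` carrier N = carrier N'"
  shows "tensor_map R M N M' N' f g ` carrier (tensor_prod R M N) = carrier (tensor_prod R M' N')"
proof -
  let ?h = "tensor_map R M N M' N' f g"
  note h = tensor_map[OF assms(1-6)]
  note T = tensor_prod_module[OF assms(1,2)] and T' = tensor_prod_module[OF assms(3,4)]
  interpret T: module R "tensor_prod R M N" by (rule T)
  have S: "submodule (?h ` carrier (tensor_prod R M N)) R (tensor_prod R M' N')"
    by (rule submodule_image[OF T T' linear_maps_is_linear[OF h(1)] T.carrier_is_submodule])
  have "pure_tensor R M' N' x' y' \<in> ?h ` carrier (tensor_prod R M N)"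
    if "x' \<in> carrier M'" "y' \<in> carrier N'" for x' y'
  proof -
    have "x' \<in> f ` carrier M" "y' \<in> g ` carrier N" using that assms(7,8) by simp_all
    then obtain x y where "x \<in> carrier M" "y \<in> carrier N" "x' = f x" "y' = g y" by blast
    then show ?thesis using h(2)[of x y] pure_tensor_closed[OF assms(1,2), of x y] by force
  qed
  note pure = this
  have "carrier (tensor_prod R M' N') \<subseteq> ?h ` carrier (tensor_prod R M N)"
    by (rule subsetI, rule tensor_prod_induct[OF assms(3,4) S pure])
  then show ?thesis using submoduleD(1)[OF S] by (intro equalityI)
qed

lemma tensor_image_submodule:
  assumes "module R M" and "module R N" and "A \<subseteq> carrier M" and "B \<subseteq> carrier N"
  shows "submodule (tensor_image R M N A B) R (tensor_prod R M N)"
  unfolding tensor_image_def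
  using assms(3,4)
  by (intro gen_submodule_submodule tensor_prod_module assms(1,2))
    (auto intro!: pure_tensor_closed[OF assms(1,2)])

lemma pure_tensor_in_tensor_image:
  assumes "x \<in> A" and "y \<in> B"
  shows "pure_tensor R M N x y \<in> tensor_image R M N A B"
  unfolding tensor_image_def using assms by (intro gen_submodule_incl) blast

lemma tensor_image_minimal:
  assumes "submodule H R (tensor_prod R M N)"
    and "\<And>x y. \<lbrakk>x \<in> A; y \<in> B\<rbrakk> \<Longrightarrow> pure_tensor R M N x y \<in> H"
  shows "tensor_image R M N A B \<subseteq> H"
  unfolding tensor_image_def using assms(2) by (intro gen_submodule_minimal[OF assms(1)]) blast

section \<open>Associative algebras and their quotients\<close>

text \<open>Tensor and enveloping algebras are noncommutative in general, so compatibility of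
  scalars with the left factor and with the right factor are two separate conditions.\<close>

locale assoc_algebra = module R A + A?: ring A for R and A (structure) +
  assumes smult_mult_left: "\<lbrakk>c \<in> carrier R; x \<in> carrier A; y \<in> carrier A\<rbrakk> \<Longrightarrow>
      (c \<odot>\<^bsub>A\<^esub> x) \<otimes>\<^bsub>A\<^esub> y = c \<odot>\<^bsub>A\<^esub> (x \<otimes>\<^bsub>A\<^esub> y)"
    and smult_mult_right: "\<lbrakk>c \<in> carrier R; x \<in> carrier A; y \<in> carrier A\<rbrakk> \<Longrightarrow>
      x \<otimes>\<^bsub>A\<^esub> (c \<odot>\<^bsub>A\<^esub> y) = c \<odot>\<^bsub>A\<^esub> (x \<otimes>\<^bsub>A\<^esub> y)"

lemma assoc_algebra_module: "assoc_algebra R A \<Longrightarrow> module R A"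
  by (simp add: assoc_algebra_def)

lemma assoc_algebra_ring: "assoc_algebra R A \<Longrightarrow> ring A"
  by (simp add: assoc_algebra_def)

lemma assoc_algebra_mult_bilinear:
  assumes "assoc_algebra R A"
  shows "is_bilinear R A A A (\<lambda>x y. x \<otimes>\<^bsub>A\<^esub> y)"
proof -
  interpret A: assoc_algebra R A by fact
  show ?thesis
    by (intro is_bilinearI is_linearI)
      (auto simp: A.A.l_distr A.A.r_distr A.smult_mult_left A.smult_mult_right)
qed

text \<open>A scalar \<open>c\<close> acts as left multiplication by
  \<open>c \<odot> \<one>\<close>, so an ideal of the ring absorbs scalars as well.\<close>

lemma assoc_algebra_ideal_submodule:
  assumes "assoc_algebra R A" and "ideal I A"
  shows "submodule I R A"
proof -
  interpret A: assoc_algebra R A by fact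
  interpret I: ideal I A by fact
  show ?thesis
  proof (intro submoduleI_smult[OF assoc_algebra_module[OF assms(1)]])
    fix c x assume "c \<in> carrier R" "x \<in> I"
    moreover from this have "x \<in> carrier A" by simp
    ultimately have "(c \<odot>\<^bsub>A\<^esub> \<one>\<^bsub>A\<^esub>) \<otimes>\<^bsub>A\<^esub> x = c \<odot>\<^bsub>A\<^esub> x" by (simp add: A.smult_mult_left)
    moreover have "(c \<odot>\<^bsub>A\<^esub> \<one>\<^bsub>A\<^esub>) \<otimes>\<^bsub>A\<^esub> x \<in> I"
      using \<open>c \<in> carrier R\<close> \<open>x \<in> I\<close> by (intro I.I_l_closed) auto
    ultimately show "c \<odot>\<^bsub>A\<^esub> x \<in> I" by simp
  qed auto
qed

lemma coset_mult:
  assumes "assoc_algebra R A" and "ideal I A" and "x \<in> carrier A" and "y \<in> carrier A"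
  shows "(I +>\<^bsub>A\<^esub> x) \<otimes>\<^bsub>quot_module A I\<^esub> (I +>\<^bsub>A\<^esub> y) = I +>\<^bsub>A\<^esub> (x \<otimes>\<^bsub>A\<^esub> y)"
proof -
  interpret I: ideal I A by fact
  show ?thesis using assms(3,4) by (simp add: quot_module_def FactRing_def I.rcoset_mult_add)
qed

lemma quot_assoc_algebra:
  assumes "assoc_algebra R A" and "ideal I A"
  shows "assoc_algebra R (quot_module A I)"
proof -
  interpret A: assoc_algebra R A by fact
  note M = assoc_algebra_module[OF assms(1)] and S = assoc_algebra_ideal_submodule[OF assms]
  note Q = quot_module_module[OF M S]
  note [simp] = coset_mult[OF assms] coset_add[OF M S] coset_smult[OF M S]
    quot_module_carrier quot_module_one
  interpret Q: module R "quot_module A I" by (rule Q)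
  have "ring (quot_module A I)"
  proof (rule ringI)
    show "abelian_group (quot_module A I)" ..
    show "monoid (quot_module A I)"
      by (rule monoidI) (auto simp: A.A.m_assoc)
  qed (auto simp: A.A.l_distr A.A.r_distr)
  then show ?thesis
    by (intro assoc_algebra.intro Q assoc_algebra_axioms.intro)
      (auto simp: A.smult_mult_left A.smult_mult_right)
qed

text \<open>The elements acting as zero under a representation \<open>h\<close> form an ideal.\<close>

lemma representation_kills_ideal:
  assumes A: "assoc_algebra R A" and W: "module R W"
    and h: "\<And>f. f \<in> carrier W \<Longrightarrow> is_linear R A W (h f)"
    and hm: "\<And>f s t. \<lbrakk>f \<in> carrier W; s \<in> carrier A; t \<in> carrier A\<rbrakk> \<Longrightarrow> h f (s \<otimes>\<^bsub>A\<^esub> t) = h (h f t) s"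
    and h0: "\<And>s. s \<in> carrier A \<Longrightarrow> h \<zero>\<^bsub>W\<^esub> s = \<zero>\<^bsub>W\<^esub>"
    and S: "S \<subseteq> carrier A" "\<And>f s. \<lbrakk>f \<in> carrier W; s \<in> S\<rbrakk> \<Longrightarrow> h f s = \<zero>\<^bsub>W\<^esub>"
    and f: "f \<in> carrier W" and s: "s \<in> Idl\<^bsub>A\<^esub> S"
  shows "h f s = \<zero>\<^bsub>W\<^esub>"
proof -
  interpret A: assoc_algebra R A by (rule A)
  interpret W: module R W by (rule W)
  \<comment> \<open>Annihilating every vector, and not just one, gives closure under right
    multiplication: \<open>a \<otimes> x\<close> acts on \<open>f\<close> as \<open>a\<close> acts
    on the vector \<open>h f x\<close>. Closure under left multiplication uses
    \<open>h0\<close>.\<close>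
  let ?N = "{t \<in> carrier A. \<forall>f\<in>carrier W. h f t = \<zero>\<^bsub>W\<^esub>}"
  have zero: "h f \<zero>\<^bsub>A\<^esub> = \<zero>\<^bsub>W\<^esub>" if "f \<in> carrier W" for f
    using is_linear_zero[OF assoc_algebra_module[OF A] W h[OF that]] .
  have "submodule ?N R A"
    using zero is_linearD[OF h]
    by (intro submoduleI_smult[OF assoc_algebra_module[OF A]]) auto
  then have "subgroup ?N (add_monoid A)" by (rule submodule.axioms(1))
  then have "ideal ?N A"
  proof (rule idealI[OF assoc_algebra_ring[OF A]])
    fix a x assume a: "a \<in> ?N" and x: "x \<in> carrier A"
    then show "x \<otimes>\<^bsub>A\<^esub> a \<in> ?N" by (auto simp: hm h0)
    show "a \<otimes>\<^bsub>A\<^esub> x \<in> ?N" using a x is_linearD(1)[OF h] by (auto simp: hm)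
  qed
  moreover have "S \<subseteq> ?N" using S by blast
  ultimately have "Idl\<^bsub>A\<^esub> S \<subseteq> ?N" by (rule A.A.genideal_minimal)
  then show ?thesis using s f by blast
qed

section \<open>The free algebra\<close>

text \<open>Both sides sum \<open>F i j\<close> over the pairs with \<open>i + j \<le> n\<close>, on
  the left grouped by \<open>i + j\<close> and on the right by \<open>i\<close>. With the lengths of
  pieces of a word as indices, this is associativity of the convolution product.\<close>

lemma (in abelian_monoid) finsum_diagonal:
  assumes "\<And>i j :: nat. F i j \<in> carrier G"
  shows "(\<Oplus>k\<in>{..n}. \<Oplus>i\<in>{..k}. F i (k - i)) = (\<Oplus>i\<in>{..n}. \<Oplus>j\<in>{..n - i}. F i j)"
proof (induction n)
  case 0 then show ?case using assms by simp
next
  case (Suc n)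
  have "(\<Oplus>i\<in>{..n}. \<Oplus>j\<in>{..Suc n - i}. F i j) = (\<Oplus>i\<in>{..n}. F i (Suc n - i) \<oplus> (\<Oplus>j\<in>{..n - i}. F i j))"
    using assms by (intro finsum_cong') (auto simp: Suc_diff_le)
  also have "\<dots> = (\<Oplus>i\<in>{..n}. F i (Suc n - i)) \<oplus> (\<Oplus>i\<in>{..n}. \<Oplus>j\<in>{..n - i}. F i j)"
    using assms by (intro finsum_addf) auto
  finally show ?case using assms Suc by (simp add: a_ac)
qed

lemma free_algebra_simps [simp]:
  "carrier (free_algebra R X) = carrier (free_module R (lists X))"
  "\<zero>\<^bsub>free_algebra R X\<^esub> = \<zero>\<^bsub>free_module R (lists X)\<^esub>"
  "f \<oplus>\<^bsub>free_algebra R X\<^esub> g = f \<oplus>\<^bsub>free_module R (lists X)\<^esub> g"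
  "c \<odot>\<^bsub>free_algebra R X\<^esub> f = c \<odot>\<^bsub>free_module R (lists X)\<^esub> f"
  "\<one>\<^bsub>free_algebra R X\<^esub> = free_gen R []"
  "(f \<otimes>\<^bsub>free_algebra R X\<^esub> g) w = (\<Oplus>\<^bsub>R\<^esub>i\<in>{..length w}. f (take i w) \<otimes>\<^bsub>R\<^esub> g (drop i w))"
  by (simp_all add: free_algebra_def free_module_def)

text \<open>The free algebra differs from the free module on words only in \<open>mult\<close> and
  \<open>one\<close>, which linear maps and submodules do not see. This and the next two lemmas
  carry the results on free modules over.\<close>

lemma add_monoid_free_algebra:
  "add_monoid (free_algebra R X) = add_monoid (free_module R (lists X))"
  by (simp add: free_algebra_def)

lemma is_linear_free_algebra:
  "is_linear R (free_algebra R X) N f \<longleftrightarrow> is_linear R (free_module R (lists X)) N f"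
  by (simp add: is_linear_def)

lemma submodule_free_algebra:
  "submodule H R (free_algebra R X) \<longleftrightarrow> submodule H R (free_module R (lists X))"
  unfolding submodule_def submodule_axioms_def add_monoid_free_algebra by simp

lemma free_algebra_module:
  assumes "cring R"
  shows "module R (free_algebra R X)"
proof -
  interpret M: module R "free_module R (lists X)" by (rule free_module_module[OF assms])
  have "abelian_group (free_algebra R X)"
    by (intro comm_group_abelian_groupI, unfold add_monoid_free_algebra) (rule M.M.a_comm_group)
  then show ?thesis
    by (intro moduleI assms) (simp_all add: M.smult_l_distr M.smult_r_distr M.smult_assoc1)
qed

lemma free_algebra_mult_closed:
  assumes "cring R" and "f \<in> carrier (free_algebra R X)" and "g \<in> carrier (free_algebra R X)"
  shows "f \<otimes>\<^bsub>free_algebra R X\<^esub> g \<in> carrier (free_algebra R X)"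
proof -
  interpret R: cring R by fact
  let ?p = "f \<otimes>\<^bsub>free_algebra R X\<^esub> g"
  let ?S = "\<lambda>f. {w. f w \<noteq> \<zero>\<^bsub>R\<^esub>}"
  have val: "f w \<in> carrier R" "g w \<in> carrier R" for w
    using assms(2,3) by (simp_all add: free_module_carrier_iff)
  \<comment> \<open>The support of a product lies among the concatenations of words from the two
    supports, which gives finiteness and keeps all letters in \<open>X\<close>.\<close>
  have "\<exists>u\<in>?S f. \<exists>v\<in>?S g. w = u @ v" if "?p w \<noteq> \<zero>\<^bsub>R\<^esub>" for w
  proof (rule ccontr)
    assume n: "\<not> ?thesis"
    have "f (take i w) \<otimes>\<^bsub>R\<^esub> g (drop i w) = \<zero>\<^bsub>R\<^esub>" for i
    proof -
      have "f (take i w) = \<zero>\<^bsub>R\<^esub> \<or> g (drop i w) = \<zero>\<^bsub>R\<^esub>"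
        using n append_take_drop_id[of i w, symmetric] by blast
      then show ?thesis using val by auto
    qed
    then have "?p w = \<zero>\<^bsub>R\<^esub>" by simp
    then show False using that by simp
  qed
  note split = this
  then have sub: "?S ?p \<subseteq> (\<lambda>(u, v). u @ v) ` (?S f \<times> ?S g)" by force
  have "finite (?S f)" "finite (?S g)" using assms(2,3) by (simp_all add: free_module_carrier_iff)
  then have "finite (?S ?p)" by (intro finite_subset[OF sub]) simp
  moreover have "?p w \<in> carrier R" for w using val by simp
  moreover have "w \<in> lists X" if nz: "?p w \<noteq> \<zero>\<^bsub>R\<^esub>" for w
  proof -
    obtain u v where "f u \<noteq> \<zero>\<^bsub>R\<^esub>" "g v \<noteq> \<zero>\<^bsub>R\<^esub>" "w = u @ v" using split[OF nz] by blast
    then show ?thesis using assms(2,3) by (simp add: free_module_carrier_iff)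
  qed
  ultimately show ?thesis
    unfolding free_algebra_simps(1) free_module_carrier_iff by blast
qed

lemma free_algebra_assoc_algebra:
  assumes "cring R"
  shows "assoc_algebra R (free_algebra R X)"
proof -
  interpret R: cring R by fact
  let ?F = "free_algebra R X"
  note M = free_algebra_module[OF assms, of X]
  interpret M: module R ?F by (rule M)
  note closed = free_algebra_mult_closed[OF assms, of _ X]
  have val: "f w \<in> carrier R" if "f \<in> carrier ?F" for f w
    using that by (simp add: free_module_carrier_iff)
  have sums: "(\<lambda>i. F i) \<in> A \<rightarrow> carrier R" if "\<And>i. F i \<in> carrier R" for F and A :: "nat set"
    using that by simp
  have "ring ?F"
  proof (rule ringI)
    show "abelian_group ?F" ..
    show "monoid ?F"
    proof (rule monoidI)
      show "\<one>\<^bsub>?F\<^esub> \<in> carrier ?F" using free_gen_closed[OF assms, of "[]" "lists X"] by simp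
    next
      fix f g h assume c: "f \<in> carrier ?F" "g \<in> carrier ?F" "h \<in> carrier ?F"
      note v = val[OF c(1)] val[OF c(2)] val[OF c(3)]
      show "f \<otimes>\<^bsub>?F\<^esub> g \<otimes>\<^bsub>?F\<^esub> h = f \<otimes>\<^bsub>?F\<^esub> (g \<otimes>\<^bsub>?F\<^esub> h)"
      proof
        fix w
        \<comment> \<open>The contribution of cutting \<open>w\<close> into three pieces, of lengths
          \<open>i\<close> and \<open>j\<close> and the rest. Each bracketing of the triple product
          sums it over all cuts.\<close>
        define F where "F i j = f (take i w) \<otimes>\<^bsub>R\<^esub> (g (take j (drop i w)) \<otimes>\<^bsub>R\<^esub> h (drop (i + j) w))" for i j
        have F: "F i j \<in> carrier R" for i j using v by (simp add: F_def)
        have "(f \<otimes>\<^bsub>?F\<^esub> g \<otimes>\<^bsub>?F\<^esub> h) w = (\<Oplus>\<^bsub>R\<^esub>k\<in>{..length w}. \<Oplus>\<^bsub>R\<^esub>i\<in>{..k}. F i (k - i))"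
        proof (simp, intro R.finsum_cong' sums refl R.finsum_closed F)
          fix k assume k: "k \<in> {..length w}"
          then have l: "{..min (length w) k} = {..k}" by simp
          have "(\<Oplus>\<^bsub>R\<^esub>i\<in>{..k}. f (take i (take k w)) \<otimes>\<^bsub>R\<^esub> g (drop i (take k w))) \<otimes>\<^bsub>R\<^esub> h (drop k w)
            = (\<Oplus>\<^bsub>R\<^esub>i\<in>{..k}. f (take i (take k w)) \<otimes>\<^bsub>R\<^esub> g (drop i (take k w)) \<otimes>\<^bsub>R\<^esub> h (drop k w))"
            using v by (intro R.finsum_ldistr) auto
          also have "\<dots> = (\<Oplus>\<^bsub>R\<^esub>i\<in>{..k}. F i (k - i))"
            using v by (intro R.finsum_cong' sums F refl)
              (auto simp: F_def R.m_assoc drop_take min_def)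
          finally show "(\<Oplus>\<^bsub>R\<^esub>i\<in>{..min (length w) k}. f (take (min i k) w) \<otimes>\<^bsub>R\<^esub> g (drop i (take k w))) \<otimes>\<^bsub>R\<^esub> h (drop k w)
            = (\<Oplus>\<^bsub>R\<^esub>i\<in>{..k}. F i (k - i))"
            unfolding l by simp
        qed
        also have "\<dots> = (\<Oplus>\<^bsub>R\<^esub>i\<in>{..length w}. \<Oplus>\<^bsub>R\<^esub>j\<in>{..length w - i}. F i j)"
          by (rule R.finsum_diagonal[OF F])
        also have "\<dots> = (f \<otimes>\<^bsub>?F\<^esub> (g \<otimes>\<^bsub>?F\<^esub> h)) w"
        proof (simp, intro R.finsum_cong' sums refl R.m_closed R.finsum_closed v)
          fix i assume "i \<in> {..length w}"
          show "(\<Oplus>\<^bsub>R\<^esub>j\<in>{..length w - i}. F i j) = f (take i w) \<otimes>\<^bsub>R\<^esub>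
            (\<Oplus>\<^bsub>R\<^esub>j\<in>{..length w - i}. g (take j (drop i w)) \<otimes>\<^bsub>R\<^esub> h (drop (j + i) w))"
            using v unfolding F_def
            by (subst R.finsum_rdistr) (auto simp: add.commute)
        qed
        finally show "(f \<otimes>\<^bsub>?F\<^esub> g \<otimes>\<^bsub>?F\<^esub> h) w = (f \<otimes>\<^bsub>?F\<^esub> (g \<otimes>\<^bsub>?F\<^esub> h)) w" .
      qed
    next
      fix f assume f: "f \<in> carrier ?F"
      note v = val[OF f]
      show "\<one>\<^bsub>?F\<^esub> \<otimes>\<^bsub>?F\<^esub> f = f"
      proof
        fix w
        have "(\<one>\<^bsub>?F\<^esub> \<otimes>\<^bsub>?F\<^esub> f) w = (\<Oplus>\<^bsub>R\<^esub>i\<in>{..length w}. if 0 = i then f (drop i w) else \<zero>\<^bsub>R\<^esub>)"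
          unfolding free_algebra_simps
          by (intro R.finsum_cong') (auto simp: free_gen_def v)
        also have "\<dots> = f (drop 0 w)"
          using v by (intro R.add.finprod_singleton) auto
        finally show "(\<one>\<^bsub>?F\<^esub> \<otimes>\<^bsub>?F\<^esub> f) w = f w" by simp
      qed
      show "f \<otimes>\<^bsub>?F\<^esub> \<one>\<^bsub>?F\<^esub> = f"
      proof
        fix w
        have "(f \<otimes>\<^bsub>?F\<^esub> \<one>\<^bsub>?F\<^esub>) w = (\<Oplus>\<^bsub>R\<^esub>i\<in>{..length w}. if length w = i then f (take i w) else \<zero>\<^bsub>R\<^esub>)"
          unfolding free_algebra_simps
          by (intro R.finsum_cong') (auto simp: free_gen_def v)
        also have "\<dots> = f (take (length w) w)"
          using v by (intro R.add.finprod_singleton) auto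
        finally show "(f \<otimes>\<^bsub>?F\<^esub> \<one>\<^bsub>?F\<^esub>) w = f w" by simp
      qed
    qed (rule closed)
  next
    fix f g h assume c: "f \<in> carrier ?F" "g \<in> carrier ?F" "h \<in> carrier ?F"
    note v = val[OF c(1)] val[OF c(2)] val[OF c(3)]
    show "(f \<oplus>\<^bsub>?F\<^esub> g) \<otimes>\<^bsub>?F\<^esub> h = f \<otimes>\<^bsub>?F\<^esub> h \<oplus>\<^bsub>?F\<^esub> g \<otimes>\<^bsub>?F\<^esub> h"
      by (intro ext) (simp add: R.l_distr R.finsum_addf v)
    show "h \<otimes>\<^bsub>?F\<^esub> (f \<oplus>\<^bsub>?F\<^esub> g) = h \<otimes>\<^bsub>?F\<^esub> f \<oplus>\<^bsub>?F\<^esub> h \<otimes>\<^bsub>?F\<^esub> g"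
      by (intro ext) (simp add: R.r_distr R.finsum_addf v)
  qed
  moreover have "(c \<odot>\<^bsub>?F\<^esub> f) \<otimes>\<^bsub>?F\<^esub> g = c \<odot>\<^bsub>?F\<^esub> (f \<otimes>\<^bsub>?F\<^esub> g)" "f \<otimes>\<^bsub>?F\<^esub> (c \<odot>\<^bsub>?F\<^esub> g) = c \<odot>\<^bsub>?F\<^esub> (f \<otimes>\<^bsub>?F\<^esub> g)"
    if c: "c \<in> carrier R" "f \<in> carrier ?F" "g \<in> carrier ?F" for c f g
  proof -
    note v = val[OF c(2)] val[OF c(3)]
    show "(c \<odot>\<^bsub>?F\<^esub> f) \<otimes>\<^bsub>?F\<^esub> g = c \<odot>\<^bsub>?F\<^esub> (f \<otimes>\<^bsub>?F\<^esub> g)"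
      using c(1) by (intro ext) (simp add: R.finsum_rdistr v R.m_assoc)
    show "f \<otimes>\<^bsub>?F\<^esub> (c \<odot>\<^bsub>?F\<^esub> g) = c \<odot>\<^bsub>?F\<^esub> (f \<otimes>\<^bsub>?F\<^esub> g)"
      using c(1) by (intro ext) (simp add: R.finsum_rdistr v R.m_lcomm)
  qed
  ultimately show ?thesis
    by (intro assoc_algebra.intro M assoc_algebra_axioms.intro)
qed

text \<open>Only the cut of \<open>w\<close> after \<open>length u\<close> letters can return
  \<open>u\<close> and \<open>v\<close>, so the convolution sum has at most one nonzero
  term.\<close>

lemma free_gen_mult:
  assumes "cring R"
  shows "free_gen R u \<otimes>\<^bsub>free_algebra R X\<^esub> free_gen R v = free_gen R (u @ v)"
proof
  interpret R: cring R by fact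
  fix w
  have "(free_gen R u \<otimes>\<^bsub>free_algebra R X\<^esub> free_gen R v) w =
    (\<Oplus>\<^bsub>R\<^esub>i\<in>{..length w}. if take i w = u \<and> drop i w = v then \<one>\<^bsub>R\<^esub> else \<zero>\<^bsub>R\<^esub>)"
    unfolding free_algebra_simps by (intro R.finsum_cong') (auto simp: free_gen_def)
  also have "\<dots> = free_gen R (u @ v) w"
  proof (cases "w = u @ v")
    case True
    have "take i w = u \<and> drop i w = v \<longleftrightarrow> length u = i" if "i \<le> length w" for i
    proof
      assume "take i w = u \<and> drop i w = v"
      then have "length u = length (take i w)" by simp
      then show "length u = i" using that by simp
    qed (use True in auto)
    then have "(\<Oplus>\<^bsub>R\<^esub>i\<in>{..length w}. if take i w = u \<and> drop i w = v then \<one>\<^bsub>R\<^esub> else \<zero>\<^bsub>R\<^esub>) =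
      (\<Oplus>\<^bsub>R\<^esub>i\<in>{..length w}. if length u = i then \<one>\<^bsub>R\<^esub> else \<zero>\<^bsub>R\<^esub>)"
      by (intro R.finsum_cong') auto
    also have "\<dots> = \<one>\<^bsub>R\<^esub>"
      using True by (intro R.add.finprod_singleton) auto
    finally show ?thesis using True by (simp add: free_gen_def)
  next
    case False
    then have "\<not> (take i w = u \<and> drop i w = v)" for i
      using append_take_drop_id[of i w] by metis
    then have "(\<Oplus>\<^bsub>R\<^esub>i\<in>{..length w}. if take i w = u \<and> drop i w = v then \<one>\<^bsub>R\<^esub> else \<zero>\<^bsub>R\<^esub>) =
      (\<Oplus>\<^bsub>R\<^esub>i\<in>{..length w}. \<zero>\<^bsub>R\<^esub>)"
      by (intro R.finsum_cong') auto
    then show ?thesis using False by (simp add: free_gen_def)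
  qed
  finally show "(free_gen R u \<otimes>\<^bsub>free_algebra R X\<^esub> free_gen R v) w = free_gen R (u @ v) w" .
qed

section \<open>Algebras generated by a module\<close>

text \<open>Generation in one-sided form: starting from the unit, left multiplication by the
  \<open>i x\<close> and linear combinations reach everything. This is the shape of the recursion
  for the action, which peels one letter off the left.\<close>

definition left_generated ::
  "('k, 'r) ring_scheme \<Rightarrow> ('k, 'a, 'x) module_scheme \<Rightarrow> 'g set \<Rightarrow> ('g \<Rightarrow> 'a) \<Rightarrow> bool"
  where "left_generated R A X i \<longleftrightarrow>
    (\<forall>H. submodule H R A \<and> \<one>\<^bsub>A\<^esub> \<in> H \<and> (\<forall>x\<in>X. \<forall>t\<in>H. i x \<otimes>\<^bsub>A\<^esub> t \<in> H) \<longrightarrow> carrier A \<subseteq> H)"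

lemma left_generated_induct:
  assumes "left_generated R A X i" and "t \<in> carrier A" and "submodule H R A" and "\<one>\<^bsub>A\<^esub> \<in> H"
    and "\<And>x t. \<lbrakk>x \<in> X; t \<in> H\<rbrakk> \<Longrightarrow> i x \<otimes>\<^bsub>A\<^esub> t \<in> H"
  shows "t \<in> H"
  using assms unfolding left_generated_def by blast

text \<open>The index \<open>j\<close> is the parameter that the induction on \<open>t\<close> must
  leave free. Later \<open>J\<close> is the carrier of the Lie algebra, since the step for
  \<open>g\<close> calls the hypothesis at \<open>bracket L g x\<close>; accordingly the submodule
  collects the \<open>t\<close> on which all indices agree.\<close>

lemma left_generated_family_eqI:
  assumes A: "assoc_algebra R A" and P: "module R P" and gen: "left_generated R A X i"
    and f: "\<And>j. j \<in> J \<Longrightarrow> is_linear R A P (f j)" and g: "\<And>j. j \<in> J \<Longrightarrow> is_linear R A P (g j)"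
    and i: "\<And>x. x \<in> X \<Longrightarrow> i x \<in> carrier A"
    and one: "\<And>j. j \<in> J \<Longrightarrow> f j \<one>\<^bsub>A\<^esub> = g j \<one>\<^bsub>A\<^esub>"
    and step: "\<And>x t j. \<lbrakk>x \<in> X; t \<in> carrier A; j \<in> J; \<And>j. j \<in> J \<Longrightarrow> f j t = g j t\<rbrakk> \<Longrightarrow>
      f j (i x \<otimes>\<^bsub>A\<^esub> t) = g j (i x \<otimes>\<^bsub>A\<^esub> t)"
    and t: "t \<in> carrier A" and j: "j \<in> J"
  shows "f j t = g j t"
proof -
  interpret A: assoc_algebra R A by (rule A)
  have S: "submodule {t \<in> carrier A. \<forall>j\<in>J. f j t = g j t} R A"
    using is_linearD[OF f] is_linearD[OF g]
      is_linear_zero[OF assoc_algebra_module[OF A] P f] is_linear_zero[OF assoc_algebra_module[OF A] P g]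
    by (intro submoduleI_smult[OF assoc_algebra_module[OF A]]) auto
  have "t \<in> {t \<in> carrier A. \<forall>j\<in>J. f j t = g j t}"
    by (rule left_generated_induct[OF gen t S]) (use one step i in auto)
  then show ?thesis using j by simp
qed

lemma left_generated_linear_eqI:
  assumes "assoc_algebra R A" and "module R P" and "left_generated R A X i"
    and "is_linear R A P f" and "is_linear R A P g" and "\<And>x. x \<in> X \<Longrightarrow> i x \<in> carrier A"
    and "f \<one>\<^bsub>A\<^esub> = g \<one>\<^bsub>A\<^esub>"
    and "\<And>x t. \<lbrakk>x \<in> X; t \<in> carrier A; f t = g t\<rbrakk> \<Longrightarrow> f (i x \<otimes>\<^bsub>A\<^esub> t) = g (i x \<otimes>\<^bsub>A\<^esub> t)"
    and "t \<in> carrier A"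
  shows "f t = g t"
  by (rule left_generated_family_eqI[OF assms(1-3), where J = "{()}" and f = "\<lambda>_. f" and g = "\<lambda>_. g"])
    (use assms(4-9) in simp_all)

text \<open>A family \<open>h\<close> obeying the recursion of a representation is one: \<open>h f t\<close> is \<open>t\<close> acting on \<open>f\<close>.\<close>

lemma representation_mult:
  assumes A: "assoc_algebra R A" and W: "module R W" and gen: "left_generated R A X i"
    and i: "\<And>x. x \<in> X \<Longrightarrow> i x \<in> carrier A"
    and h: "\<And>f. f \<in> carrier W \<Longrightarrow> is_linear R A W (h f)"
    and h1: "\<And>f. f \<in> carrier W \<Longrightarrow> h f \<one>\<^bsub>A\<^esub> = f"
    and hx: "\<And>f x t. \<lbrakk>f \<in> carrier W; x \<in> X; t \<in> carrier A\<rbrakk> \<Longrightarrow> h f (i x \<otimes>\<^bsub>A\<^esub> t) = a x (h f t)"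
    and f: "f \<in> carrier W" and s: "s \<in> carrier A" and t: "t \<in> carrier A"
  shows "h f (s \<otimes>\<^bsub>A\<^esub> t) = h (h f t) s"
proof -
  interpret A: assoc_algebra R A by (rule A)
  have ft: "h f t \<in> carrier W" by (rule is_linearD(1)[OF h[OF f] t])
  show ?thesis
  proof (rule left_generated_linear_eqI[OF A W gen _ h[OF ft] i _ _ s])
    show "is_linear R A W (\<lambda>s. h f (s \<otimes>\<^bsub>A\<^esub> t))"
      by (rule is_linear_comp[OF is_bilinearD(2)[OF assoc_algebra_mult_bilinear[OF A] t] h[OF f]])
    show "h f (\<one>\<^bsub>A\<^esub> \<otimes>\<^bsub>A\<^esub> t) = h (h f t) \<one>\<^bsub>A\<^esub>" using t by (simp add: h1 ft)
  next
    fix x s assume x: "x \<in> X" and s: "s \<in> carrier A" and IH: "h f (s \<otimes>\<^bsub>A\<^esub> t) = h (h f t) s"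
    have "h f (i x \<otimes>\<^bsub>A\<^esub> s \<otimes>\<^bsub>A\<^esub> t) = h f (i x \<otimes>\<^bsub>A\<^esub> (s \<otimes>\<^bsub>A\<^esub> t))" using i[OF x] s t by (simp add: A.A.m_assoc)
    also have "\<dots> = a x (h (h f t) s)" using hx[OF f x] s t IH by simp
    also have "\<dots> = h (h f t) (i x \<otimes>\<^bsub>A\<^esub> s)" using hx[OF ft x s] by simp
    finally show "h f (i x \<otimes>\<^bsub>A\<^esub> s \<otimes>\<^bsub>A\<^esub> t) = h (h f t) (i x \<otimes>\<^bsub>A\<^esub> s)" .
  qed
qed

text \<open>The orbits of a sum or a multiple obey the same recursion as the sum or multiple of the
  orbits, because each \<open>a x\<close> is linear. It is needed because the starting vector of the
  orbit will depend linearly on \<open>m\<close>.\<close>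

lemma representation_linear:
  assumes A: "assoc_algebra R A" and W: "module R W" and gen: "left_generated R A X i"
    and i: "\<And>x. x \<in> X \<Longrightarrow> i x \<in> carrier A"
    and h: "\<And>f. f \<in> carrier W \<Longrightarrow> is_linear R A W (h f)"
    and h1: "\<And>f. f \<in> carrier W \<Longrightarrow> h f \<one>\<^bsub>A\<^esub> = f"
    and hx: "\<And>f x t. \<lbrakk>f \<in> carrier W; x \<in> X; t \<in> carrier A\<rbrakk> \<Longrightarrow> h f (i x \<otimes>\<^bsub>A\<^esub> t) = a x (h f t)"
    and a: "\<And>x. x \<in> X \<Longrightarrow> is_linear R W W (a x)"
    and t: "t \<in> carrier A"
  shows "is_linear R W W (\<lambda>f. h f t)"
proof (rule is_linearI)
  interpret A: assoc_algebra R A by (rule A)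
  interpret W: module R W by (rule W)
  note hc = is_linearD(1)[OF h]
  show "h f t \<in> carrier W" if "f \<in> carrier W" for f using hc[OF that t] .
  show "h (f \<oplus>\<^bsub>W\<^esub> g) t = h f t \<oplus>\<^bsub>W\<^esub> h g t" if f: "f \<in> carrier W" and g: "g \<in> carrier W" for f g
    by (rule left_generated_linear_eqI[OF A W gen h[OF W.M.a_closed[OF f g]]
          is_linear_add[OF W h[OF f] h[OF g]] i _ _ t])
      (use f g in \<open>simp_all add: h1 hx is_linearD(2)[OF a] hc\<close>)
  show "h (c \<odot>\<^bsub>W\<^esub> f) t = c \<odot>\<^bsub>W\<^esub> h f t" if c: "c \<in> carrier R" and f: "f \<in> carrier W" for c f
    by (rule left_generated_linear_eqI[OF A W gen h[OF W.smult_closed[OF c f]]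
          is_linear_smult[OF W h[OF f] c] i _ _ t])
      (use f c in \<open>simp_all add: h1 hx is_linearD(3)[OF a] hc\<close>)
qed

section \<open>The tensor algebra\<close>

lemma linear_maps_free_algebra:
  "linear_maps R (free_algebra R X) N = linear_maps R (free_module R (lists X)) N"
  by (auto simp: linear_maps_iff is_linear_free_algebra)

lemma linear_relations_subset:
  assumes "module R M"
  shows "linear_relations R M \<subseteq> carrier (free_algebra R (carrier M))"
proof -
  interpret M: module R M by fact
  interpret F: module R "free_algebra R (carrier M)" by (rule free_algebra_module[OF M.R.is_cring])
  have e: "free_gen R [x] \<in> carrier (free_algebra R (carrier M))" if "x \<in> carrier M" for x
    using that free_gen_closed[OF M.R.is_cring, of "[x]" "lists (carrier M)"] by simp
  show ?thesis
  proof
    fix \<phi> assume "\<phi> \<in> linear_relations R M"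
    then show "\<phi> \<in> carrier (free_algebra R (carrier M))"
      unfolding linear_relations_def Let_def
      by (elim UnE CollectE exE conjE)
        (simp_all add: e F.M.minus_closed F.M.a_closed F.smult_closed del: free_algebra_simps)
  qed
qed

lemma tensor_ideal_ideal:
  assumes "module R M"
  shows "ideal (tensor_ideal R M) (free_algebra R (carrier M))"
proof -
  interpret M: module R M by fact
  interpret F: assoc_algebra R "free_algebra R (carrier M)"
    by (rule free_algebra_assoc_algebra[OF M.R.is_cring])
  show ?thesis unfolding tensor_ideal_def
    by (rule F.A.genideal_ideal[OF linear_relations_subset[OF assms]])
qed

lemma tensor_algebra_assoc_algebra:
  assumes "module R M"
  shows "assoc_algebra R (tensor_algebra R M)"
proof -
  interpret M: module R M by fact
  show ?thesis unfolding tensor_algebra_def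
    by (rule quot_assoc_algebra[OF free_algebra_assoc_algebra[OF M.R.is_cring] tensor_ideal_ideal[OF assms]])
qed

lemmas tensor_algebra_module = assoc_algebra_module[OF tensor_algebra_assoc_algebra]

lemma tensor_ideal_submodule:
  assumes "module R M"
  shows "submodule (tensor_ideal R M) R (free_algebra R (carrier M))"
proof -
  interpret M: module R M by fact
  show ?thesis
    by (rule assoc_algebra_ideal_submodule[OF free_algebra_assoc_algebra[OF M.R.is_cring] tensor_ideal_ideal[OF assms]])
qed

lemma tensor_algebra_coset_linear:
  assumes "module R M"
  shows "is_linear R (free_algebra R (carrier M)) (tensor_algebra R M)
    (\<lambda>\<phi>. tensor_ideal R M +>\<^bsub>free_algebra R (carrier M)\<^esub> \<phi>)"
proof -
  interpret M: module R M by fact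
  show ?thesis unfolding tensor_algebra_def
    by (rule is_linear_coset[OF free_algebra_module[OF M.R.is_cring] tensor_ideal_submodule[OF assms]])
qed

lemma free_word_closed:
  assumes "module R M" and "w \<in> lists (carrier M)"
  shows "free_gen R w \<in> carrier (free_algebra R (carrier M))"
  using free_gen_closed[OF module.axioms(1)[OF assms(1)] assms(2)] by simp

text \<open>The defects of additivity and homogeneity are exactly the generators of
  \<open>tensor_ideal\<close>, so they vanish in the quotient.\<close>

lemma tensor_incl_linear:
  assumes "module R M"
  shows "is_linear R M (tensor_algebra R M) (tensor_incl R M)"
proof -
  interpret M: module R M by fact
  let ?F = "free_algebra R (carrier M)"
  let ?I = "tensor_ideal R M"
  note F = free_algebra_module[OF M.R.is_cring, of "carrier M"]
  note S = tensor_ideal_submodule[OF assms]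
  note ql = tensor_algebra_coset_linear[OF assms]
  interpret F: module R ?F by (rule F)
  have e: "free_gen R [x] \<in> carrier ?F" if "x \<in> carrier M" for x
    using that by (intro free_word_closed[OF assms]) simp
  have rel: "\<phi> \<in> ?I" if "\<phi> \<in> linear_relations R M" for \<phi>
    using that unfolding tensor_ideal_def genideal_def by blast
  have eq: "?I +>\<^bsub>?F\<^esub> \<phi> = ?I +>\<^bsub>?F\<^esub> \<psi>"
    if "\<phi> \<ominus>\<^bsub>?F\<^esub> \<psi> \<in> linear_relations R M" "\<phi> \<in> carrier ?F" "\<psi> \<in> carrier ?F" for \<phi> \<psi>
    using coset_eq_iff[OF F S that(2,3)] rel[OF that(1)] by blast
  show ?thesis
  proof (rule is_linearI)
    fix x assume "x \<in> carrier M"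
    then show "tensor_incl R M x \<in> carrier (tensor_algebra R M)"
      unfolding tensor_incl_def by (intro is_linearD(1)[OF ql] e)
  next
    fix x y assume c: "x \<in> carrier M" "y \<in> carrier M"
    have "free_gen R [x \<oplus>\<^bsub>M\<^esub> y] \<ominus>\<^bsub>?F\<^esub> (free_gen R [x] \<oplus>\<^bsub>?F\<^esub> free_gen R [y]) \<in> linear_relations R M"
      unfolding linear_relations_def Let_def by (rule UnI1, use c in blast)
    from eq[OF this e] have "tensor_incl R M (x \<oplus>\<^bsub>M\<^esub> y) = ?I +>\<^bsub>?F\<^esub> (free_gen R [x] \<oplus>\<^bsub>?F\<^esub> free_gen R [y])"
      unfolding tensor_incl_def using c e by (simp add: F.M.a_closed del: free_algebra_simps)
    then show "tensor_incl R M (x \<oplus>\<^bsub>M\<^esub> y) = tensor_incl R M x \<oplus>\<^bsub>tensor_algebra R M\<^esub> tensor_incl R M y"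
      using is_linearD(2)[OF ql e e, OF c] by (simp add: tensor_incl_def)
  next
    fix k x assume c: "k \<in> carrier R" "x \<in> carrier M"
    have "free_gen R [k \<odot>\<^bsub>M\<^esub> x] \<ominus>\<^bsub>?F\<^esub> (k \<odot>\<^bsub>?F\<^esub> free_gen R [x]) \<in> linear_relations R M"
      unfolding linear_relations_def Let_def by (rule UnI2, use c in blast)
    from eq[OF this e] have "tensor_incl R M (k \<odot>\<^bsub>M\<^esub> x) = ?I +>\<^bsub>?F\<^esub> (k \<odot>\<^bsub>?F\<^esub> free_gen R [x])"
      unfolding tensor_incl_def using c e by (simp add: F.smult_closed del: free_algebra_simps)
    then show "tensor_incl R M (k \<odot>\<^bsub>M\<^esub> x) = k \<odot>\<^bsub>tensor_algebra R M\<^esub> tensor_incl R M x"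
      using is_linearD(3)[OF ql c(1) e, OF c(2)] by (simp add: tensor_incl_def)
  qed
qed

lemma tensor_algebra_coset_Cons:
  assumes "module R M" and "x \<in> carrier M" and "w \<in> lists (carrier M)"
  shows "tensor_incl R M x \<otimes>\<^bsub>tensor_algebra R M\<^esub>
      (tensor_ideal R M +>\<^bsub>free_algebra R (carrier M)\<^esub> free_gen R w) =
    tensor_ideal R M +>\<^bsub>free_algebra R (carrier M)\<^esub> free_gen R (x # w)"
proof -
  interpret M: module R M by fact
  have e: "free_gen R [x] \<in> carrier (free_algebra R (carrier M))"
    using assms(2) by (intro free_word_closed[OF assms(1)]) simp
  show ?thesis
    unfolding tensor_incl_def tensor_algebra_def
      coset_mult[OF free_algebra_assoc_algebra[OF M.R.is_cring] tensor_ideal_ideal[OF assms(1)]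
        e free_word_closed[OF assms(1,3)]]
      free_gen_mult[OF M.R.is_cring]
    by simp
qed

lemma tensor_algebra_one:
  "\<one>\<^bsub>tensor_algebra R M\<^esub> = tensor_ideal R M +>\<^bsub>free_algebra R (carrier M)\<^esub> free_gen R []"
  by (simp add: tensor_algebra_def quot_module_one)

lemma tensor_algebra_carrier:
  "carrier (tensor_algebra R M) =
    (\<lambda>\<phi>. tensor_ideal R M +>\<^bsub>free_algebra R (carrier M)\<^esub> \<phi>) ` carrier (free_algebra R (carrier M))"
  unfolding tensor_algebra_def by (rule quot_module_carrier)

text \<open>Classes of words span, and each word arises from the empty one by adjoining letters on
  the left.\<close>

lemma tensor_algebra_left_generated:
  assumes "module R M"
  shows "left_generated R (tensor_algebra R M) (carrier M) (tensor_incl R M)"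
  unfolding left_generated_def
proof (intro allI impI subsetI, elim conjE)
  interpret M: module R M by fact
  let ?F = "free_algebra R (carrier M)"
  let ?I = "tensor_ideal R M"
  fix H z
  assume H: "submodule H R (tensor_algebra R M)" "\<one>\<^bsub>tensor_algebra R M\<^esub> \<in> H"
    "\<forall>x\<in>carrier M. \<forall>t\<in>H. tensor_incl R M x \<otimes>\<^bsub>tensor_algebra R M\<^esub> t \<in> H"
    and "z \<in> carrier (tensor_algebra R M)"
  then obtain \<phi> where \<phi>: "\<phi> \<in> carrier ?F" "z = ?I +>\<^bsub>?F\<^esub> \<phi>"
    by (auto simp: tensor_algebra_carrier)
  have word: "?I +>\<^bsub>?F\<^esub> free_gen R w \<in> H" if "w \<in> lists (carrier M)" for w
    using that
  proof (induction w rule: lists.induct)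
    case Nil then show ?case using H(2) by (simp add: tensor_algebra_one)
  next
    case (Cons x w)
    then show ?case using H(3) tensor_algebra_coset_Cons[OF assms Cons.hyps] by metis
  qed
  have "submodule {\<phi> \<in> carrier ?F. ?I +>\<^bsub>?F\<^esub> \<phi> \<in> H} R ?F"
    by (rule submodule_vimage[OF free_algebra_module[OF M.R.is_cring] tensor_algebra_module[OF assms]
          tensor_algebra_coset_linear[OF assms] H(1)])
  then have "submodule {\<phi> \<in> carrier ?F. ?I +>\<^bsub>?F\<^esub> \<phi> \<in> H} R (free_module R (lists (carrier M)))"
    by (simp add: submodule_free_algebra)
  then have "\<phi> \<in> {\<phi> \<in> carrier ?F. ?I +>\<^bsub>?F\<^esub> \<phi> \<in> H}"
    by (rule free_module_induct[OF M.R.is_cring])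
      (use word free_word_closed[OF assms] \<phi>(1) in simp_all)
  then show "z \<in> H" using \<phi>(2) by simp
qed

text \<open>The universal property of the tensor algebra in the language of modules: any bilinear
  action of \<open>M\<close> on \<open>W\<close> extends to the tensor algebra. A word acts by
  applying its letters from the last to the first, and the linear relations act as zero because
  \<open>a\<close> is linear in its first argument.\<close>

lemma tensor_algebra_representation:
  assumes M: "module R M" and W: "module R W" and a: "is_bilinear R M W W a"
  shows "\<exists>h. \<forall>f\<in>carrier W. h f \<in> linear_maps R (tensor_algebra R M) W \<and>
    h f \<one>\<^bsub>tensor_algebra R M\<^esub> = f \<and>
    (\<forall>x\<in>carrier M. \<forall>t\<in>carrier (tensor_algebra R M).
      h f (tensor_incl R M x \<otimes>\<^bsub>tensor_algebra R M\<^esub> t) = a x (h f t))"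
proof -
  interpret M: module R M by (rule M)
  interpret W: module R W by (rule W)
  let ?F = "free_algebra R (carrier M)"
  let ?T = "tensor_algebra R M"
  let ?I = "tensor_ideal R M"
  let ?q = "\<lambda>\<phi>. ?I +>\<^bsub>?F\<^esub> \<phi>"
  note AF = free_algebra_assoc_algebra[OF M.R.is_cring, of "carrier M"]
  note F = assoc_algebra_module[OF AF]
  interpret F: assoc_algebra R ?F by (rule AF)
  note e = free_word_closed[OF M]
  have act: "foldr a w f \<in> carrier W" if "w \<in> lists (carrier M)" "f \<in> carrier W" for w f
    using that by (induction w rule: lists.induct) (auto intro!: is_bilinear_closed[OF a])
  have "\<exists>H\<in>linear_maps R ?F W. \<forall>w\<in>lists (carrier M). H (free_gen R w) = foldr a w f"
    if "f \<in> carrier W" for f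
    using free_module_lift[OF W, of "lists (carrier M)" "\<lambda>w. foldr a w f"] act[OF _ that]
    by (simp add: linear_maps_free_algebra)
  then obtain H where H: "\<And>f. f \<in> carrier W \<Longrightarrow> H f \<in> linear_maps R ?F W"
    and Hw: "\<And>f w. \<lbrakk>f \<in> carrier W; w \<in> lists (carrier M)\<rbrakk> \<Longrightarrow> H f (free_gen R w) = foldr a w f"
    by metis
  note Hl = linear_maps_is_linear[OF H]
  have ind: "g \<phi> = g' \<phi>"
    if "is_linear R ?F W g" "is_linear R ?F W g'" "\<phi> \<in> carrier ?F"
      "\<And>w. w \<in> lists (carrier M) \<Longrightarrow> g (free_gen R w) = g' (free_gen R w)" for g g' \<phi>
  proof -
    have "submodule {\<phi> \<in> carrier ?F. g \<phi> = g' \<phi>} R (free_module R (lists (carrier M)))"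
      using submodule_equalizer[OF F W that(1,2)] by (simp add: submodule_free_algebra)
    then have "\<phi> \<in> {\<phi> \<in> carrier ?F. g \<phi> = g' \<phi>}"
      by (rule free_module_induct[OF M.R.is_cring]) (use that(3,4) e in simp_all)
    then show ?thesis by simp
  qed
  note mult = assoc_algebra_mult_bilinear[OF AF]
  have fold_linear: "is_linear R W W (foldr a w)" if "w \<in> lists (carrier M)" for w
    using that
  proof (induction w rule: lists.induct)
    case Nil then show ?case by (simp add: is_linear_def)
  next
    case (Cons x w)
    then show ?case using is_linear_comp[OF Cons.IH is_bilinearD(1)[OF a Cons.hyps(1)]]
      by (simp add: comp_def)
  qed
  have H_word: "H f (free_gen R u \<otimes>\<^bsub>?F\<^esub> \<phi>) = foldr a u (H f \<phi>)"
    if f: "f \<in> carrier W" and u: "u \<in> lists (carrier M)" and \<phi>: "\<phi> \<in> carrier ?F" for f u \<phi>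
  proof (rule ind[OF _ _ \<phi>])
    show "is_linear R ?F W (\<lambda>\<phi>. H f (free_gen R u \<otimes>\<^bsub>?F\<^esub> \<phi>))"
      by (rule is_linear_comp[OF is_bilinearD(1)[OF mult e[OF u]] Hl[OF f]])
    show "is_linear R ?F W (\<lambda>\<phi>. foldr a u (H f \<phi>))"
      by (rule is_linear_comp[OF Hl[OF f] fold_linear[OF u]])
    fix w assume "w \<in> lists (carrier M)"
    then show "H f (free_gen R u \<otimes>\<^bsub>?F\<^esub> free_gen R w) = foldr a u (H f (free_gen R w))"
      using f u by (simp add: free_gen_mult[OF M.R.is_cring] Hw)
  qed
  \<comment> \<open>Multiplicativity is established already on the free algebra, because it is what
    lets the annihilator of \<open>W\<close> absorb the ideal generated by the relations.\<close>
  have H_mult: "H f (\<phi> \<otimes>\<^bsub>?F\<^esub> \<psi>) = H (H f \<psi>) \<phi>"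
    if f: "f \<in> carrier W" and \<phi>: "\<phi> \<in> carrier ?F" and \<psi>: "\<psi> \<in> carrier ?F" for f \<phi> \<psi>
  proof -
    have g: "H f \<psi> \<in> carrier W" by (rule is_linearD(1)[OF Hl[OF f] \<psi>])
    show ?thesis
    proof (rule ind[OF _ Hl[OF g] \<phi>])
      show "is_linear R ?F W (\<lambda>\<phi>. H f (\<phi> \<otimes>\<^bsub>?F\<^esub> \<psi>))"
        by (rule is_linear_comp[OF is_bilinearD(2)[OF mult \<psi>] Hl[OF f]])
      show "H f (free_gen R w \<otimes>\<^bsub>?F\<^esub> \<psi>) = H (H f \<psi>) (free_gen R w)"
        if "w \<in> lists (carrier M)" for w
        using H_word[OF f that \<psi>] Hw[OF g that] by simp
    qed
  qed
  \<comment> \<open>\<open>H f\<close> was chosen separately for each \<open>f\<close>, so nothing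
    is known yet about the dependence on \<open>f\<close>. Its value at the zero vector suffices for
    the annihilator to be a left ideal.\<close>
  have H_zero: "H \<zero>\<^bsub>W\<^esub> \<phi> = \<zero>\<^bsub>W\<^esub>" if "\<phi> \<in> carrier ?F" for \<phi>
    by (rule ind[OF Hl[OF W.M.zero_closed] is_linear_const_zero[OF W] that])
      (simp add: Hw[OF W.M.zero_closed] is_linear_zero[OF W W fold_linear])
  note fD = is_linearD(2,3)[OF Hl] is_linear_minus[OF F W Hl]
  note aD = is_linearD(2,3)[OF is_bilinearD(2)[OF a]] is_bilinear_closed[OF a]
  have rel: "H f \<phi> = \<zero>\<^bsub>W\<^esub>" if f: "f \<in> carrier W" and \<phi>: "\<phi> \<in> linear_relations R M" for f \<phi>
  proof -
    have x: "free_gen R [x] \<in> carrier ?F" "H f (free_gen R [x]) = a x f" if "x \<in> carrier M" for x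
      using that e[of "[x]"] Hw[OF f, of "[x]"] by simp_all
    show ?thesis
      using \<phi> f unfolding linear_relations_def Let_def
      by (elim UnE CollectE exE conjE)
        (simp_all add: fD x aD module_diff_zero_iff[OF W] F.M.a_closed F.smult_closed
          del: free_algebra_simps)
  qed
  have kill: "H f n = \<zero>\<^bsub>W\<^esub>" if "f \<in> carrier W" "n \<in> ?I" for f n
    by (rule representation_kills_ideal[OF AF W Hl H_mult H_zero linear_relations_subset[OF M] rel
          that(1) that(2)[unfolded tensor_ideal_def]])
  have "\<exists>h\<in>linear_maps R ?T W. \<forall>\<phi>\<in>carrier ?F. h (?q \<phi>) = H f \<phi>" if f: "f \<in> carrier W" for f
    unfolding tensor_algebra_def
    by (rule quot_module_lift[OF F tensor_ideal_submodule[OF M] W Hl[OF f] kill[OF f]])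
  then obtain h where h: "\<And>f. f \<in> carrier W \<Longrightarrow> h f \<in> linear_maps R ?T W"
    and hq: "\<And>f \<phi>. \<lbrakk>f \<in> carrier W; \<phi> \<in> carrier ?F\<rbrakk> \<Longrightarrow> h f (?q \<phi>) = H f \<phi>"
    by metis
  have one: "h f \<one>\<^bsub>?T\<^esub> = f" if "f \<in> carrier W" for f
    using that e[of "[]"] Hw[of f "[]"] by (simp add: tensor_algebra_one hq)
  have step: "h f (tensor_incl R M x \<otimes>\<^bsub>?T\<^esub> t) = a x (h f t)"
    if f: "f \<in> carrier W" and x: "x \<in> carrier M" and t: "t \<in> carrier ?T" for f x t
  proof -
    obtain \<phi> where \<phi>: "\<phi> \<in> carrier ?F" "t = ?q \<phi>" using t by (auto simp: tensor_algebra_carrier)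
    have x': "free_gen R [x] \<in> carrier ?F" using e[of "[x]"] x by simp
    have "tensor_incl R M x \<otimes>\<^bsub>?T\<^esub> t = ?q (free_gen R [x] \<otimes>\<^bsub>?F\<^esub> \<phi>)"
      unfolding \<phi>(2) tensor_incl_def tensor_algebra_def
      by (rule coset_mult[OF AF tensor_ideal_ideal[OF M] x' \<phi>(1)])
    then have "h f (tensor_incl R M x \<otimes>\<^bsub>?T\<^esub> t) = H f (free_gen R [x] \<otimes>\<^bsub>?F\<^esub> \<phi>)"
      using hq[OF f F.A.m_closed[OF x' \<phi>(1)]] by simp
    also have "\<dots> = a x (H f \<phi>)" using H_word[OF f, of "[x]" \<phi>] x \<phi>(1) by simp
    finally show ?thesis using hq[OF f \<phi>(1)] \<phi>(2) by simp
  qed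
  show ?thesis using h one step by blast
qed

section \<open>Universal enveloping algebras\<close>

lemma lie_algebra_module: "lie_algebra R L \<Longrightarrow> module R L"
  by (simp add: lie_algebra_def)

lemma uea_relations_subset:
  assumes "lie_algebra R L"
  shows "{(tensor_incl R L x \<otimes>\<^bsub>tensor_algebra R L\<^esub> tensor_incl R L y
      \<ominus>\<^bsub>tensor_algebra R L\<^esub> tensor_incl R L y \<otimes>\<^bsub>tensor_algebra R L\<^esub> tensor_incl R L x)
      \<ominus>\<^bsub>tensor_algebra R L\<^esub> tensor_incl R L (bracket L x y) | x y.
      x \<in> carrier L \<and> y \<in> carrier L} \<subseteq> carrier (tensor_algebra R L)"
proof -
  interpret L: lie_algebra R L by fact
  interpret T: assoc_algebra R "tensor_algebra R L"
    by (rule tensor_algebra_assoc_algebra[OF lie_algebra_module[OF assms]])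
  show ?thesis
    using is_linearD(1)[OF tensor_incl_linear[OF lie_algebra_module[OF assms]]] L.bracket_closed
    by auto
qed

lemma uea_ideal_ideal:
  assumes "lie_algebra R L"
  shows "ideal (uea_ideal R L) (tensor_algebra R L)"
proof -
  interpret T: assoc_algebra R "tensor_algebra R L"
    by (rule tensor_algebra_assoc_algebra[OF lie_algebra_module[OF assms]])
  show ?thesis unfolding uea_ideal_def Let_def
    by (rule T.A.genideal_ideal[OF uea_relations_subset[OF assms]])
qed

lemma uea_assoc_algebra:
  assumes "lie_algebra R L"
  shows "assoc_algebra R (uea R L)"
  unfolding uea_def
  by (rule quot_assoc_algebra[OF tensor_algebra_assoc_algebra[OF lie_algebra_module[OF assms]]
        uea_ideal_ideal[OF assms]])

lemmas uea_module = assoc_algebra_module[OF uea_assoc_algebra]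

lemma uea_ideal_submodule:
  assumes "lie_algebra R L"
  shows "submodule (uea_ideal R L) R (tensor_algebra R L)"
  by (rule assoc_algebra_ideal_submodule[OF tensor_algebra_assoc_algebra[OF lie_algebra_module[OF assms]]
        uea_ideal_ideal[OF assms]])

lemma uea_proj_linear:
  assumes "lie_algebra R L"
  shows "is_linear R (tensor_algebra R L) (uea R L) (uea_proj R L)"
  unfolding uea_def uea_proj_def
  by (rule is_linear_coset[OF tensor_algebra_module[OF lie_algebra_module[OF assms]]
        uea_ideal_submodule[OF assms]])

lemma uea_proj_mult:
  assumes "lie_algebra R L" and "s \<in> carrier (tensor_algebra R L)" and "t \<in> carrier (tensor_algebra R L)"
  shows "uea_proj R L (s \<otimes>\<^bsub>tensor_algebra R L\<^esub> t) = uea_proj R L s \<otimes>\<^bsub>uea R L\<^esub> uea_proj R L t"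
  unfolding uea_def uea_proj_def
  by (rule coset_mult[OF tensor_algebra_assoc_algebra[OF lie_algebra_module[OF assms(1)]]
        uea_ideal_ideal[OF assms(1)] assms(2,3), symmetric])

lemma uea_proj_one: "uea_proj R L \<one>\<^bsub>tensor_algebra R L\<^esub> = \<one>\<^bsub>uea R L\<^esub>"
  by (simp add: uea_def uea_proj_def quot_module_one)

lemma uea_proj_surj: "uea_proj R L ` carrier (tensor_algebra R L) = carrier (uea R L)"
  unfolding uea_def uea_proj_def by (rule quot_module_carrier[symmetric])

lemma uea_incl_linear:
  assumes "lie_algebra R L"
  shows "is_linear R L (uea R L) (uea_incl R L)"
  unfolding uea_incl_def
  by (rule is_linear_comp[OF tensor_incl_linear[OF lie_algebra_module[OF assms]] uea_proj_linear[OF assms]])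

lemma uea_incl_bracket:
  assumes "lie_algebra R L" and "x \<in> carrier L" and "y \<in> carrier L"
  shows "uea_incl R L (bracket L x y) =
    uea_incl R L x \<otimes>\<^bsub>uea R L\<^esub> uea_incl R L y \<ominus>\<^bsub>uea R L\<^esub> uea_incl R L y \<otimes>\<^bsub>uea R L\<^esub> uea_incl R L x"
proof -
  interpret L: lie_algebra R L by fact
  let ?T = "tensor_algebra R L"
  let ?i = "tensor_incl R L"
  note M = lie_algebra_module[OF assms(1)]
  interpret T: assoc_algebra R ?T by (rule tensor_algebra_assoc_algebra[OF M])
  note p = uea_proj_linear[OF assms(1)]
  have i: "?i z \<in> carrier ?T" if "z \<in> carrier L" for z
    using is_linearD(1)[OF tensor_incl_linear[OF M] that] .
  note xy = i[OF assms(2)] i[OF assms(3)]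
  note b = i[OF L.bracket_closed[OF assms(2,3)]]
  have "(?i x \<otimes>\<^bsub>?T\<^esub> ?i y \<ominus>\<^bsub>?T\<^esub> ?i y \<otimes>\<^bsub>?T\<^esub> ?i x) \<ominus>\<^bsub>?T\<^esub> ?i (bracket L x y) \<in> uea_ideal R L"
    unfolding uea_ideal_def Let_def
    by (rule subsetD[OF T.A.genideal_self[OF uea_relations_subset[OF assms(1)]]]) (use assms(2,3) in blast)
  then have "uea_proj R L (?i x \<otimes>\<^bsub>?T\<^esub> ?i y \<ominus>\<^bsub>?T\<^esub> ?i y \<otimes>\<^bsub>?T\<^esub> ?i x) = uea_proj R L (?i (bracket L x y))"
    unfolding uea_proj_def
    using coset_eq_iff[OF tensor_algebra_module[OF M] uea_ideal_submodule[OF assms(1)] _ b] xy by simp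
  then show ?thesis
    using xy unfolding uea_incl_def
    by (simp add: is_linear_minus[OF tensor_algebra_module[OF M] uea_module[OF assms(1)] p]
        uea_proj_mult[OF assms(1)])
qed

text \<open>The property passes to a quotient: the preimage of \<open>H\<close> in the tensor
  algebra contains the unit and absorbs left multiplication by letters, hence is everything.\<close>

lemma uea_left_generated:
  assumes "lie_algebra R L"
  shows "left_generated R (uea R L) (carrier L) (uea_incl R L)"
  unfolding left_generated_def
proof (intro allI impI subsetI, elim conjE)
  let ?T = "tensor_algebra R L" and ?U = "uea R L"
  note M = lie_algebra_module[OF assms]
  fix H z
  assume H: "submodule H R ?U" "\<one>\<^bsub>?U\<^esub> \<in> H" "\<forall>x\<in>carrier L. \<forall>t\<in>H. uea_incl R L x \<otimes>\<^bsub>?U\<^esub> t \<in> H"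
    and "z \<in> carrier ?U"
  then obtain t where t: "t \<in> carrier ?T" "z = uea_proj R L t"
    unfolding uea_proj_surj[symmetric] by blast
  interpret T: assoc_algebra R ?T by (rule tensor_algebra_assoc_algebra[OF M])
  have "t \<in> {t \<in> carrier ?T. uea_proj R L t \<in> H}"
  proof (rule left_generated_induct[OF tensor_algebra_left_generated[OF M] t(1)
        submodule_vimage[OF tensor_algebra_module[OF M] uea_module[OF assms] uea_proj_linear[OF assms] H(1)]])
    show "\<one>\<^bsub>?T\<^esub> \<in> {t \<in> carrier ?T. uea_proj R L t \<in> H}" using H(2) by (simp add: uea_proj_one)
  next
    fix x t assume x: "x \<in> carrier L" and t: "t \<in> {t \<in> carrier ?T. uea_proj R L t \<in> H}"
    have "tensor_incl R L x \<in> carrier ?T" by (rule is_linearD(1)[OF tensor_incl_linear[OF M] x])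
    then show "tensor_incl R L x \<otimes>\<^bsub>?T\<^esub> t \<in> {t \<in> carrier ?T. uea_proj R L t \<in> H}"
      using x t H(3) by (simp add: uea_proj_mult[OF assms] uea_incl_def)
  qed
  then show "z \<in> H" using t(2) by simp
qed

text \<open>The universal property of U(L) in the language of modules. The action of the tensor
  algebra extending \<open>a\<close> sends each defining relation to zero exactly by
  \<open>br\<close>, so the whole ideal annihilates \<open>W\<close> and the action
  descends.\<close>

lemma uea_representation:
  assumes L: "lie_algebra R L" and W: "module R W" and a: "is_bilinear R L W W a"
    and br: "\<And>x y f. \<lbrakk>x \<in> carrier L; y \<in> carrier L; f \<in> carrier W\<rbrakk> \<Longrightarrow>
      a (bracket L x y) f = a x (a y f) \<ominus>\<^bsub>W\<^esub> a y (a x f)"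
  shows "\<exists>h. \<forall>f\<in>carrier W. h f \<in> linear_maps R (uea R L) W \<and> h f \<one>\<^bsub>uea R L\<^esub> = f \<and>
    (\<forall>x\<in>carrier L. \<forall>t\<in>carrier (uea R L). h f (uea_incl R L x \<otimes>\<^bsub>uea R L\<^esub> t) = a x (h f t))"
proof -
  interpret L: lie_algebra R L by (rule L)
  interpret W: module R W by (rule W)
  let ?T = "tensor_algebra R L" and ?U = "uea R L"
  let ?i = "tensor_incl R L"
  note M = lie_algebra_module[OF L]
  note AT = tensor_algebra_assoc_algebra[OF M] and T = tensor_algebra_module[OF M]
  interpret T: assoc_algebra R ?T by (rule AT)
  have i: "?i z \<in> carrier ?T" if "z \<in> carrier L" for z
    using is_linearD(1)[OF tensor_incl_linear[OF M] that] .
  obtain h where h: "\<And>f. f \<in> carrier W \<Longrightarrow> h f \<in> linear_maps R ?T W"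
    and h1: "\<And>f. f \<in> carrier W \<Longrightarrow> h f \<one>\<^bsub>?T\<^esub> = f"
    and hx: "\<And>f x t. \<lbrakk>f \<in> carrier W; x \<in> carrier L; t \<in> carrier ?T\<rbrakk> \<Longrightarrow> h f (?i x \<otimes>\<^bsub>?T\<^esub> t) = a x (h f t)"
    using tensor_algebra_representation[OF M W a] by blast
  note hl = linear_maps_is_linear[OF h]
  note gen = tensor_algebra_left_generated[OF M]
  note hm = representation_mult[OF AT W gen i hl h1 hx]
  have az: "a x \<zero>\<^bsub>W\<^esub> = \<zero>\<^bsub>W\<^esub>" if "x \<in> carrier L" for x
    by (rule is_linear_zero[OF W W is_bilinearD(1)[OF a that]])
  have h0: "h \<zero>\<^bsub>W\<^esub> s = \<zero>\<^bsub>W\<^esub>" if "s \<in> carrier ?T" for s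
    by (rule left_generated_linear_eqI[OF AT W gen hl[OF W.M.zero_closed] is_linear_const_zero[OF W] i _ _ that])
      (simp_all add: h1 hx az)
  have hi: "h f (?i x) = a x f" if "f \<in> carrier W" "x \<in> carrier L" for f x
    using hx[OF that T.A.one_closed] i[OF that(2)] h1[OF that(1)] by simp
  note ac = is_bilinear_closed[OF a]
  have rel: "h f s = \<zero>\<^bsub>W\<^esub>"
    if f: "f \<in> carrier W" and s: "s \<in> {(?i x \<otimes>\<^bsub>?T\<^esub> ?i y \<ominus>\<^bsub>?T\<^esub> ?i y \<otimes>\<^bsub>?T\<^esub> ?i x) \<ominus>\<^bsub>?T\<^esub> ?i (bracket L x y) | x y.
        x \<in> carrier L \<and> y \<in> carrier L}" for f s
  proof -
    obtain x y where xy: "x \<in> carrier L" "y \<in> carrier L"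
      and s: "s = (?i x \<otimes>\<^bsub>?T\<^esub> ?i y \<ominus>\<^bsub>?T\<^esub> ?i y \<otimes>\<^bsub>?T\<^esub> ?i x) \<ominus>\<^bsub>?T\<^esub> ?i (bracket L x y)" using s by blast
    have m: "h f (?i x \<otimes>\<^bsub>?T\<^esub> ?i y) = a x (a y f)" if "x \<in> carrier L" "y \<in> carrier L" for x y
      using hx[OF f that(1) i[OF that(2)]] hi[OF f that(2)] by simp
    have "h f s = (a x (a y f) \<ominus>\<^bsub>W\<^esub> a y (a x f)) \<ominus>\<^bsub>W\<^esub> a (bracket L x y) f"
      unfolding s using xy
      by (simp add: is_linear_minus[OF T W hl[OF f]] i m hi[OF f] L.bracket_closed)
    also have "\<dots> = \<zero>\<^bsub>W\<^esub>"
      using br[OF xy f] xy f ac by (simp add: module_diff_zero_iff[OF W] W.M.minus_closed)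
    finally show ?thesis .
  qed
  have kill: "h f n = \<zero>\<^bsub>W\<^esub>" if "f \<in> carrier W" "n \<in> uea_ideal R L" for f n
    by (rule representation_kills_ideal[OF AT W hl hm h0 uea_relations_subset[OF L] rel
          that(1) that(2)[unfolded uea_ideal_def Let_def]])
  have "\<exists>k\<in>linear_maps R ?U W. \<forall>t\<in>carrier ?T. k (uea_proj R L t) = h f t" if f: "f \<in> carrier W" for f
    unfolding uea_def uea_proj_def
    by (rule quot_module_lift[OF T uea_ideal_submodule[OF L] W hl[OF f] kill[OF f]])
  then obtain k where k: "\<And>f. f \<in> carrier W \<Longrightarrow> k f \<in> linear_maps R ?U W"
    and kp: "\<And>f t. \<lbrakk>f \<in> carrier W; t \<in> carrier ?T\<rbrakk> \<Longrightarrow> k f (uea_proj R L t) = h f t"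
    by metis
  have one: "k f \<one>\<^bsub>?U\<^esub> = f" if "f \<in> carrier W" for f
    using kp[OF that T.A.one_closed] h1[OF that] by (simp add: uea_proj_one)
  have step: "k f (uea_incl R L x \<otimes>\<^bsub>?U\<^esub> u) = a x (k f u)"
    if f: "f \<in> carrier W" and x: "x \<in> carrier L" and u: "u \<in> carrier ?U" for f x u
  proof -
    obtain t where t: "t \<in> carrier ?T" "u = uea_proj R L t"
      using u unfolding uea_proj_surj[symmetric] by blast
    have "uea_incl R L x \<otimes>\<^bsub>?U\<^esub> u = uea_proj R L (?i x \<otimes>\<^bsub>?T\<^esub> t)"
      using uea_proj_mult[OF L i[OF x] t(1)] t(2) by (simp add: uea_incl_def)
    then show ?thesis
      using kp[OF f T.A.m_closed[OF i[OF x] t(1)]] kp[OF f t(1)] hx[OF f x t(1)] t(2) by simp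
  qed
  show ?thesis using k one step by blast
qed

text \<open>The induced morphism is obtained from a module: \<open>L\<close> acts on U(L') by left
  multiplication by the image of \<open>f x\<close>, and this respects brackets because
  \<open>f\<close> does. Uniqueness follows since an algebra map is determined on the
  generators.\<close>

lemma uea_map:
  assumes L: "lie_algebra R L" and L': "lie_algebra R L'" and f: "is_linear R L L' f"
    and br: "\<And>x y. \<lbrakk>x \<in> carrier L; y \<in> carrier L\<rbrakk> \<Longrightarrow> f (bracket L x y) = bracket L' (f x) (f y)"
  shows "uea_map R L L' f \<in> algebra_maps R (uea R L) (uea R L')"
    and "x \<in> carrier L \<Longrightarrow> uea_map R L L' f (uea_incl R L x) = uea_incl R L' (f x)"
proof -
  let ?U = "uea R L" and ?U' = "uea R L'"
  let ?s = "uea_incl R L" and ?s' = "uea_incl R L'"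
  let ?Q = "\<lambda>h. h \<in> algebra_maps R ?U ?U' \<and> (\<forall>x\<in>carrier L. h (?s x) = ?s' (f x))"
  note A = uea_assoc_algebra[OF L] and A' = uea_assoc_algebra[OF L'] and M' = uea_module[OF L']
  interpret U: assoc_algebra R ?U by (rule A)
  interpret U': assoc_algebra R ?U' by (rule A')
  note mult' = assoc_algebra_mult_bilinear[OF A'] and mult = assoc_algebra_mult_bilinear[OF A]
  note s = is_linearD(1)[OF uea_incl_linear[OF L]] and s' = is_linearD(1)[OF uea_incl_linear[OF L']]
  note fc = is_linearD(1)[OF f]
  have lin: "is_linear R L ?U' (\<lambda>x. ?s' (f x))" by (rule is_linear_comp[OF f uea_incl_linear[OF L']])
  have a: "is_bilinear R L ?U' ?U' (\<lambda>x u. ?s' (f x) \<otimes>\<^bsub>?U'\<^esub> u)"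
    by (intro is_bilinearI is_bilinearD(1)[OF mult'] is_linear_comp[OF lin is_bilinearD(2)[OF mult']] s' fc)
  have "?s' (f (bracket L x y)) \<otimes>\<^bsub>?U'\<^esub> u =
      ?s' (f x) \<otimes>\<^bsub>?U'\<^esub> (?s' (f y) \<otimes>\<^bsub>?U'\<^esub> u) \<ominus>\<^bsub>?U'\<^esub> ?s' (f y) \<otimes>\<^bsub>?U'\<^esub> (?s' (f x) \<otimes>\<^bsub>?U'\<^esub> u)"
    if "x \<in> carrier L" "y \<in> carrier L" "u \<in> carrier ?U'" for x y u
    using that s' fc
    by (simp add: br uea_incl_bracket[OF L'] is_linear_minus[OF M' M' is_bilinearD(2)[OF mult']] U'.A.m_assoc)
  from uea_representation[OF L M' a this] obtain h where
    "\<forall>g\<in>carrier ?U'. h g \<in> linear_maps R ?U ?U' \<and> h g \<one>\<^bsub>?U\<^esub> = g \<and>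
    (\<forall>x\<in>carrier L. \<forall>t\<in>carrier ?U. h g (?s x \<otimes>\<^bsub>?U\<^esub> t) = ?s' (f x) \<otimes>\<^bsub>?U'\<^esub> h g t)" by blast
  \<comment> \<open>The orbit of the unit of U(L') under this action is the required
    morphism.\<close>
  then obtain k where k: "k \<in> linear_maps R ?U ?U'" "k \<one>\<^bsub>?U\<^esub> = \<one>\<^bsub>?U'\<^esub>"
    "\<And>x t. \<lbrakk>x \<in> carrier L; t \<in> carrier ?U\<rbrakk> \<Longrightarrow> k (?s x \<otimes>\<^bsub>?U\<^esub> t) = ?s' (f x) \<otimes>\<^bsub>?U'\<^esub> k t"
    using U'.A.one_closed by blast
  note kl = linear_maps_is_linear[OF k(1)]
  note gen = uea_left_generated[OF L]
  \<comment> \<open>Induction on the left factor \<open>u\<close>: associativity in both algebras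
    lets its leftmost generator be pulled out on either side.\<close>
  have km: "k (u \<otimes>\<^bsub>?U\<^esub> v) = k u \<otimes>\<^bsub>?U'\<^esub> k v" if u: "u \<in> carrier ?U" and v: "v \<in> carrier ?U" for u v
  proof (rule left_generated_linear_eqI[OF A M' gen _ _ s _ _ u])
    show "is_linear R ?U ?U' (\<lambda>u. k (u \<otimes>\<^bsub>?U\<^esub> v))"
      by (rule is_linear_comp[OF is_bilinearD(2)[OF mult v] kl])
    show "is_linear R ?U ?U' (\<lambda>u. k u \<otimes>\<^bsub>?U'\<^esub> k v)"
      by (rule is_linear_comp[OF kl is_bilinearD(2)[OF mult' is_linearD(1)[OF kl v]]])
    show "k (\<one>\<^bsub>?U\<^esub> \<otimes>\<^bsub>?U\<^esub> v) = k \<one>\<^bsub>?U\<^esub> \<otimes>\<^bsub>?U'\<^esub> k v" using v is_linearD(1)[OF kl] by (simp add: k(2))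
    show "k (?s x \<otimes>\<^bsub>?U\<^esub> t \<otimes>\<^bsub>?U\<^esub> v) = k (?s x \<otimes>\<^bsub>?U\<^esub> t) \<otimes>\<^bsub>?U'\<^esub> k v"
      if "x \<in> carrier L" "t \<in> carrier ?U" "k (t \<otimes>\<^bsub>?U\<^esub> v) = k t \<otimes>\<^bsub>?U'\<^esub> k v" for x t
      using that s s' fc v is_linearD(1)[OF kl] by (simp add: k(3) U.A.m_assoc U'.A.m_assoc)
  qed
  have "k (?s x) = ?s' (f x)" if "x \<in> carrier L" for x
    using k(2) k(3)[OF that U.A.one_closed] s[OF that] s'[OF fc[OF that]] by simp
  moreover have "k \<in> ring_hom ?U ?U'"
    using km k(2) is_linearD(1,2)[OF kl] by (intro ring_hom_memI) auto
  ultimately have Qk: "?Q k" using k(1) by (simp add: algebra_maps_def)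
  have "h = k" if Q: "?Q h" for h
  proof (rule linear_maps_eqI[OF _ k(1)])
    show hU: "h \<in> linear_maps R ?U ?U'" using Q by (simp add: algebra_maps_def)
    have hr: "h \<in> ring_hom ?U ?U'" using Q by (simp add: algebra_maps_def)
    fix u assume u: "u \<in> carrier ?U"
    show "h u = k u"
      by (rule left_generated_linear_eqI[OF A M' gen linear_maps_is_linear[OF hU] kl s _ _ u])
        (use Q s ring_hom_one[OF hr] in \<open>simp_all add: k(2,3) ring_hom_mult[OF hr]\<close>)
  qed
  with Qk have "uea_map R L L' f = k"
    unfolding uea_map_def by (intro the_equality)
  then show "uea_map R L L' f \<in> algebra_maps R (uea R L) (uea R L')"
    and "x \<in> carrier L \<Longrightarrow> uea_map R L L' f (uea_incl R L x) = uea_incl R L' (f x)"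
    using Qk by simp_all
qed

section \<open>Multiplication on the factors of a tensor product of algebras\<close>

context
  fixes R :: "('k, 'r) ring_scheme" and A :: "('k, 'a, 'x) module_scheme" and B :: "('k, 'b, 'y) module_scheme"
  assumes A: "assoc_algebra R A" and B: "assoc_algebra R B"
begin

interpretation A: assoc_algebra R A by (rule A)
interpretation B: assoc_algebra R B by (rule B)

lemmas tensor_algebras_module =
  tensor_prod_module[OF assoc_algebra_module[OF A] assoc_algebra_module[OF B]]

interpretation V: module R "tensor_prod R A B" by (rule tensor_algebras_module)

lemmas tensor_algebras_eqI =
  tensor_prod_linear_eqI[OF assoc_algebra_module[OF A] assoc_algebra_module[OF B]]

lemmas tensor_algebras_bilinear =
  pure_tensor_bilinear[OF assoc_algebra_module[OF A] assoc_algebra_module[OF B]]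

lemmas tensor_algebras_closed =
  pure_tensor_closed[OF assoc_algebra_module[OF A] assoc_algebra_module[OF B]]

lemma tensor_lmult:
  assumes "a \<in> carrier A"
  shows "is_linear R (tensor_prod R A B) (tensor_prod R A B) (tensor_lmult R A B a)"
    and "\<lbrakk>t \<in> carrier A; m \<in> carrier B\<rbrakk> \<Longrightarrow>
      tensor_lmult R A B a (pure_tensor R A B t m) = pure_tensor R A B (a \<otimes>\<^bsub>A\<^esub> t) m"
  using tensor_map[OF A.module_axioms B.module_axioms A.module_axioms B.module_axioms
      is_bilinearD(1)[OF assoc_algebra_mult_bilinear[OF A] assms] is_linear_id]
  unfolding tensor_lmult_def by (blast intro: linear_maps_is_linear)+

lemma tensor_rmult:
  assumes "b \<in> carrier B"
  shows "is_linear R (tensor_prod R A B) (tensor_prod R A B) (\<lambda>z. tensor_rmult R A B z b)"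
    and "\<lbrakk>t \<in> carrier A; m \<in> carrier B\<rbrakk> \<Longrightarrow>
      tensor_rmult R A B (pure_tensor R A B t m) b = pure_tensor R A B t (m \<otimes>\<^bsub>B\<^esub> b)"
proof -
  note h = tensor_map[OF A.module_axioms B.module_axioms A.module_axioms B.module_axioms
      is_linear_id is_bilinearD(2)[OF assoc_algebra_mult_bilinear[OF B] assms]]
  show "is_linear R (tensor_prod R A B) (tensor_prod R A B) (\<lambda>z. tensor_rmult R A B z b)"
    using linear_maps_is_linear[OF h(1)] by (simp add: tensor_rmult_def)
  show "\<lbrakk>t \<in> carrier A; m \<in> carrier B\<rbrakk> \<Longrightarrow>
      tensor_rmult R A B (pure_tensor R A B t m) b = pure_tensor R A B t (m \<otimes>\<^bsub>B\<^esub> b)"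
    using h(2) by (simp add: tensor_rmult_def)
qed

text \<open>\<open>tensor_lmult\<close> is built for one \<open>a\<close> at a time. Linearity in
  \<open>a\<close> is recovered by comparing both sides, which are linear in \<open>z\<close>, on
  pure tensors.\<close>

lemma tensor_lmult_bilinear:
  "is_bilinear R A (tensor_prod R A B) (tensor_prod R A B) (tensor_lmult R A B)"
proof (rule is_bilinearI)
  fix z assume z: "z \<in> carrier (tensor_prod R A B)"
  note pl = is_linearD[OF is_bilinearD(2)[OF tensor_algebras_bilinear]]
  note lc = is_linearD(1)[OF tensor_lmult(1)]
  show "is_linear R A (tensor_prod R A B) (\<lambda>a. tensor_lmult R A B a z)"
  proof (rule is_linearI)
    fix a a' assume a: "a \<in> carrier A" "a' \<in> carrier A"
    show "tensor_lmult R A B (a \<oplus>\<^bsub>A\<^esub> a') z =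
        tensor_lmult R A B a z \<oplus>\<^bsub>tensor_prod R A B\<^esub> tensor_lmult R A B a' z"
      by (rule tensor_algebras_eqI[OF tensor_algebras_module tensor_lmult(1)
            is_linear_add[OF tensor_algebras_module tensor_lmult(1) tensor_lmult(1)] _ z])
        (use a in \<open>simp_all add: tensor_lmult(2) A.A.l_distr pl\<close>)
  next
    fix c a assume c: "c \<in> carrier R" "a \<in> carrier A"
    show "tensor_lmult R A B (c \<odot>\<^bsub>A\<^esub> a) z = c \<odot>\<^bsub>tensor_prod R A B\<^esub> tensor_lmult R A B a z"
      by (rule tensor_algebras_eqI[OF tensor_algebras_module tensor_lmult(1)
            is_linear_smult[OF tensor_algebras_module tensor_lmult(1)] _ z])
        (use c in \<open>simp_all add: tensor_lmult(2) A.smult_mult_left pl\<close>)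
  qed (use z lc in simp)
qed (rule tensor_lmult(1))

lemma tensor_lmult_mult:
  assumes "a \<in> carrier A" and "a' \<in> carrier A" and "z \<in> carrier (tensor_prod R A B)"
  shows "tensor_lmult R A B (a \<otimes>\<^bsub>A\<^esub> a') z = tensor_lmult R A B a (tensor_lmult R A B a' z)"
  by (rule tensor_algebras_eqI[OF tensor_algebras_module tensor_lmult(1)
        is_linear_comp[OF tensor_lmult(1) tensor_lmult(1)] _ assms(3)])
    (use assms(1,2) in \<open>simp_all add: tensor_lmult(2) A.A.m_assoc\<close>)

text \<open>The recursion alters values only by sums and left multiplications, so this commutation
  is what carries right multiplication by an element of U(g2) through it.\<close>

lemma tensor_lmult_rmult:
  assumes "a \<in> carrier A" and "b \<in> carrier B" and "z \<in> carrier (tensor_prod R A B)"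
  shows "tensor_lmult R A B a (tensor_rmult R A B z b) = tensor_rmult R A B (tensor_lmult R A B a z) b"
  by (rule tensor_algebras_eqI[OF tensor_algebras_module
        is_linear_comp[OF tensor_rmult(1) tensor_lmult(1)]
        is_linear_comp[OF tensor_lmult(1) tensor_rmult(1)] _ assms(3)])
    (use assms(1,2) in \<open>simp_all add: tensor_lmult(2) tensor_rmult(2)\<close>)

end

section \<open>The recursion defining the action\<close>

text \<open>Polarisation of \<open>bracket_self\<close> at \<open>x \<oplus> y\<close>, valid in
  every characteristic.\<close>

lemma lie_bracket_antisym:
  assumes "lie_algebra R L" and "x \<in> carrier L" and "y \<in> carrier L"
  shows "bracket L x y = \<ominus>\<^bsub>L\<^esub> bracket L y x"
proof -
  interpret L: lie_algebra R L by fact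
  note c = assms(2,3) and b = L.bracket_closed
  have "bracket L (x \<oplus>\<^bsub>L\<^esub> y) (x \<oplus>\<^bsub>L\<^esub> y) = bracket L x (x \<oplus>\<^bsub>L\<^esub> y) \<oplus>\<^bsub>L\<^esub> bracket L y (x \<oplus>\<^bsub>L\<^esub> y)"
    using c by (intro L.bracket_add_left) auto
  also have "\<dots> = bracket L x y \<oplus>\<^bsub>L\<^esub> bracket L y x"
    using c b by (simp add: L.bracket_add_right L.bracket_self)
  finally have "bracket L x y \<oplus>\<^bsub>L\<^esub> bracket L y x = \<zero>\<^bsub>L\<^esub>" using c by (simp add: L.bracket_self)
  then show ?thesis using c b by (intro L.M.minus_equality[symmetric])
qed

text \<open>The Jacobi identity for the operators \<open>g \<mapsto> [g, x]\<close>: applying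
  \<open>x\<close> and then \<open>y\<close>, minus the opposite order, is the operator of
  \<open>[x, y]\<close>. The negative term is moved across so that only sums occur.\<close>

lemma lie_bracket_bracket:
  assumes "lie_algebra R L" and "g \<in> carrier L" and "x \<in> carrier L" and "y \<in> carrier L"
  shows "bracket L g (bracket L x y) \<oplus>\<^bsub>L\<^esub> bracket L (bracket L g y) x = bracket L (bracket L g x) y"
proof -
  interpret L: lie_algebra R L by fact
  note c = assms(2-4) and b = L.bracket_closed
  have neg: "bracket L u (\<ominus>\<^bsub>L\<^esub> v) = \<ominus>\<^bsub>L\<^esub> bracket L u v" if "u \<in> carrier L" "v \<in> carrier L" for u v
    using that b by (simp add: module_minus_eq[OF L.module_axioms] L.bracket_smult_right)
  have 1: "bracket L (bracket L g y) x = bracket L x (bracket L y g)"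
  proof -
    have "bracket L (bracket L g y) x = \<ominus>\<^bsub>L\<^esub> bracket L x (bracket L g y)"
      using c b by (intro lie_bracket_antisym[OF assms(1)]) auto
    also have "\<dots> = \<ominus>\<^bsub>L\<^esub> bracket L x (\<ominus>\<^bsub>L\<^esub> bracket L y g)"
      using lie_bracket_antisym[OF assms(1) c(1,3)] by simp
    finally show ?thesis using c b by (simp add: neg)
  qed
  have 2: "bracket L (bracket L g x) y = \<ominus>\<^bsub>L\<^esub> bracket L y (bracket L g x)"
    using c b by (intro lie_bracket_antisym[OF assms(1)]) auto
  have "bracket L g (bracket L x y) \<oplus>\<^bsub>L\<^esub> bracket L x (bracket L y g) \<oplus>\<^bsub>L\<^esub>
      bracket L y (bracket L g x) = \<zero>\<^bsub>L\<^esub>"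
    using L.jacobi[OF c] .
  then have "bracket L g (bracket L x y) \<oplus>\<^bsub>L\<^esub> bracket L x (bracket L y g) =
      \<ominus>\<^bsub>L\<^esub> bracket L y (bracket L g x)"
    using c b by (intro L.M.minus_equality[symmetric]) auto
  then show ?thesis by (simp only: 1 2)
qed

text \<open>The recursion \<open>g \<star> (x t \<otimes> m) = [g, x] \<star> (t \<otimes> m) + x (g \<star> (t \<otimes> m))\<close> says that the map
  \<open>t \<mapsto> (g \<mapsto> g \<star> (t \<otimes> m))\<close> intertwines left multiplication by \<open>x\<close> with \<open>star_step x\<close>.\<close>

definition star_step ::
  "('k, 'r) ring_scheme \<Rightarrow> ('k, 'g, 'l) lie_algebra_scheme \<Rightarrow> ('k, 'a, 'x) module_scheme \<Rightarrow>
    ('k, 'b, 'y) module_scheme \<Rightarrow> ('g \<Rightarrow> 'a) \<Rightarrow> 'g \<Rightarrow>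
    ('g \<Rightarrow> ('a \<times> 'b \<Rightarrow> 'k) set) \<Rightarrow> 'g \<Rightarrow> ('a \<times> 'b \<Rightarrow> 'k) set"
  where "star_step R L A B i x f =
    restrict (\<lambda>g. f (bracket L g x) \<oplus>\<^bsub>tensor_prod R A B\<^esub> tensor_lmult R A B (i x) (f g)) (carrier L)"

lemma star_step_apply:
  "g \<in> carrier L \<Longrightarrow> star_step R L A B i x f g =
    f (bracket L g x) \<oplus>\<^bsub>tensor_prod R A B\<^esub> tensor_lmult R A B (i x) (f g)"
  by (simp add: star_step_def)

text \<open>Linearity of the bracket in its first argument keeps the result inside the Hom module;
  linearity in its second argument, together with that of \<open>i\<close>, gives linearity in
  \<open>x\<close>.\<close>

lemma star_step_bilinear:
  assumes A: "assoc_algebra R A" and B: "assoc_algebra R B" and L: "lie_algebra R L"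
    and X: "submodule X R L" and i: "is_linear R (L\<lparr>carrier := X\<rparr>) A i"
  shows "is_bilinear R (L\<lparr>carrier := X\<rparr>) (hom_module R L (tensor_prod R A B))
    (hom_module R L (tensor_prod R A B)) (star_step R L A B i)"
proof -
  let ?V = "tensor_prod R A B"
  let ?W = "hom_module R L ?V"
  note V = tensor_algebras_module[OF A B] and M = lie_algebra_module[OF L]
  note W = hom_module_module[OF M V]
  interpret L: lie_algebra R L by (rule L)
  interpret V: module R ?V by (rule V)
  interpret W: module R ?W by (rule W)
  have XL: "x \<in> carrier L" if "x \<in> X" for x using that submoduleD(1)[OF X] by blast
  have iA: "i x \<in> carrier A" if "x \<in> X" for x using is_linearD(1)[OF i] that by simp
  have br: "is_linear R L L (\<lambda>g. bracket L g x)" if "x \<in> carrier L" for x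
    using that by (intro is_linearI) (simp_all add: L.bracket_closed L.bracket_add_left L.bracket_smult_left)
  have step: "star_step R L A B i x f \<in> carrier ?W" if x: "x \<in> X" and f: "f \<in> carrier ?W" for x f
  proof -
    have fl: "is_linear R L ?V f" using f by (simp add: linear_maps_is_linear)
    show ?thesis
      unfolding star_step_def hom_module_simps(1)
      by (rule restrict_linear_maps[OF M is_linear_add[OF V is_linear_comp[OF br[OF XL[OF x]] fl]
            is_linear_comp[OF fl tensor_lmult(1)[OF A B iA[OF x]]]]])
  qed
  have fc: "f g \<in> carrier ?V" if "f \<in> carrier ?W" "g \<in> carrier L" for f g
    using that is_linearD(1)[OF linear_maps_is_linear] by force
  have eqI: "f = g" if "f \<in> carrier ?W" "g \<in> carrier ?W" "\<And>x. x \<in> carrier L \<Longrightarrow> f x = g x" for f g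
    using that linear_maps_eqI[of f R L ?V g] by simp
  note lmc = is_linearD[OF is_bilinearD(1)[OF tensor_lmult_bilinear[OF A B]]]
    is_linearD(2,3)[OF is_bilinearD(2)[OF tensor_lmult_bilinear[OF A B]]]
  note brc = L.bracket_closed L.bracket_add_right L.bracket_smult_right
  show ?thesis
  proof (rule is_bilinearI)
    fix x assume "x \<in> carrier (L\<lparr>carrier := X\<rparr>)"
    then have x: "x \<in> X" by simp
    show "is_linear R ?W ?W (star_step R L A B i x)"
    proof (rule is_linearI)
      fix f f' assume f: "f \<in> carrier ?W" "f' \<in> carrier ?W"
      show "star_step R L A B i x (f \<oplus>\<^bsub>?W\<^esub> f') = star_step R L A B i x f \<oplus>\<^bsub>?W\<^esub> star_step R L A B i x f'"
        by (intro eqI step x f W.M.a_closed)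
          (use f x in \<open>simp add: star_step_apply brc lmc fc XL iA V.M.a_ac
            del: hom_module_simps(1)\<close>)
    next
      fix c f assume f: "c \<in> carrier R" "f \<in> carrier ?W"
      show "star_step R L A B i x (c \<odot>\<^bsub>?W\<^esub> f) = c \<odot>\<^bsub>?W\<^esub> star_step R L A B i x f"
        by (intro eqI step x f W.smult_closed)
          (use f x in \<open>simp add: star_step_apply brc lmc fc XL iA V.smult_r_distr
            del: hom_module_simps(1)\<close>)
    qed (rule step[OF x])
  next
    fix f assume f: "f \<in> carrier ?W"
    have fl: "is_linear R L ?V f" using f by (simp add: linear_maps_is_linear)
    note fD = is_linearD(2,3)[OF fl]
    show "is_linear R (L\<lparr>carrier := X\<rparr>) ?W (\<lambda>x. star_step R L A B i x f)"
    proof (rule is_linearI)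
      fix x assume "x \<in> carrier (L\<lparr>carrier := X\<rparr>)"
      then show "star_step R L A B i x f \<in> carrier ?W" using step[OF _ f] by simp
    next
      fix x y assume "x \<in> carrier (L\<lparr>carrier := X\<rparr>)" "y \<in> carrier (L\<lparr>carrier := X\<rparr>)"
      then have xy: "x \<in> X" "y \<in> X" by simp_all
      have ia: "i (x \<oplus>\<^bsub>L\<^esub> y) = i x \<oplus>\<^bsub>A\<^esub> i y" using is_linearD(2)[OF i] xy by simp
      show "star_step R L A B i (x \<oplus>\<^bsub>L\<lparr>carrier := X\<rparr>\<^esub> y) f =
          star_step R L A B i x f \<oplus>\<^bsub>?W\<^esub> star_step R L A B i y f"
        by (rule eqI)
          (use f xy step submoduleD(3)[OF X xy] in \<open>simp_all add: star_step_apply ia brc lmc fc fD XL iA V.M.a_ac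
            W.M.a_closed del: hom_module_simps(1)\<close>)
    next
      fix c x assume "c \<in> carrier R" "x \<in> carrier (L\<lparr>carrier := X\<rparr>)"
      then have c: "c \<in> carrier R" "x \<in> X" by simp_all
      have ia: "i (c \<odot>\<^bsub>L\<^esub> x) = c \<odot>\<^bsub>A\<^esub> i x" using is_linearD(3)[OF i] c by simp
      show "star_step R L A B i (c \<odot>\<^bsub>L\<lparr>carrier := X\<rparr>\<^esub> x) f = c \<odot>\<^bsub>?W\<^esub> star_step R L A B i x f"
        by (rule eqI)
          (use f c step submoduleD(4)[OF X c] in \<open>simp_all add: star_step_apply ia brc lmc fc fD XL iA V.smult_r_distr
            W.smult_closed del: hom_module_simps(1)\<close>)
    qed
  qed
qed

text \<open>The composite of the operators of \<open>u\<close> and \<open>v\<close> has four terms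
  at \<open>g\<close>. The two mixed ones, \<open>v f([g, u])\<close> and
  \<open>u f([g, v])\<close>, are exchanged by swapping \<open>u\<close> and \<open>v\<close> and so
  cancel in the commutator. The terms \<open>f([[g, u], v])\<close> are handled by the Jacobi
  identity, the terms \<open>u v f(g)\<close> by the relation \<open>ibr\<close> in
  \<open>A\<close>.\<close>

lemma star_step_bracket:
  assumes A: "assoc_algebra R A" and B: "assoc_algebra R B" and L: "lie_algebra R L"
    and X: "submodule X R L" and i: "is_linear R (L\<lparr>carrier := X\<rparr>) A i"
    and ibr: "\<And>x y. \<lbrakk>x \<in> X; y \<in> X\<rbrakk> \<Longrightarrow>
      bracket L x y \<in> X \<and> i (bracket L x y) = i x \<otimes>\<^bsub>A\<^esub> i y \<ominus>\<^bsub>A\<^esub> i y \<otimes>\<^bsub>A\<^esub> i x"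
    and x: "x \<in> X" and y: "y \<in> X" and f: "f \<in> carrier (hom_module R L (tensor_prod R A B))"
  shows "star_step R L A B i (bracket L x y) f =
    star_step R L A B i x (star_step R L A B i y f) \<ominus>\<^bsub>hom_module R L (tensor_prod R A B)\<^esub>
    star_step R L A B i y (star_step R L A B i x f)"
proof -
  let ?V = "tensor_prod R A B"
  let ?W = "hom_module R L ?V"
  let ?s = "star_step R L A B i"
  let ?l = "tensor_lmult R A B"
  note V = tensor_algebras_module[OF A B] and M = lie_algebra_module[OF L]
  note W = hom_module_module[OF M V]
  interpret A: assoc_algebra R A by (rule A)
  interpret L: lie_algebra R L by (rule L)
  interpret V: module R ?V by (rule V)
  interpret W: module R ?W by (rule W)
  have XL: "x \<in> carrier L" if "x \<in> X" for x using that submoduleD(1)[OF X] by blast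
  have iA: "i x \<in> carrier A" if "x \<in> X" for x using is_linearD(1)[OF i] that by simp
  note xL = XL[OF x] and yL = XL[OF y] and xyX = ibr[OF x y, THEN conjunct1]
  have sc: "?s x f \<in> carrier ?W" if "x \<in> X" "f \<in> carrier ?W" for x f
    using is_bilinear_closed[OF star_step_bilinear[OF A B L X i], of x f] that by simp
  have fl: "is_linear R L ?V f" using f by (simp add: linear_maps_is_linear)
  note fc = is_linearD(1)[OF fl]
  note lc = is_bilinear_closed[OF tensor_lmult_bilinear[OF A B]]
  have eqI: "f = g" if "f \<in> carrier ?W" "g \<in> carrier ?W" "\<And>x. x \<in> carrier L \<Longrightarrow> f x = g x" for f g
    using that linear_maps_eqI[of f R L ?V g] by simp
  \<comment> \<open>The subtracted composite is moved to the left, so that only sums have to be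
    compared.\<close>
  have "?s (bracket L x y) f \<oplus>\<^bsub>?W\<^esub> ?s y (?s x f) = ?s x (?s y f)"
  proof (rule eqI)
    show "?s (bracket L x y) f \<oplus>\<^bsub>?W\<^esub> ?s y (?s x f) \<in> carrier ?W" "?s x (?s y f) \<in> carrier ?W"
      using sc x y f xyX by (simp_all add: W.M.a_closed del: hom_module_simps(1))
    fix g assume g: "g \<in> carrier L"
    note b = L.bracket_closed
    have s2: "?s u (?s v f) g = f (bracket L (bracket L g u) v) \<oplus>\<^bsub>?V\<^esub> ?l (i v) (f (bracket L g u)) \<oplus>\<^bsub>?V\<^esub>
        (?l (i u) (f (bracket L g v)) \<oplus>\<^bsub>?V\<^esub> ?l (i u \<otimes>\<^bsub>A\<^esub> i v) (f g))" if u: "u \<in> X" and v: "v \<in> X" for u v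
      using g XL[OF u] XL[OF v] iA[OF u] iA[OF v] b fc lc
      by (simp add: star_step_apply is_linearD(2)[OF tensor_lmult(1)[OF A B]] tensor_lmult_mult[OF A B])
    have m: "?l (i x \<otimes>\<^bsub>A\<^esub> i y) (f g) = ?l (i (bracket L x y)) (f g) \<oplus>\<^bsub>?V\<^esub> ?l (i y \<otimes>\<^bsub>A\<^esub> i x) (f g)"
    proof -
      have "i x \<otimes>\<^bsub>A\<^esub> i y = i (bracket L x y) \<oplus>\<^bsub>A\<^esub> i y \<otimes>\<^bsub>A\<^esub> i x"
        using ibr[OF x y] iA[OF x] iA[OF y] by (simp add: a_minus_def A.M.a_assoc A.M.l_neg)
      then show ?thesis
        using is_linearD(2)[OF is_bilinearD(2)[OF tensor_lmult_bilinear[OF A B] fc[OF g]], of "i (bracket L x y)" "i y \<otimes>\<^bsub>A\<^esub> i x"]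
          iA[OF x] iA[OF y] iA[OF xyX] by simp
    qed
    have j: "f (bracket L (bracket L g x) y) = f (bracket L g (bracket L x y)) \<oplus>\<^bsub>?V\<^esub> f (bracket L (bracket L g y) x)"
      using is_linearD(2)[OF fl, of "bracket L g (bracket L x y)" "bracket L (bracket L g y) x"]
        lie_bracket_bracket[OF L g xL yL] g xL yL b by simp
    have cl: "f (bracket L g (bracket L x y)) \<in> carrier ?V" "f (bracket L (bracket L g y) x) \<in> carrier ?V"
      "?l (i y) (f (bracket L g x)) \<in> carrier ?V" "?l (i x) (f (bracket L g y)) \<in> carrier ?V"
      "?l (i (bracket L x y)) (f g) \<in> carrier ?V" "?l (i y \<otimes>\<^bsub>A\<^esub> i x) (f g) \<in> carrier ?V"
      using g xL yL b fc lc iA[OF x] iA[OF y] iA[OF xyX] by simp_all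
    show "(?s (bracket L x y) f \<oplus>\<^bsub>?W\<^esub> ?s y (?s x f)) g = ?s x (?s y f) g"
      using cl by (simp add: g star_step_apply[of g L R A B i "bracket L x y" f] s2[OF x y] s2[OF y x] m j V.M.a_ac)
  qed
  then have "?s (bracket L x y) f \<oplus>\<^bsub>?W\<^esub> ?s y (?s x f) \<ominus>\<^bsub>?W\<^esub> ?s y (?s x f) = ?s x (?s y f) \<ominus>\<^bsub>?W\<^esub> ?s y (?s x f)"
    by simp
  then show ?thesis
    using sc x y f xyX
    by (simp add: a_minus_def W.M.a_assoc W.M.r_neg del: hom_module_simps(1))
qed

text \<open>The two equations of the action with the first algebra left open, so that one existence
  argument serves both T(g1) and U(g1). The maps \<open>\<alpha>\<close> and \<open>\<beta>\<close>
  send an element of the Lie algebra to its components in the two factors.\<close>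

definition is_star ::
  "('k, 'r) ring_scheme \<Rightarrow> ('k, 'g, 'l) lie_algebra_scheme \<Rightarrow> ('k, 'a, 'x) module_scheme \<Rightarrow>
    ('k, 'b, 'y) module_scheme \<Rightarrow> 'g set \<Rightarrow> ('g \<Rightarrow> 'a) \<Rightarrow> ('g \<Rightarrow> 'a) \<Rightarrow> ('g \<Rightarrow> 'b) \<Rightarrow>
    (('g \<times> ('a \<times> 'b \<Rightarrow> 'k) set \<Rightarrow> 'k) set \<Rightarrow> ('a \<times> 'b \<Rightarrow> 'k) set) \<Rightarrow> bool"
  where "is_star R L A B X i \<alpha> \<beta> \<Phi> \<longleftrightarrow>
    \<Phi> \<in> linear_maps R (tensor_prod R L (tensor_prod R A B)) (tensor_prod R A B) \<and>
    (\<forall>g\<in>carrier L. \<forall>m\<in>carrier B.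
      \<Phi> (pure_tensor R L (tensor_prod R A B) g (pure_tensor R A B \<one>\<^bsub>A\<^esub> m)) =
        pure_tensor R A B (\<alpha> g) m \<oplus>\<^bsub>tensor_prod R A B\<^esub> pure_tensor R A B \<one>\<^bsub>A\<^esub> (\<beta> g \<otimes>\<^bsub>B\<^esub> m)) \<and>
    (\<forall>g\<in>carrier L. \<forall>x\<in>X. \<forall>t\<in>carrier A. \<forall>m\<in>carrier B.
      \<Phi> (pure_tensor R L (tensor_prod R A B) g (pure_tensor R A B (i x \<otimes>\<^bsub>A\<^esub> t) m)) =
        \<Phi> (pure_tensor R L (tensor_prod R A B) (bracket L g x) (pure_tensor R A B t m))
          \<oplus>\<^bsub>tensor_prod R A B\<^esub>
        tensor_lmult R A B (i x) (\<Phi> (pure_tensor R L (tensor_prod R A B) g (pure_tensor R A B t m))))"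

lemma is_starD:
  assumes "is_star R L A B X i \<alpha> \<beta> \<Phi>"
  shows "\<Phi> \<in> linear_maps R (tensor_prod R L (tensor_prod R A B)) (tensor_prod R A B)"
    and "\<lbrakk>g \<in> carrier L; m \<in> carrier B\<rbrakk> \<Longrightarrow>
      \<Phi> (pure_tensor R L (tensor_prod R A B) g (pure_tensor R A B \<one>\<^bsub>A\<^esub> m)) =
        pure_tensor R A B (\<alpha> g) m \<oplus>\<^bsub>tensor_prod R A B\<^esub> pure_tensor R A B \<one>\<^bsub>A\<^esub> (\<beta> g \<otimes>\<^bsub>B\<^esub> m)"
    and "\<lbrakk>g \<in> carrier L; x \<in> X; t \<in> carrier A; m \<in> carrier B\<rbrakk> \<Longrightarrow>
      \<Phi> (pure_tensor R L (tensor_prod R A B) g (pure_tensor R A B (i x \<otimes>\<^bsub>A\<^esub> t) m)) =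
        \<Phi> (pure_tensor R L (tensor_prod R A B) (bracket L g x) (pure_tensor R A B t m))
          \<oplus>\<^bsub>tensor_prod R A B\<^esub>
        tensor_lmult R A B (i x) (\<Phi> (pure_tensor R L (tensor_prod R A B) g (pure_tensor R A B t m)))"
  using assms unfolding is_star_def by blast+

lemma pure_tensor3_linear:
  assumes A: "assoc_algebra R A" and B: "assoc_algebra R B" and L: "lie_algebra R L"
    and F: "is_linear R (tensor_prod R L (tensor_prod R A B)) P F"
  shows "g \<in> carrier L \<Longrightarrow>
      is_linear R (tensor_prod R A B) P (\<lambda>z. F (pure_tensor R L (tensor_prod R A B) g z))"
    and "\<lbrakk>g \<in> carrier L; m \<in> carrier B\<rbrakk> \<Longrightarrow>
      is_linear R A P (\<lambda>t. F (pure_tensor R L (tensor_prod R A B) g (pure_tensor R A B t m)))"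
proof -
  note V = tensor_algebras_module[OF A B]
  note b = pure_tensor_bilinear[OF lie_algebra_module[OF L] V]
  show l: "g \<in> carrier L \<Longrightarrow>
      is_linear R (tensor_prod R A B) P (\<lambda>z. F (pure_tensor R L (tensor_prod R A B) g z))"
    by (rule is_linear_comp[OF is_bilinearD(1)[OF b] F])
  show "\<lbrakk>g \<in> carrier L; m \<in> carrier B\<rbrakk> \<Longrightarrow>
      is_linear R A P (\<lambda>t. F (pure_tensor R L (tensor_prod R A B) g (pure_tensor R A B t m)))"
    by (rule is_linear_comp[OF is_bilinearD(2)[OF tensor_algebras_bilinear[OF A B]] l])
qed

lemma tensor3_eqI:
  assumes A: "assoc_algebra R A" and B: "assoc_algebra R B" and L: "lie_algebra R L" and P: "module R P"
    and F: "is_linear R (tensor_prod R L (tensor_prod R A B)) P F"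
    and G: "is_linear R (tensor_prod R L (tensor_prod R A B)) P G"
    and eq: "\<And>g t m. \<lbrakk>g \<in> carrier L; t \<in> carrier A; m \<in> carrier B\<rbrakk> \<Longrightarrow>
      F (pure_tensor R L (tensor_prod R A B) g (pure_tensor R A B t m)) =
      G (pure_tensor R L (tensor_prod R A B) g (pure_tensor R A B t m))"
    and z: "z \<in> carrier (tensor_prod R L (tensor_prod R A B))"
  shows "F z = G z"
proof (rule tensor_prod_linear_eqI[OF lie_algebra_module[OF L] tensor_algebras_module[OF A B] P F G _ z])
  fix g y assume g: "g \<in> carrier L" and y: "y \<in> carrier (tensor_prod R A B)"
  show "F (pure_tensor R L (tensor_prod R A B) g y) = G (pure_tensor R L (tensor_prod R A B) g y)"
    by (rule tensor_algebras_eqI[OF A B P pure_tensor3_linear(1)[OF A B L F g]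
          pure_tensor3_linear(1)[OF A B L G g] eq[OF g] y])
qed

lemma star_unique:
  assumes A: "assoc_algebra R A" and B: "assoc_algebra R B" and L: "lie_algebra R L"
    and X: "X \<subseteq> carrier L" and i: "\<And>x. x \<in> X \<Longrightarrow> i x \<in> carrier A"
    and gen: "left_generated R A X i"
    and \<Phi>: "is_star R L A B X i \<alpha> \<beta> \<Phi>" and \<Psi>: "is_star R L A B X i \<alpha> \<beta> \<Psi>"
  shows "\<Phi> = \<Psi>"
proof (rule linear_maps_eqI[OF is_starD(1)[OF \<Phi>] is_starD(1)[OF \<Psi>]])
  interpret L: lie_algebra R L by (rule L)
  let ?V = "tensor_prod R A B"
  note V = tensor_algebras_module[OF A B]
  note l = linear_maps_is_linear[OF is_starD(1)[OF \<Phi>]] linear_maps_is_linear[OF is_starD(1)[OF \<Psi>]]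
  fix z assume z: "z \<in> carrier (tensor_prod R L ?V)"
  show "\<Phi> z = \<Psi> z"
  proof (rule tensor3_eqI[OF A B L V l _ z])
    fix g t m assume g: "g \<in> carrier L" and t: "t \<in> carrier A" and m: "m \<in> carrier B"
    show "\<Phi> (pure_tensor R L ?V g (pure_tensor R A B t m)) = \<Psi> (pure_tensor R L ?V g (pure_tensor R A B t m))"
    proof (rule left_generated_family_eqI[where J="carrier L" and
          f="\<lambda>g t. \<Phi> (pure_tensor R L ?V g (pure_tensor R A B t m))" and
          g="\<lambda>g t. \<Psi> (pure_tensor R L ?V g (pure_tensor R A B t m))",
          OF A V gen pure_tensor3_linear(2)[OF A B L l(1) _ m] pure_tensor3_linear(2)[OF A B L l(2) _ m]
          i _ _ t g])
      fix x t g assume "x \<in> X" "t \<in> carrier A" "g \<in> carrier L" and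
        IH: "\<And>g. g \<in> carrier L \<Longrightarrow>
          \<Phi> (pure_tensor R L ?V g (pure_tensor R A B t m)) = \<Psi> (pure_tensor R L ?V g (pure_tensor R A B t m))"
      \<comment> \<open>The hypothesis is used both at \<open>g\<close> and at
        \<open>bracket L g x\<close>, so the index set must be closed under this change.\<close>
      moreover have "bracket L g x \<in> carrier L"
        using L.bracket_closed \<open>g \<in> carrier L\<close> \<open>x \<in> X\<close> X by blast
      ultimately show "\<Phi> (pure_tensor R L ?V g (pure_tensor R A B (i x \<otimes>\<^bsub>A\<^esub> t) m)) =
          \<Psi> (pure_tensor R L ?V g (pure_tensor R A B (i x \<otimes>\<^bsub>A\<^esub> t) m))"
        using m by (simp add: is_starD(3)[OF \<Phi>] is_starD(3)[OF \<Psi>])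
    qed (simp_all add: is_starD(2)[OF \<Phi>] is_starD(2)[OF \<Psi>] m)
  qed
qed

text \<open>The action of \<open>A\<close> on the Hom module is taken as the hypothesis
  \<open>rep\<close>, since its construction is the point at which T(g1) and U(g1) differ. What
  remains is to pass to tensor products: the orbit is linear in \<open>t\<close> by
  \<open>rep\<close>, and in \<open>m\<close> because both the starting vector and the action on
  vectors are linear.\<close>

lemma star_exists:
  assumes A: "assoc_algebra R A" and B: "assoc_algebra R B" and L: "lie_algebra R L"
    and X: "submodule X R L" and i: "is_linear R (L\<lparr>carrier := X\<rparr>) A i"
    and gen: "left_generated R A X i"
    and \<alpha>: "is_linear R L A \<alpha>" and \<beta>: "is_linear R L B \<beta>"
    and rep: "\<exists>h. \<forall>f\<in>carrier (hom_module R L (tensor_prod R A B)).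
      h f \<in> linear_maps R A (hom_module R L (tensor_prod R A B)) \<and> h f \<one>\<^bsub>A\<^esub> = f \<and>
      (\<forall>x\<in>X. \<forall>t\<in>carrier A. h f (i x \<otimes>\<^bsub>A\<^esub> t) = star_step R L A B i x (h f t))"
  shows "\<exists>\<Phi>. is_star R L A B X i \<alpha> \<beta> \<Phi>"
proof -
  let ?V = "tensor_prod R A B"
  let ?W = "hom_module R L ?V"
  let ?p = "pure_tensor R A B"
  note V = tensor_algebras_module[OF A B] and M = lie_algebra_module[OF L]
  note MA = assoc_algebra_module[OF A] and MB = assoc_algebra_module[OF B]
  note W = hom_module_module[OF M V]
  interpret A: assoc_algebra R A by (rule A)
  interpret B: assoc_algebra R B by (rule B)
  interpret L: lie_algebra R L by (rule L)
  interpret V: module R ?V by (rule V)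
  interpret W: module R ?W by (rule W)
  obtain h where h: "\<And>f. f \<in> carrier ?W \<Longrightarrow> h f \<in> linear_maps R A ?W"
    and h1: "\<And>f. f \<in> carrier ?W \<Longrightarrow> h f \<one>\<^bsub>A\<^esub> = f"
    and hx: "\<And>f x t. \<lbrakk>f \<in> carrier ?W; x \<in> X; t \<in> carrier A\<rbrakk> \<Longrightarrow>
      h f (i x \<otimes>\<^bsub>A\<^esub> t) = star_step R L A B i x (h f t)"
    using rep by blast
  note hl = linear_maps_is_linear[OF h]
  note pb = tensor_algebras_bilinear[OF A B] and Bm = assoc_algebra_mult_bilinear[OF B]
  have iA: "i x \<in> carrier A" if "x \<in> X" for x using is_linearD(1)[OF i] that by simp
  have h_lin: "is_linear R ?W ?W (\<lambda>f. h f t)" if t: "t \<in> carrier A" for t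
  proof (rule representation_linear[OF A W gen iA hl h1 hx _ t])
    fix x assume "x \<in> X"
    then have "x \<in> carrier (L\<lparr>carrier := X\<rparr>)" by simp
    then show "is_linear R ?W ?W (star_step R L A B i x)"
      by (rule is_bilinearD(1)[OF star_step_bilinear[OF A B L X i]])
  qed
  \<comment> \<open>The value prescribed at \<open>t = 1\<close>, as a function of \<open>g\<close>;
    this is the vector on which \<open>A\<close> acts.\<close>
  define base where "base m = restrict (\<lambda>g. ?p (\<alpha> g) m \<oplus>\<^bsub>?V\<^esub> ?p \<one>\<^bsub>A\<^esub> (\<beta> g \<otimes>\<^bsub>B\<^esub> m)) (carrier L)" for m
  have base_g: "base m g = ?p (\<alpha> g) m \<oplus>\<^bsub>?V\<^esub> ?p \<one>\<^bsub>A\<^esub> (\<beta> g \<otimes>\<^bsub>B\<^esub> m)" if "g \<in> carrier L" for m g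
    using that by (simp add: base_def)
  have base: "base m \<in> carrier ?W" if m: "m \<in> carrier B" for m
    unfolding base_def hom_module_simps(1)
    by (rule restrict_linear_maps[OF M is_linear_add[OF V is_linear_comp[OF \<alpha> is_bilinearD(2)[OF pb m]]
          is_linear_comp[OF is_linear_comp[OF \<beta> is_bilinearD(2)[OF Bm m]] is_bilinearD(1)[OF pb A.A.one_closed]]]])
  have eqI: "f = g" if "f \<in> carrier ?W" "g \<in> carrier ?W" "\<And>x. x \<in> carrier L \<Longrightarrow> f x = g x" for f g
    using that linear_maps_eqI[of f R L ?V g] by simp
  have fix_g: "is_linear R B ?V (\<lambda>m. base m g)" if g: "g \<in> carrier L" for g
    unfolding base_g[OF g]
    by (rule is_linear_add[OF V is_bilinearD(1)[OF pb is_linearD(1)[OF \<alpha> g]]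
          is_linear_comp[OF is_bilinearD(1)[OF Bm is_linearD(1)[OF \<beta> g]] is_bilinearD(1)[OF pb A.A.one_closed]]])
  have base_lin: "is_linear R B ?W base"
  proof (rule is_linearI)
    show "base (m \<oplus>\<^bsub>B\<^esub> m') = base m \<oplus>\<^bsub>?W\<^esub> base m'" if m: "m \<in> carrier B" "m' \<in> carrier B" for m m'
      by (rule eqI) (use m base is_linearD(2)[OF fix_g] in \<open>simp_all add: W.M.a_closed del: hom_module_simps(1)\<close>)
    show "base (c \<odot>\<^bsub>B\<^esub> m) = c \<odot>\<^bsub>?W\<^esub> base m" if c: "c \<in> carrier R" "m \<in> carrier B" for c m
      by (rule eqI) (use c base is_linearD(3)[OF fix_g] in \<open>simp_all add: W.smult_closed del: hom_module_simps(1)\<close>)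
  qed (rule base)
  have bil: "is_bilinear R A B ?W (\<lambda>t m. h (base m) t)"
  proof (rule is_bilinearI)
    show "is_linear R B ?W (\<lambda>m. h (base m) t)" if "t \<in> carrier A" for t
      by (rule is_linear_comp[OF base_lin h_lin[OF that]])
    show "is_linear R A ?W (\<lambda>t. h (base m) t)" if "m \<in> carrier B" for m
      by (rule hl[OF base[OF that]])
  qed
  \<comment> \<open>Orbits assembled over A \<otimes> B, still with values in functions of
    \<open>g\<close>; evaluation at \<open>g\<close> and a second lift then give the map on the
    triple tensor product.\<close>
  define H where "H = tensor_lift R A B ?W (\<lambda>t m. h (base m) t)"
  have H: "is_linear R ?V ?W H" "\<And>t m. \<lbrakk>t \<in> carrier A; m \<in> carrier B\<rbrakk> \<Longrightarrow> H (?p t m) = h (base m) t"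
    using tensor_lift[OF MA MB W bil] unfolding H_def by (auto intro: linear_maps_is_linear)
  have bil2: "is_bilinear R L ?V ?V (\<lambda>g z. H z g)"
  proof (rule is_bilinearI)
    fix g assume g: "g \<in> carrier L"
    have "is_linear R ?W ?V (\<lambda>f. f g)"
      using g by (intro is_linearI) (auto intro: is_linearD(1)[OF linear_maps_is_linear])
    then show "is_linear R ?V ?V (\<lambda>z. H z g)" by (rule is_linear_comp[OF H(1)])
  next
    fix z assume z: "z \<in> carrier ?V"
    show "is_linear R L ?V (\<lambda>g. H z g)"
      using is_linearD(1)[OF H(1) z] by (simp add: linear_maps_is_linear)
  qed
  define \<Phi> where "\<Phi> = tensor_lift R L ?V ?V (\<lambda>g z. H z g)"
  note \<Phi> = tensor_lift[OF M V V bil2, folded \<Phi>_def]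
  note pc = tensor_algebras_closed[OF A B]
  have XL: "x \<in> carrier L" if "x \<in> X" for x using that submoduleD(1)[OF X] by blast
  have \<Phi>_eq: "\<Phi> (pure_tensor R L ?V g (?p t m)) = h (base m) t g"
    if "g \<in> carrier L" "t \<in> carrier A" "m \<in> carrier B" for g t m
    using that by (simp add: \<Phi>(2) pc H(2))
  have "is_star R L A B X i \<alpha> \<beta> \<Phi>"
    unfolding is_star_def
    by (intro conjI ballI \<Phi>(1))
      (simp_all add: \<Phi>_eq iA XL L.bracket_closed base_g star_step_apply h1 base hx del: hom_module_simps(1))
  then show ?thesis by blast
qed

section \<open>The degree filtration of the tensor algebra\<close>

definition tensor_word ::
  "('k, 'r) ring_scheme \<Rightarrow> ('k, 'a, 'x) module_scheme \<Rightarrow> 'a list \<Rightarrow> ('a list \<Rightarrow> 'k) set"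
  where "tensor_word R M w = tensor_ideal R M +>\<^bsub>free_algebra R (carrier M)\<^esub> free_gen R w"

lemma tensor_word_simps:
  "tensor_word R M [] = \<one>\<^bsub>tensor_algebra R M\<^esub>"
  "tensor_word R M [x] = tensor_incl R M x"
  "\<lbrakk>module R M; x \<in> carrier M; w \<in> lists (carrier M)\<rbrakk> \<Longrightarrow>
    tensor_word R M (x # w) = tensor_incl R M x \<otimes>\<^bsub>tensor_algebra R M\<^esub> tensor_word R M w"
  by (simp_all add: tensor_word_def tensor_algebra_one tensor_algebra_coset_Cons)
    (simp add: tensor_incl_def)

lemma tensor_word_closed:
  assumes "module R M" and "w \<in> lists (carrier M)"
  shows "tensor_word R M w \<in> carrier (tensor_algebra R M)"
  using free_word_closed[OF assms] by (auto simp: tensor_word_def tensor_algebra_carrier)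

text \<open>A representative supported on words of length \<open>n\<close> lies in the free module
  on those words alone, so the induction principle for free modules is applied there rather than on
  all words.\<close>

lemma tensor_degree_induct:
  assumes M: "module R M" and H: "submodule H R (tensor_algebra R M)"
    and w: "\<And>w. \<lbrakk>w \<in> lists (carrier M); length w = n\<rbrakk> \<Longrightarrow> tensor_word R M w \<in> H"
    and t: "t \<in> tensor_degree R M n"
  shows "t \<in> H"
proof -
  interpret M: module R M by (rule M)
  let ?F = "free_algebra R (carrier M)"
  let ?q = "\<lambda>\<phi>. tensor_ideal R M +>\<^bsub>?F\<^esub> \<phi>"
  let ?Y = "{w \<in> lists (carrier M). length w = n}"
  let ?G = "free_module R ?Y"
  obtain f where f: "f \<in> carrier ?F" "\<forall>w. f w \<noteq> \<zero>\<^bsub>R\<^esub> \<longrightarrow> length w = n" "t = ?q f"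
    using t by (auto simp: tensor_degree_def)
  then have fG: "f \<in> carrier ?G" by (simp add: free_module_carrier_iff)
  have sub: "\<phi> \<in> carrier ?F" if "\<phi> \<in> carrier ?G" for \<phi>
    using that by (simp add: free_module_carrier_iff)
  have ops: "\<phi> \<oplus>\<^bsub>?G\<^esub> \<psi> = \<phi> \<oplus>\<^bsub>?F\<^esub> \<psi>" "c \<odot>\<^bsub>?G\<^esub> \<phi> = c \<odot>\<^bsub>?F\<^esub> \<phi>" for \<phi> \<psi> c
    by (simp_all add: free_module_def)
  note ql = is_linearD[OF tensor_algebra_coset_linear[OF M]]
  have l: "is_linear R ?G (tensor_algebra R M) ?q"
    unfolding is_linear_def ops using ql sub by blast
  have S: "submodule {\<phi> \<in> carrier ?G. ?q \<phi> \<in> H} R ?G"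
    by (rule submodule_vimage[OF free_module_module[OF M.R.is_cring] tensor_algebra_module[OF M] l H])
  have "f \<in> {\<phi> \<in> carrier ?G. ?q \<phi> \<in> H}"
    by (rule free_module_induct[OF M.R.is_cring S _ fG])
      (use w free_gen_closed[OF M.R.is_cring, of _ ?Y] in \<open>simp add: tensor_word_def\<close>)
  then show ?thesis using f(3) by simp
qed

lemma tensor_degree_le_induct:
  assumes M: "module R M" and H: "submodule H R (tensor_algebra R M)"
    and w: "\<And>w. \<lbrakk>w \<in> lists (carrier M); length w \<le> n\<rbrakk> \<Longrightarrow> tensor_word R M w \<in> H"
    and t: "t \<in> tensor_degree_le R M n"
  shows "t \<in> H"
proof -
  obtain u where u: "\<And>k. k \<le> n \<Longrightarrow> u k \<in> tensor_degree R M k"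
    and t: "t = (\<Oplus>\<^bsub>tensor_algebra R M\<^esub>k\<in>{..n}. u k)"
    using t by (auto simp: tensor_degree_le_def)
  have "u k \<in> H" if "k \<in> {..n}" for k
    by (rule tensor_degree_induct[OF M H _ u]) (use w that in auto)
  then show ?thesis unfolding t by (intro submodule_finsum[OF tensor_algebra_module[OF M] H]) auto
qed

lemma tensor_degree_le_subset:
  assumes "module R M"
  shows "tensor_degree_le R M n \<subseteq> carrier (tensor_algebra R M)"
proof
  interpret T: module R "tensor_algebra R M" by (rule tensor_algebra_module[OF assms])
  fix t assume "t \<in> tensor_degree_le R M n"
  from tensor_degree_le_induct[OF assms T.carrier_is_submodule tensor_word_closed[OF assms] this]
  show "t \<in> carrier (tensor_algebra R M)" by simp
qed

lemma tensor_word_degree_le: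
  assumes M: "module R M" and w: "w \<in> lists (carrier M)" and n: "length w \<le> n"
  shows "tensor_word R M w \<in> tensor_degree_le R M n"
proof -
  interpret M: module R M by (rule M)
  let ?T = "tensor_algebra R M"
  let ?F = "free_algebra R (carrier M)"
  interpret T: module R ?T by (rule tensor_algebra_module[OF M])
  interpret F: module R ?F by (rule free_algebra_module[OF M.R.is_cring])
  have zero: "\<zero>\<^bsub>?T\<^esub> \<in> tensor_degree R M k" for k
  proof -
    have "\<zero>\<^bsub>?T\<^esub> = tensor_ideal R M +>\<^bsub>?F\<^esub> \<zero>\<^bsub>?F\<^esub>"
      unfolding tensor_algebra_def quot_module_zero
      by (rule coset_zero[OF F.module_axioms tensor_ideal_submodule[OF M], symmetric])
    moreover have "\<zero>\<^bsub>?F\<^esub> \<in> carrier ?F" by (rule F.M.zero_closed)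
    moreover have "\<zero>\<^bsub>?F\<^esub> w = \<zero>\<^bsub>R\<^esub>" for w by simp
    ultimately show ?thesis unfolding tensor_degree_def by blast
  qed
  have word: "tensor_word R M w \<in> tensor_degree R M (length w)"
  proof -
    have "free_gen R w v = \<zero>\<^bsub>R\<^esub>" if "length v \<noteq> length w" for v
      using that by (auto simp: free_gen_def)
    then show ?thesis
      using free_word_closed[OF M w] unfolding tensor_degree_def tensor_word_def by blast
  qed
  \<comment> \<open>The word placed in its own degree, with zero in every other degree up to
    \<open>n\<close>.\<close>
  define u where "u k = (if length w = k then tensor_word R M w else \<zero>\<^bsub>?T\<^esub>)" for k
  have "(\<Oplus>\<^bsub>?T\<^esub>k\<in>{..n}. u k) = tensor_word R M w"
    unfolding u_def using n tensor_word_closed[OF M w]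
    by (intro T.M.add.finprod_singleton) auto
  moreover have "\<forall>k\<le>n. u k \<in> tensor_degree R M k" using zero word by (simp add: u_def)
  ultimately show ?thesis unfolding tensor_degree_le_def by blast
qed

section \<open>Projections of a direct sum\<close>

lemma internal_direct_sum_sym:
  assumes "module R M" and "submodule A R M" and "submodule B R M" and "internal_direct_sum M A B"
  shows "internal_direct_sum M B A"
proof -
  interpret M: module R M by fact
  have "A <+>\<^bsub>M\<^esub> B = B <+>\<^bsub>M\<^esub> A"
    using submoduleD(1)[OF assms(2)] submoduleD(1)[OF assms(3)]
    by (force simp: set_add_def' M.M.a_comm)
  then show ?thesis using assms(4) by (auto simp: internal_direct_sum_def)
qed

text \<open>For two decompositions the difference of the first components equals the negative of
  that of the second ones, hence lies in \<open>A \<inter> B\<close> and vanishes; this makes the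
  definite description meaningful.\<close>

lemma dsum_proj_add:
  assumes "module R M" and "submodule A R M" and "submodule B R M" and "internal_direct_sum M A B"
    and "a \<in> A" and "b \<in> B"
  shows "dsum_proj M A B (a \<oplus>\<^bsub>M\<^esub> b) = a"
proof -
  interpret M: module R M by fact
  have AM: "x \<in> carrier M" if "x \<in> A" for x using that submoduleD(1)[OF assms(2)] by blast
  have BM: "x \<in> carrier M" if "x \<in> B" for x using that submoduleD(1)[OF assms(3)] by blast
  show ?thesis unfolding dsum_proj_def
  proof (rule the_equality)
    show "a \<in> A \<and> (\<exists>b'\<in>B. a \<oplus>\<^bsub>M\<^esub> b = a \<oplus>\<^bsub>M\<^esub> b')" using assms(5,6) by blast
  next
    fix a' assume "a' \<in> A \<and> (\<exists>b'\<in>B. a \<oplus>\<^bsub>M\<^esub> b = a' \<oplus>\<^bsub>M\<^esub> b')"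
    then obtain b' where a': "a' \<in> A" and b': "b' \<in> B" and eq: "a \<oplus>\<^bsub>M\<^esub> b = a' \<oplus>\<^bsub>M\<^esub> b'" by blast
    note c = AM[OF assms(5)] BM[OF assms(6)] AM[OF a'] BM[OF b']
    have "a' \<oplus>\<^bsub>M\<^esub> (b' \<ominus>\<^bsub>M\<^esub> b) = (a \<oplus>\<^bsub>M\<^esub> b) \<ominus>\<^bsub>M\<^esub> b"
      using c by (simp add: eq a_minus_def M.M.a_assoc)
    also have "\<dots> = a" using c by (simp add: a_minus_def M.M.a_assoc M.M.r_neg)
    finally have a: "a' \<oplus>\<^bsub>M\<^esub> (b' \<ominus>\<^bsub>M\<^esub> b) = a" .
    have "(a' \<oplus>\<^bsub>M\<^esub> d) \<ominus>\<^bsub>M\<^esub> a' = d" if "d \<in> carrier M" for d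
      using c that by (simp add: a_minus_def M.M.a_comm[of a' d] M.M.a_assoc M.M.r_neg)
    from this[of "b' \<ominus>\<^bsub>M\<^esub> b"] have "a \<ominus>\<^bsub>M\<^esub> a' = b' \<ominus>\<^bsub>M\<^esub> b"
      using c by (simp add: a)
    moreover have "a \<ominus>\<^bsub>M\<^esub> a' \<in> A" by (rule submodule_minus[OF assms(1,2,5) a'])
    moreover have "b' \<ominus>\<^bsub>M\<^esub> b \<in> B" by (rule submodule_minus[OF assms(1,3) b' assms(6)])
    ultimately have "a \<ominus>\<^bsub>M\<^esub> a' \<in> A \<inter> B" by simp
    then have "a \<ominus>\<^bsub>M\<^esub> a' = \<zero>\<^bsub>M\<^esub>"
      using assms(4) unfolding internal_direct_sum_def by blast
    then show "a' = a" using module_diff_zero_iff[OF assms(1)] c by blast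
  qed
qed

lemma dsum_cases:
  assumes "internal_direct_sum M A B" and "x \<in> carrier M"
  obtains a b where "a \<in> A" and "b \<in> B" and "x = a \<oplus>\<^bsub>M\<^esub> b"
  using assms by (auto simp: internal_direct_sum_def set_add_def')

lemma dsum_proj_linear:
  assumes "module R M" and "submodule A R M" and "submodule B R M" and "internal_direct_sum M A B"
  shows "is_linear R M (M\<lparr>carrier := A\<rparr>) (dsum_proj M A B)"
proof -
  interpret M: module R M by fact
  have AM: "x \<in> carrier M" if "x \<in> A" for x using that submoduleD(1)[OF assms(2)] by blast
  have BM: "x \<in> carrier M" if "x \<in> B" for x using that submoduleD(1)[OF assms(3)] by blast
  note p = dsum_proj_add[OF assms]
  show ?thesis
  proof (rule is_linearI)
    fix x assume "x \<in> carrier M"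
    with assms(4) obtain a b where "a \<in> A" "b \<in> B" "x = a \<oplus>\<^bsub>M\<^esub> b" by (rule dsum_cases)
    then show "dsum_proj M A B x \<in> carrier (M\<lparr>carrier := A\<rparr>)" by (simp add: p)
  next
    fix x y assume x: "x \<in> carrier M" and y: "y \<in> carrier M"
    from assms(4) x obtain a b where ab: "a \<in> A" "b \<in> B" "x = a \<oplus>\<^bsub>M\<^esub> b" by (rule dsum_cases)
    from assms(4) y obtain a' b' where ab': "a' \<in> A" "b' \<in> B" "y = a' \<oplus>\<^bsub>M\<^esub> b'" by (rule dsum_cases)
    have "x \<oplus>\<^bsub>M\<^esub> y = (a \<oplus>\<^bsub>M\<^esub> a') \<oplus>\<^bsub>M\<^esub> (b \<oplus>\<^bsub>M\<^esub> b')" using ab ab' AM BM by (simp add: M.M.a_ac)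
    then show "dsum_proj M A B (x \<oplus>\<^bsub>M\<^esub> y) = dsum_proj M A B x \<oplus>\<^bsub>M\<lparr>carrier := A\<rparr>\<^esub> dsum_proj M A B y"
      using ab ab' submoduleD(3)[OF assms(2)] submoduleD(3)[OF assms(3)] by (simp add: p)
  next
    fix c x assume c: "c \<in> carrier R" and x: "x \<in> carrier M"
    from assms(4) x obtain a b where ab: "a \<in> A" "b \<in> B" "x = a \<oplus>\<^bsub>M\<^esub> b" by (rule dsum_cases)
    have "c \<odot>\<^bsub>M\<^esub> x = c \<odot>\<^bsub>M\<^esub> a \<oplus>\<^bsub>M\<^esub> c \<odot>\<^bsub>M\<^esub> b" using ab c AM BM by (simp add: M.smult_r_distr)
    then show "dsum_proj M A B (c \<odot>\<^bsub>M\<^esub> x) = c \<odot>\<^bsub>M\<lparr>carrier := A\<rparr>\<^esub> dsum_proj M A B x"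
      using ab c submoduleD(4)[OF assms(2)] submoduleD(4)[OF assms(3)] by (simp add: p)
  qed
qed

lemma dsum_proj_sum:
  assumes "module R M" and "submodule A R M" and "submodule B R M" and "internal_direct_sum M A B"
    and "x \<in> carrier M"
  shows "dsum_proj M A B x \<oplus>\<^bsub>M\<^esub> dsum_proj M B A x = x"
proof -
  interpret M: module R M by fact
  from assms(4,5) obtain a b where ab: "a \<in> A" "b \<in> B" "x = a \<oplus>\<^bsub>M\<^esub> b" by (rule dsum_cases)
  moreover have "x = b \<oplus>\<^bsub>M\<^esub> a"
    using ab submoduleD(1)[OF assms(2)] submoduleD(1)[OF assms(3)] by (auto intro: M.M.a_comm)
  ultimately show ?thesis
    using dsum_proj_add[OF assms(1-4) ab(1,2)]
      dsum_proj_add[OF assms(1,3,2) internal_direct_sum_sym[OF assms(1-4)] ab(2,1)] by metis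
qed

lemma lie_subalgebra_lie_algebra:
  assumes "lie_algebra R L" and "lie_subalgebra X R L"
  shows "lie_algebra R (L\<lparr>carrier := X\<rparr>)"
proof -
  interpret L: lie_algebra R L by fact
  interpret X: lie_subalgebra X R L by fact
  have XL: "x \<in> carrier L" if "x \<in> X" for x
    using that submoduleD(1)[OF X.submodule_axioms] by blast
  show ?thesis
    by (intro lie_algebra.intro X.submodule_is_module L.module_axioms lie_algebra_axioms.intro)
      (simp_all add: XL X.subalgebra_bracket_closed L.bracket_add_left L.bracket_add_right
        L.bracket_smult_left L.bracket_smult_right L.bracket_self L.jacobi)
qed

section \<open>Lie algebras split into two subalgebras\<close>

locale split_lie_algebra = lie_algebra R L
  for R :: "('k, 'r) ring_scheme" and L :: "('k, 'g, 'l) lie_algebra_scheme" +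
  fixes g1 g2 :: "'g set"
  assumes sub1: "lie_subalgebra g1 R L" and sub2: "lie_subalgebra g2 R L"
    and sum: "internal_direct_sum L g1 g2"
begin

abbreviation "L1 \<equiv> L\<lparr>carrier := g1\<rparr>"
abbreviation "L2 \<equiv> L\<lparr>carrier := g2\<rparr>"
abbreviation "p1 \<equiv> dsum_proj L g1 g2"
abbreviation "p2 \<equiv> dsum_proj L g2 g1"
abbreviation "T \<equiv> tensor_algebra R L1"
abbreviation "T1 \<equiv> tensor_incl R L1"
abbreviation "U \<equiv> uea R L"
abbreviation "U1 \<equiv> uea R L1"
abbreviation "U2 \<equiv> uea R L2"
abbreviation "\<sigma> \<equiv> uea_incl R L"
abbreviation "\<sigma>1 \<equiv> uea_incl R L1"
abbreviation "\<sigma>2 \<equiv> uea_incl R L2"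
abbreviation "Uj1 \<equiv> uea_map R L1 L (\<lambda>x. x)"
abbreviation "Uj2 \<equiv> uea_map R L2 L (\<lambda>x. x)"
abbreviation "\<psi>1 \<equiv> uea_proj R L1"
abbreviation "TU \<equiv> tensor_prod R T U2"
abbreviation "UU \<equiv> tensor_prod R U1 U2"
abbreviation "GTU \<equiv> tensor_prod R L TU"
abbreviation "GUU \<equiv> tensor_prod R L UU"
abbreviation "tens \<equiv> pure_tensor R T U2"
abbreviation "pureG \<equiv> pure_tensor R L TU"
abbreviation "\<psi>TU \<equiv> tensor_map R T U2 U1 U2 \<psi>1 (\<lambda>m. m)"
abbreviation "\<psi>GTU \<equiv> tensor_map R L TU L UU (\<lambda>g. g) \<psi>TU"
abbreviation "\<mu> \<equiv> tensor_lift R U U U (\<lambda>a b. a \<otimes>\<^bsub>U\<^esub> b)"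
abbreviation "\<mu>state \<equiv> (\<lambda>z. \<mu> (tensor_map R U1 U2 U U Uj1 Uj2 (\<psi>TU z)))"
abbreviation "star \<equiv> is_star R L T U2 g1 T1 (\<lambda>g. T1 (p1 g)) (\<lambda>g. \<sigma>2 (p2 g))"
abbreviation "starU \<equiv> is_star R L U1 U2 g1 \<sigma>1 (\<lambda>g. \<sigma>1 (p1 g)) (\<lambda>g. \<sigma>2 (p2 g))"

lemma lie: "lie_algebra R L" by (rule lie_algebra_axioms)
lemmas lie1 = lie_subalgebra_lie_algebra[OF lie sub1]
lemmas lie2 = lie_subalgebra_lie_algebra[OF lie sub2]
lemmas modL = lie_algebra_module[OF lie]
lemmas mod1 = lie_algebra_module[OF lie1]
lemma submod1: "submodule g1 R L" using sub1 by (simp add: lie_subalgebra_def)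
lemma submod2: "submodule g2 R L" using sub2 by (simp add: lie_subalgebra_def)
lemmas algT = tensor_algebra_assoc_algebra[OF mod1]
lemmas algU = uea_assoc_algebra[OF lie]
lemmas algU1 = uea_assoc_algebra[OF lie1]
lemmas algU2 = uea_assoc_algebra[OF lie2]
lemmas modT = assoc_algebra_module[OF algT]
lemmas modU = assoc_algebra_module[OF algU]
lemmas modU1 = assoc_algebra_module[OF algU1]
lemmas modU2 = assoc_algebra_module[OF algU2]
lemmas modTU = tensor_prod_module[OF modT modU2]
lemmas modUU = tensor_prod_module[OF modU1 modU2]
lemmas modGTU = tensor_prod_module[OF modL modTU]

lemma g1_carrier: "x \<in> g1 \<Longrightarrow> x \<in> carrier L" using submoduleD(1)[OF submod1] by blast
lemma g2_carrier: "x \<in> g2 \<Longrightarrow> x \<in> carrier L" using submoduleD(1)[OF submod2] by blast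

lemmas p1_linear = dsum_proj_linear[OF modL submod1 submod2 sum]
lemmas p2_linear = dsum_proj_linear[OF modL submod2 submod1 internal_direct_sum_sym[OF modL submod1 submod2 sum]]

lemma p1_closed: "g \<in> carrier L \<Longrightarrow> p1 g \<in> g1" using is_linearD(1)[OF p1_linear] by simp
lemma p2_closed: "g \<in> carrier L \<Longrightarrow> p2 g \<in> g2" using is_linearD(1)[OF p2_linear] by simp

lemmas T1_linear = tensor_incl_linear[OF mod1]
lemmas \<sigma>_linear = uea_incl_linear[OF lie]
lemmas \<sigma>1_linear = uea_incl_linear[OF lie1]
lemmas \<sigma>2_linear = uea_incl_linear[OF lie2]

lemma T1_closed: "x \<in> g1 \<Longrightarrow> T1 x \<in> carrier T" using is_linearD(1)[OF T1_linear] by simp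
lemma \<sigma>2_closed: "x \<in> g2 \<Longrightarrow> \<sigma>2 x \<in> carrier U2" using is_linearD(1)[OF \<sigma>2_linear] by simp
lemmas \<sigma>_closed = is_linearD(1)[OF \<sigma>_linear]

lemma T_generated: "left_generated R T g1 T1"
  using tensor_algebra_left_generated[OF mod1] by simp

lemma U1_generated: "left_generated R U1 g1 \<sigma>1"
  using uea_left_generated[OF lie1] by simp

sublocale T: assoc_algebra R T by (rule algT)
sublocale U: assoc_algebra R U by (rule algU)
sublocale U1: assoc_algebra R U1 by (rule algU1)
sublocale U2: assoc_algebra R U2 by (rule algU2)

section \<open>Existence of the actions on T(g1) \<otimes> U(g2) and U(g1) \<otimes> U(g2), and
  uniqueness of the former\<close>

lemma star_ex1: "\<exists>!\<Phi>. star \<Phi>"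
proof -
  have "\<exists>\<Phi>. star \<Phi>"
    using tensor_algebra_representation[OF mod1 hom_module_module[OF modL modTU]
        star_step_bilinear[OF algT algU2 lie submod1 T1_linear]]
    by (intro star_exists[OF algT algU2 lie submod1 T1_linear T_generated
          is_linear_comp[OF p1_linear T1_linear] is_linear_comp[OF p2_linear \<sigma>2_linear]]) simp
  then show ?thesis
    using star_unique[OF algT algU2 lie submoduleD(1)[OF submod1] T1_closed T_generated] by blast
qed

text \<open>Here the operators also have to respect the relations of U(g1). Closure of
  \<open>g1\<close> under the bracket enters so that the operator of \<open>[x, y]\<close> is again
  one of those attached to \<open>g1\<close>.\<close>

lemma starU_ex: "\<exists>\<Phi>. starU \<Phi>"
proof -
  have br: "bracket L x y \<in> g1 \<and> \<sigma>1 (bracket L x y) = \<sigma>1 x \<otimes>\<^bsub>U1\<^esub> \<sigma>1 y \<ominus>\<^bsub>U1\<^esub> \<sigma>1 y \<otimes>\<^bsub>U1\<^esub> \<sigma>1 x"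
    if "x \<in> g1" "y \<in> g1" for x y
    using uea_incl_bracket[OF lie1, of x y] lie_subalgebra.subalgebra_bracket_closed[OF sub1 that] that
    by simp
  have "star_step R L U1 U2 \<sigma>1 (bracket L1 x y) f =
      star_step R L U1 U2 \<sigma>1 x (star_step R L U1 U2 \<sigma>1 y f) \<ominus>\<^bsub>hom_module R L UU\<^esub>
      star_step R L U1 U2 \<sigma>1 y (star_step R L U1 U2 \<sigma>1 x f)"
    if "x \<in> carrier L1" "y \<in> carrier L1" "f \<in> carrier (hom_module R L UU)" for x y f
    using star_step_bracket[OF algU1 algU2 lie submod1 \<sigma>1_linear br, of x y f] that by simp
  from uea_representation[OF lie1 hom_module_module[OF modL modUU]
      star_step_bilinear[OF algU1 algU2 lie submod1 \<sigma>1_linear] this]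
  show ?thesis
    by (intro star_exists[OF algU1 algU2 lie submod1 \<sigma>1_linear U1_generated
          is_linear_comp[OF p1_linear \<sigma>1_linear] is_linear_comp[OF p2_linear \<sigma>2_linear]]) simp
qed

section \<open>Compatibility of the action with the degree filtration\<close>

context
  fixes \<Phi> assumes star: "star \<Phi>"
begin

lemmas \<Phi>_linear = linear_maps_is_linear[OF is_starD(1)[OF star]]
lemmas act_linear = pure_tensor3_linear[OF algT algU2 lie \<Phi>_linear]

abbreviation "F n \<equiv> tensor_image R T U2 (tensor_degree_le R L1 n) (carrier U2)"

lemma F_submodule: "submodule (F n) R TU"
  by (rule tensor_image_submodule[OF modT modU2 tensor_degree_le_subset[OF mod1] subset_refl])

lemma word_in_F:
  assumes "w \<in> lists g1" and "length w \<le> n" and "m \<in> carrier U2"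
  shows "tens (tensor_word R L1 w) m \<in> F n"
  using assms tensor_word_degree_le[OF mod1, of w n] by (intro pure_tensor_in_tensor_image) simp_all

text \<open>T_{\<le>n} is spanned by words of length at most \<open>n\<close>, so containment can be
  tested on one word at a time instead of on sums over degrees.\<close>

lemma F_minimal:
  assumes H: "submodule H R TU"
    and w: "\<And>w m. \<lbrakk>w \<in> lists g1; length w \<le> n; m \<in> carrier U2\<rbrakk> \<Longrightarrow> tens (tensor_word R L1 w) m \<in> H"
  shows "F n \<subseteq> H"
proof (rule tensor_image_minimal[OF H])
  fix t m assume t: "t \<in> tensor_degree_le R L1 n" and m: "m \<in> carrier U2"
  have "submodule {t \<in> carrier T. tens t m \<in> H} R T"
    by (rule submodule_vimage[OF modT modTU is_bilinearD(2)[OF tensor_algebras_bilinear[OF algT algU2] m] H])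
  then have "t \<in> {t \<in> carrier T. tens t m \<in> H}"
    by (rule tensor_degree_le_induct[OF mod1 _ _ t]) (use w m tensor_word_closed[OF mod1] in simp)
  then show "tens t m \<in> H" by simp
qed

lemma F_mono: "n \<le> k \<Longrightarrow> F n \<subseteq> F k"
  by (rule F_minimal[OF F_submodule]) (simp add: word_in_F)

lemma lmult_F:
  assumes "x \<in> g1" and "z \<in> F n"
  shows "tensor_lmult R T U2 (T1 x) z \<in> F (Suc n)"
proof -
  have "F n \<subseteq> {z \<in> carrier TU. tensor_lmult R T U2 (T1 x) z \<in> F (Suc n)}"
  proof (rule F_minimal)
    show "submodule {z \<in> carrier TU. tensor_lmult R T U2 (T1 x) z \<in> F (Suc n)} R TU"
      by (rule submodule_vimage[OF modTU modTU tensor_lmult(1)[OF algT algU2 T1_closed[OF assms(1)]] F_submodule])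
  next
    fix w m assume w: "w \<in> lists g1" "length w \<le> n" "m \<in> carrier U2"
    have "tensor_word R L1 (x # w) = T1 x \<otimes>\<^bsub>T\<^esub> tensor_word R L1 w"
      using tensor_word_simps(3)[OF mod1] assms(1) w(1) by simp
    then show "tens (tensor_word R L1 w) m \<in> {z \<in> carrier TU. tensor_lmult R T U2 (T1 x) z \<in> F (Suc n)}"
      using word_in_F[of "x # w" "Suc n" m] assms(1) w tensor_word_closed[OF mod1, of w] T1_closed
      by (simp add: tensor_lmult(2)[OF algT algU2] tensor_algebras_closed[OF algT algU2])
  qed
  then show ?thesis using assms(2) by blast
qed

text \<open>Each letter costs at most one degree: \<open>[g, x]\<close> acts on the shorter word and
  stays one degree lower than allowed, while left multiplication by \<open>x\<close> uses up the
  extra degree. The induction leaves \<open>g\<close> free because of the bracket.\<close>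

lemma act_word_F:
  assumes "w \<in> lists g1" and "m \<in> carrier U2" and "g \<in> carrier L"
  shows "\<Phi> (pureG g (tens (tensor_word R L1 w) m)) \<in> F (Suc (length w))"
  using assms(1,3)
proof (induction w arbitrary: g rule: lists.induct)
  case Nil
  \<comment> \<open>The increase by one in the bound comes from \<open>p1 g\<close>, which becomes a
    letter; the component \<open>p2 g\<close> goes into U(g2) and leaves the degree at zero.\<close>
  have "tens (tensor_word R L1 [p1 g]) m \<in> F (Suc 0)"
    "tens (tensor_word R L1 []) (\<sigma>2 (p2 g) \<otimes>\<^bsub>U2\<^esub> m) \<in> F (Suc 0)"
    using Nil assms(2) p1_closed p2_closed \<sigma>2_closed by (intro word_in_F; simp)+
  from submoduleD(3)[OF F_submodule this]
  show ?case using Nil assms(2) by (simp add: tensor_word_simps is_starD(2)[OF star])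
next
  case (Cons x w)
  have b: "bracket L g x \<in> carrier L" using Cons g1_carrier by (intro bracket_closed) auto
  have "\<Phi> (pureG (bracket L g x) (tens (tensor_word R L1 w) m)) \<in> F (Suc (Suc (length w)))"
    using Cons.IH[OF b] F_mono[of "Suc (length w)" "Suc (Suc (length w))"] by auto
  moreover have "tensor_lmult R T U2 (T1 x) (\<Phi> (pureG g (tens (tensor_word R L1 w) m))) \<in> F (Suc (Suc (length w)))"
    by (rule lmult_F[OF Cons.hyps(1) Cons.IH[OF Cons.prems]])
  moreover have "tensor_word R L1 (x # w) = T1 x \<otimes>\<^bsub>T\<^esub> tensor_word R L1 w"
    using tensor_word_simps(3)[OF mod1] Cons.hyps by simp
  ultimately show ?case
    using submoduleD(3)[OF F_submodule] Cons.hyps Cons.prems assms(2) tensor_word_closed[OF mod1, of w]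
    by (simp add: is_starD(3)[OF star])
qed

lemma star_filtration:
  "\<Phi> ` tensor_image R L TU (carrier L) (F n) \<subseteq> F (n + 1)"
proof -
  have "tensor_image R L TU (carrier L) (F n) \<subseteq> {z \<in> carrier GTU. \<Phi> z \<in> F (n + 1)}"
  proof (rule tensor_image_minimal)
    show "submodule {z \<in> carrier GTU. \<Phi> z \<in> F (n + 1)} R GTU"
      by (rule submodule_vimage[OF modGTU modTU \<Phi>_linear F_submodule])
  next
    fix g z assume g: "g \<in> carrier L" and z: "z \<in> F n"
    have "F n \<subseteq> {z \<in> carrier TU. \<Phi> (pureG g z) \<in> F (n + 1)}"
    proof (rule F_minimal)
      show "submodule {z \<in> carrier TU. \<Phi> (pureG g z) \<in> F (n + 1)} R TU"
        by (rule submodule_vimage[OF modTU modTU act_linear(1)[OF g] F_submodule])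
    next
      fix w m assume w: "w \<in> lists g1" "length w \<le> n" "m \<in> carrier U2"
      then have "\<Phi> (pureG g (tens (tensor_word R L1 w) m)) \<in> F (n + 1)"
        using act_word_F[OF w(1,3) g] F_mono[of "Suc (length w)" "n + 1"] by auto
      then show "tens (tensor_word R L1 w) m \<in> {z \<in> carrier TU. \<Phi> (pureG g z) \<in> F (n + 1)}"
        using w tensor_word_closed[OF mod1, of w] by (simp add: tensor_algebras_closed[OF algT algU2])
    qed
    then show "pureG g z \<in> {z \<in> carrier GTU. \<Phi> z \<in> F (n + 1)}"
      using z g pure_tensor_closed[OF modL modTU] by blast
  qed
  then show ?thesis by blast
qed

section \<open>Right linearity over U(g2)\<close>

text \<open>In the initial value \<open>m\<close> only stands rightmost in the second factor, and
  the step multiplies on the left of the first factor, so right multiplication by \<open>m\<close>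
  passes through both.\<close>

lemma star_rmult:
  assumes g: "g \<in> carrier L" and t: "t \<in> carrier T" and m: "m \<in> carrier U2"
  shows "\<Phi> (pureG g (tens t m)) = tensor_rmult R T U2 (\<Phi> (pureG g (tens t \<one>\<^bsub>U2\<^esub>))) m"
proof -
  note pl = is_linearD[OF tensor_rmult(1)[OF algT algU2 m]]
  note pc = tensor_algebras_closed[OF algT algU2]
  note ac = is_linearD(1)[OF act_linear(1)]
  have step: "\<Phi> (pureG g (tens (T1 x \<otimes>\<^bsub>T\<^esub> t) m)) = tensor_rmult R T U2 (\<Phi> (pureG g (tens (T1 x \<otimes>\<^bsub>T\<^esub> t) \<one>\<^bsub>U2\<^esub>))) m"
    if x: "x \<in> g1" and t: "t \<in> carrier T" and g: "g \<in> carrier L"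
      and IH: "\<And>g. g \<in> carrier L \<Longrightarrow> \<Phi> (pureG g (tens t m)) = tensor_rmult R T U2 (\<Phi> (pureG g (tens t \<one>\<^bsub>U2\<^esub>))) m"
    for x t g
  proof -
    have b: "bracket L g x \<in> carrier L" using bracket_closed g g1_carrier[OF x] by blast
    show ?thesis
      using x t g b m IH
      by (simp add: is_starD(3)[OF star] pl ac pc tensor_lmult_rmult[OF algT algU2] T1_closed
          is_linearD(1)[OF tensor_lmult(1)[OF algT algU2]])
  qed
  have base: "\<Phi> (pureG g (tens \<one>\<^bsub>T\<^esub> m)) = tensor_rmult R T U2 (\<Phi> (pureG g (tens \<one>\<^bsub>T\<^esub> \<one>\<^bsub>U2\<^esub>))) m"
    if g: "g \<in> carrier L" for g
    using g m p1_closed p2_closed \<sigma>2_closed T1_closed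
    by (simp add: is_starD(2)[OF star] pl pc tensor_rmult(2)[OF algT algU2])
  show ?thesis
    by (rule left_generated_family_eqI[where J="carrier L" and
          f="\<lambda>g t. \<Phi> (pureG g (tens t m))" and
          g="\<lambda>g t. tensor_rmult R T U2 (\<Phi> (pureG g (tens t \<one>\<^bsub>U2\<^esub>))) m",
          OF algT modTU T_generated act_linear(2)[OF _ m]
          is_linear_comp[OF act_linear(2)[OF _ U2.A.one_closed] tensor_rmult(1)[OF algT algU2 m]]
          T1_closed base step t g])
qed

end

section \<open>The state map into U(g)\<close>

lemma Uj1: "Uj1 \<in> algebra_maps R U1 U" "x \<in> g1 \<Longrightarrow> Uj1 (\<sigma>1 x) = \<sigma> x"
proof -
  have "is_linear R L1 L (\<lambda>x. x)" using g1_carrier by (simp add: is_linear_def)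
  note h = uea_map[OF lie1 lie this]
  show "Uj1 \<in> algebra_maps R U1 U" by (rule h(1)) simp
  show "x \<in> g1 \<Longrightarrow> Uj1 (\<sigma>1 x) = \<sigma> x" by (rule h(2)) simp_all
qed

lemma Uj2: "Uj2 \<in> algebra_maps R U2 U" "x \<in> g2 \<Longrightarrow> Uj2 (\<sigma>2 x) = \<sigma> x"
proof -
  have "is_linear R L2 L (\<lambda>x. x)" using g2_carrier by (simp add: is_linear_def)
  note h = uea_map[OF lie2 lie this]
  show "Uj2 \<in> algebra_maps R U2 U" by (rule h(1)) simp
  show "x \<in> g2 \<Longrightarrow> Uj2 (\<sigma>2 x) = \<sigma> x" by (rule h(2)) simp_all
qed

lemma Uj1_hom: "is_linear R U1 U Uj1" "Uj1 \<in> ring_hom U1 U"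
  using Uj1(1) by (simp_all add: algebra_maps_def linear_maps_is_linear)

lemma Uj2_hom: "is_linear R U2 U Uj2" "Uj2 \<in> ring_hom U2 U"
  using Uj2(1) by (simp_all add: algebra_maps_def linear_maps_is_linear)

lemmas \<psi>1_linear = uea_proj_linear[OF lie1]

lemma \<psi>1_closed: "t \<in> carrier T \<Longrightarrow> \<psi>1 t \<in> carrier U1"
  by (rule is_linearD(1)[OF \<psi>1_linear])

lemmas \<psi>TU = tensor_map[OF modT modU2 modU1 modU2 \<psi>1_linear is_linear_id]
lemmas \<psi>TU_linear = linear_maps_is_linear[OF \<psi>TU(1)]
lemmas \<psi>GTU = tensor_map[OF modL modTU modL modUU is_linear_id \<psi>TU_linear]
lemmas \<psi>GTU_linear = linear_maps_is_linear[OF \<psi>GTU(1)]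

lemma \<mu>state_linear: "is_linear R TU U \<mu>state"
  by (rule is_linear_comp[OF is_linear_comp[OF \<psi>TU_linear
        linear_maps_is_linear[OF tensor_map(1)[OF modU1 modU2 modU modU Uj1_hom(1) Uj2_hom(1)]]]
        linear_maps_is_linear[OF tensor_lift(1)[OF modU modU modU assoc_algebra_mult_bilinear[OF algU]]]])

lemma \<mu>state_pure:
  assumes "t \<in> carrier T" and "m \<in> carrier U2"
  shows "\<mu>state (tens t m) = Uj1 (\<psi>1 t) \<otimes>\<^bsub>U\<^esub> Uj2 m"
  using assms \<psi>1_closed is_linearD(1)[OF Uj1_hom(1)] is_linearD(1)[OF Uj2_hom(1)]
  by (simp add: \<psi>TU(2) tensor_map(2)[OF modU1 modU2 modU modU Uj1_hom(1) Uj2_hom(1)]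
      tensor_lift(2)[OF modU modU modU assoc_algebra_mult_bilinear[OF algU]])

text \<open>On pure tensors this is multiplicativity of \<open>Uj1\<close> after
  \<open>\<psi>1\<close>. It makes the second term of the recursion visible in U(g).\<close>

lemma \<mu>state_lmult:
  assumes a: "a \<in> carrier T" and z: "z \<in> carrier TU"
  shows "\<mu>state (tensor_lmult R T U2 a z) = Uj1 (\<psi>1 a) \<otimes>\<^bsub>U\<^esub> \<mu>state z"
proof -
  have c: "Uj1 (\<psi>1 t) \<in> carrier U" if "t \<in> carrier T" for t
    using that is_linearD(1)[OF Uj1_hom(1)] \<psi>1_closed by blast
  show ?thesis
    by (rule tensor_algebras_eqI[OF algT algU2 modU
          is_linear_comp[OF tensor_lmult(1)[OF algT algU2 a] \<mu>state_linear]
          is_linear_comp[OF \<mu>state_linear is_bilinearD(1)[OF assoc_algebra_mult_bilinear[OF algU] c[OF a]]] _ z])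
      (use a \<psi>1_closed c is_linearD(1)[OF Uj2_hom(1)] in \<open>simp add: tensor_lmult(2)[OF algT algU2] \<mu>state_pure
        uea_proj_mult[OF lie1] ring_hom_mult[OF Uj1_hom(2)] U.A.m_assoc\<close>)
qed

text \<open>Under the state map the recursion becomes the rule for moving \<sigma>(g) to the right
  past \<sigma>(x), and the initial value becomes the splitting of \<sigma>(g), so both sides obey
  the same recursion in \<open>t\<close>.\<close>

lemma star_state:
  assumes star: "star \<Phi>" and g: "g \<in> carrier L" and t: "t \<in> carrier T" and m: "m \<in> carrier U2"
  shows "\<mu>state (\<Phi> (pureG g (tens t m))) = \<sigma> g \<otimes>\<^bsub>U\<^esub> \<mu>state (tens t m)"
proof -
  note ml = is_linearD[OF \<mu>state_linear]
  note pc = tensor_algebras_closed[OF algT algU2]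
  note ac = is_linearD(1)[OF act_linear(1)[OF star]]
  have UT1: "Uj1 (\<psi>1 (T1 x)) = \<sigma> x" if "x \<in> g1" for x
    using Uj1(2)[OF that] by (simp add: uea_incl_def)
  have step: "\<mu>state (\<Phi> (pureG g (tens (T1 x \<otimes>\<^bsub>T\<^esub> t) m))) = \<sigma> g \<otimes>\<^bsub>U\<^esub> \<mu>state (tens (T1 x \<otimes>\<^bsub>T\<^esub> t) m)"
    if x: "x \<in> g1" and t: "t \<in> carrier T" and g: "g \<in> carrier L"
      and IH: "\<And>g. g \<in> carrier L \<Longrightarrow> \<mu>state (\<Phi> (pureG g (tens t m))) = \<sigma> g \<otimes>\<^bsub>U\<^esub> \<mu>state (tens t m)"
    for x t g
  proof -
    let ?s = "\<mu>state (tens t m)"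
    have b: "bracket L g x \<in> carrier L" using bracket_closed g g1_carrier[OF x] by blast
    have s: "?s \<in> carrier U" using ml(1) pc[OF t m] by blast
    note sg = \<sigma>_closed[OF g] and sx = \<sigma>_closed[OF g1_carrier[OF x]]
    have "tens (T1 x \<otimes>\<^bsub>T\<^esub> t) m = tensor_lmult R T U2 (T1 x) (tens t m)"
      using tensor_lmult(2)[OF algT algU2 T1_closed[OF x] t m] by simp
    then have r: "\<mu>state (tens (T1 x \<otimes>\<^bsub>T\<^esub> t) m) = \<sigma> x \<otimes>\<^bsub>U\<^esub> ?s"
      using \<mu>state_lmult[OF T1_closed[OF x] pc[OF t m]] UT1[OF x] by simp
    have "\<Phi> (pureG g (tens (T1 x \<otimes>\<^bsub>T\<^esub> t) m)) = \<Phi> (pureG (bracket L g x) (tens t m)) \<oplus>\<^bsub>TU\<^esub>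
        tensor_lmult R T U2 (T1 x) (\<Phi> (pureG g (tens t m)))"
      by (rule is_starD(3)[OF star g x t m])
    then have "\<mu>state (\<Phi> (pureG g (tens (T1 x \<otimes>\<^bsub>T\<^esub> t) m))) =
        \<mu>state (\<Phi> (pureG (bracket L g x) (tens t m))) \<oplus>\<^bsub>U\<^esub>
        \<mu>state (tensor_lmult R T U2 (T1 x) (\<Phi> (pureG g (tens t m))))"
      using ml(2)[OF ac[OF b pc[OF t m]] is_linearD(1)[OF tensor_lmult(1)[OF algT algU2 T1_closed[OF x]] ac[OF g pc[OF t m]]]]
      by simp
    also have "\<dots> = \<sigma> (bracket L g x) \<otimes>\<^bsub>U\<^esub> ?s \<oplus>\<^bsub>U\<^esub> \<sigma> x \<otimes>\<^bsub>U\<^esub> (\<sigma> g \<otimes>\<^bsub>U\<^esub> ?s)"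
      using IH[OF b] \<mu>state_lmult[OF T1_closed[OF x] ac[OF g pc[OF t m]]] IH[OF g] UT1[OF x] by simp
    \<comment> \<open>The image of the bracket is a commutator, whose negative half cancels the term
      produced by left multiplication by \<open>x\<close>.\<close>
    also have "\<dots> = (\<sigma> g \<otimes>\<^bsub>U\<^esub> \<sigma> x \<ominus>\<^bsub>U\<^esub> \<sigma> x \<otimes>\<^bsub>U\<^esub> \<sigma> g \<oplus>\<^bsub>U\<^esub> \<sigma> x \<otimes>\<^bsub>U\<^esub> \<sigma> g) \<otimes>\<^bsub>U\<^esub> ?s"
      using s sg sx by (simp add: uea_incl_bracket[OF lie g g1_carrier[OF x]] U.A.l_distr U.A.m_assoc)
    also have "\<dots> = \<sigma> g \<otimes>\<^bsub>U\<^esub> (\<sigma> x \<otimes>\<^bsub>U\<^esub> ?s)"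
      using s sg sx by (simp add: a_minus_def U.M.a_assoc U.M.l_neg U.A.m_assoc)
    finally show ?thesis using r by simp
  qed
  have base: "\<mu>state (\<Phi> (pureG g (tens \<one>\<^bsub>T\<^esub> m))) = \<sigma> g \<otimes>\<^bsub>U\<^esub> \<mu>state (tens \<one>\<^bsub>T\<^esub> m)" if g: "g \<in> carrier L" for g
  proof -
    note p = p1_closed[OF g] p2_closed[OF g]
    note sp = \<sigma>_closed[OF g1_carrier[OF p(1)]] \<sigma>_closed[OF g2_carrier[OF p(2)]]
    have Um: "Uj2 m \<in> carrier U" using is_linearD(1)[OF Uj2_hom(1)] m by blast
    have o: "Uj1 (\<psi>1 \<one>\<^bsub>T\<^esub>) = \<one>\<^bsub>U\<^esub>" by (simp add: uea_proj_one ring_hom_one[OF Uj1_hom(2)])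
    have s2m: "\<sigma>2 (p2 g) \<otimes>\<^bsub>U2\<^esub> m \<in> carrier U2" using \<sigma>2_closed[OF p(2)] m by simp
    have "\<mu>state (\<Phi> (pureG g (tens \<one>\<^bsub>T\<^esub> m))) =
        \<mu>state (tens (T1 (p1 g)) m) \<oplus>\<^bsub>U\<^esub> \<mu>state (tens \<one>\<^bsub>T\<^esub> (\<sigma>2 (p2 g) \<otimes>\<^bsub>U2\<^esub> m))"
      using ml(2)[OF pc[OF T1_closed[OF p(1)] m] pc[OF T.A.one_closed s2m]] is_starD(2)[OF star g m] by simp
    also have "\<dots> = \<sigma> (p1 g) \<otimes>\<^bsub>U\<^esub> Uj2 m \<oplus>\<^bsub>U\<^esub> \<sigma> (p2 g) \<otimes>\<^bsub>U\<^esub> Uj2 m"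
      using \<mu>state_pure[OF T1_closed[OF p(1)] m] \<mu>state_pure[OF T.A.one_closed s2m] UT1[OF p(1)] o
        ring_hom_mult[OF Uj2_hom(2) \<sigma>2_closed[OF p(2)] m] Uj2(2)[OF p(2)] sp Um by simp
    \<comment> \<open>The two factors have become elements of the same algebra, so the components
      recombine to \<open>g\<close> by linearity of \<open>\<sigma>\<close>.\<close>
    also have "\<dots> = \<sigma> (p1 g \<oplus>\<^bsub>L\<^esub> p2 g) \<otimes>\<^bsub>U\<^esub> Uj2 m"
      using is_linearD(2)[OF \<sigma>_linear g1_carrier[OF p(1)] g2_carrier[OF p(2)]] sp Um by (simp add: U.A.l_distr)
    also have "\<dots> = \<sigma> g \<otimes>\<^bsub>U\<^esub> \<mu>state (tens \<one>\<^bsub>T\<^esub> m)"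
      using dsum_proj_sum[OF modL submod1 submod2 sum g] \<mu>state_pure[OF T.A.one_closed m] o Um by simp
    finally show ?thesis .
  qed
  show ?thesis
    by (rule left_generated_family_eqI[where J="carrier L" and
          f="\<lambda>g t. \<mu>state (\<Phi> (pureG g (tens t m)))" and g="\<lambda>g t. \<sigma> g \<otimes>\<^bsub>U\<^esub> \<mu>state (tens t m)",
          OF algT modU T_generated is_linear_comp[OF act_linear(2)[OF star _ m] \<mu>state_linear]
          is_linear_comp[OF is_linear_comp[OF is_bilinearD(2)[OF tensor_algebras_bilinear[OF algT algU2] m] \<mu>state_linear]
            is_bilinearD(1)[OF assoc_algebra_mult_bilinear[OF algU] \<sigma>_closed]]
          T1_closed base step t g])
qed

lemma \<mu>state_split:
  assumes "t \<in> carrier T" and "m \<in> carrier U2"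
  shows "\<mu>state (tens t m) = \<mu>state (tens t \<one>\<^bsub>U2\<^esub>) \<otimes>\<^bsub>U\<^esub> Uj2 m"
proof -
  have "Uj1 (\<psi>1 t) \<in> carrier U" using is_linearD(1)[OF Uj1_hom(1)] \<psi>1_closed assms(1) by blast
  then show ?thesis
    using assms by (simp only: \<mu>state_pure U2.A.one_closed ring_hom_one[OF Uj2_hom(2)] U.A.r_one)
qed

section \<open>Descent from T(g1) to U(g1)\<close>

lemma \<psi>TU_lmult:
  assumes a: "a \<in> carrier T" and z: "z \<in> carrier TU"
  shows "\<psi>TU (tensor_lmult R T U2 a z) = tensor_lmult R U1 U2 (\<psi>1 a) (\<psi>TU z)"
  by (rule tensor_algebras_eqI[OF algT algU2 modUU
        is_linear_comp[OF tensor_lmult(1)[OF algT algU2 a] \<psi>TU_linear]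
        is_linear_comp[OF \<psi>TU_linear tensor_lmult(1)[OF algU1 algU2 \<psi>1_closed[OF a]]] _ z])
    (use a \<psi>1_closed in \<open>simp add: tensor_lmult(2)[OF algT algU2] tensor_lmult(2)[OF algU1 algU2] \<psi>TU(2)
      uea_proj_mult[OF lie1]\<close>)

text \<open>\<open>\<psi>TU\<close> carries left multiplication by \<open>T1 x\<close> to left
  multiplication by \<open>\<sigma>1 x\<close>, and the initial value for T(g1) to that for U(g1).
  Both composites therefore obey one recursion over T(g1), with values in U(g1) \<otimes>
  U(g2).\<close>

lemma starU_\<psi>:
  assumes star: "star \<Phi>" and starU: "starU \<Phi>U" and z: "z \<in> carrier GTU"
  shows "\<Phi>U (\<psi>GTU z) = \<psi>TU (\<Phi> z)"
proof -
  note \<Phi>l = linear_maps_is_linear[OF is_starD(1)[OF star]]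
  note \<Phi>Ul = linear_maps_is_linear[OF is_starD(1)[OF starU]]
  note l1 = is_linear_comp[OF \<psi>GTU_linear \<Phi>Ul] and l2 = is_linear_comp[OF \<Phi>l \<psi>TU_linear]
  note pc = tensor_algebras_closed[OF algT algU2]
  note ac = is_linearD(1)[OF act_linear(1)[OF star]]
  have \<psi>g: "\<psi>GTU (pureG g (tens t m)) = pure_tensor R L UU g (pure_tensor R U1 U2 (\<psi>1 t) m)"
    if "g \<in> carrier L" "t \<in> carrier T" "m \<in> carrier U2" for g t m
    using that by (simp add: \<psi>GTU(2) pc \<psi>TU(2))
  show ?thesis
  proof (rule tensor3_eqI[OF algT algU2 lie modUU l1 l2 _ z])
    fix g t m assume g: "g \<in> carrier L" and t: "t \<in> carrier T" and m: "m \<in> carrier U2"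
    have base: "\<Phi>U (\<psi>GTU (pureG g (tens \<one>\<^bsub>T\<^esub> m))) = \<psi>TU (\<Phi> (pureG g (tens \<one>\<^bsub>T\<^esub> m)))"
      if g: "g \<in> carrier L" for g
      using g m p1_closed[OF g] p2_closed[OF g] T1_closed \<sigma>2_closed
      by (simp add: \<psi>g uea_proj_one is_starD(2)[OF starU] is_starD(2)[OF star] is_linearD(2)[OF \<psi>TU_linear] pc
          \<psi>TU(2) uea_incl_def[of R L1])
    have step: "\<Phi>U (\<psi>GTU (pureG g (tens (T1 x \<otimes>\<^bsub>T\<^esub> t) m))) = \<psi>TU (\<Phi> (pureG g (tens (T1 x \<otimes>\<^bsub>T\<^esub> t) m)))"
      if x: "x \<in> g1" and t: "t \<in> carrier T" and g: "g \<in> carrier L"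
        and IH: "\<And>g. g \<in> carrier L \<Longrightarrow> \<Phi>U (\<psi>GTU (pureG g (tens t m))) = \<psi>TU (\<Phi> (pureG g (tens t m)))" for x t g
    proof -
      have b: "bracket L g x \<in> carrier L" using bracket_closed g g1_carrier[OF x] by blast
      have \<psi>x: "\<psi>1 (T1 x \<otimes>\<^bsub>T\<^esub> t) = \<sigma>1 x \<otimes>\<^bsub>U1\<^esub> \<psi>1 t"
        by (simp add: uea_proj_mult[OF lie1 T1_closed[OF x] t] uea_incl_def)
      have "\<Phi>U (\<psi>GTU (pureG g (tens (T1 x \<otimes>\<^bsub>T\<^esub> t) m))) =
          \<Phi>U (pure_tensor R L UU g (pure_tensor R U1 U2 (\<sigma>1 x \<otimes>\<^bsub>U1\<^esub> \<psi>1 t) m))"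
        using \<psi>g[OF g T.A.m_closed[OF T1_closed[OF x] t] m] \<psi>x by simp
      also have "\<dots> = \<Phi>U (\<psi>GTU (pureG (bracket L g x) (tens t m))) \<oplus>\<^bsub>UU\<^esub>
          tensor_lmult R U1 U2 (\<sigma>1 x) (\<Phi>U (\<psi>GTU (pureG g (tens t m))))"
        using is_starD(3)[OF starU g x \<psi>1_closed[OF t] m] \<psi>g[OF g t m] \<psi>g[OF b t m] by simp
      also have "\<dots> = \<psi>TU (\<Phi> (pureG (bracket L g x) (tens t m))) \<oplus>\<^bsub>UU\<^esub>
          \<psi>TU (tensor_lmult R T U2 (T1 x) (\<Phi> (pureG g (tens t m))))"
        using IH[OF b] IH[OF g] \<psi>TU_lmult[OF T1_closed[OF x] ac[OF g pc[OF t m]]] by (simp add: uea_incl_def)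
      also have "\<dots> = \<psi>TU (\<Phi> (pureG g (tens (T1 x \<otimes>\<^bsub>T\<^esub> t) m)))"
        using is_linearD(2)[OF \<psi>TU_linear ac[OF b pc[OF t m]]
            is_linearD(1)[OF tensor_lmult(1)[OF algT algU2 T1_closed[OF x]] ac[OF g pc[OF t m]]]]
          is_starD(3)[OF star g x t m] by simp
      finally show ?thesis .
    qed
    show "\<Phi>U (\<psi>GTU (pureG g (tens t m))) = \<psi>TU (\<Phi> (pureG g (tens t m)))"
      by (rule left_generated_family_eqI[where J="carrier L" and
            f="\<lambda>g t. \<Phi>U (\<psi>GTU (pureG g (tens t m)))" and g="\<lambda>g t. \<psi>TU (\<Phi> (pureG g (tens t m)))",
            OF algT modUU T_generated pure_tensor3_linear(2)[OF algT algU2 lie l1 _ m]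
            pure_tensor3_linear(2)[OF algT algU2 lie l2 _ m] T1_closed base step t g])
  qed
qed

lemma \<psi>GTU_surj: "\<psi>GTU ` carrier GTU = carrier GUU"
proof -
  have "\<psi>TU ` carrier TU = carrier UU"
    by (rule tensor_map_surj[OF modT modU2 modU1 modU2 \<psi>1_linear is_linear_id uea_proj_surj]) simp
  then show ?thesis
    by (intro tensor_map_surj[OF modL modTU modL modUU is_linear_id \<psi>TU_linear]) simp_all
qed

text \<open>The witness is the action on U(g1) \<otimes> U(g2) built from its own representation.
  Uniqueness is among all extensional functions: \<open>\<psi>GTU\<close> is onto, so the equation
  prescribes every value.\<close>

lemma star_descends:
  assumes star: "star \<Phi>"
  shows "\<exists>\<Phi>U\<in>linear_maps R GUU UU.
    (\<forall>z\<in>carrier GTU. \<Phi>U (\<psi>GTU z) = \<psi>TU (\<Phi> z)) \<and>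
    (\<forall>\<Psi>\<in>carrier GUU \<rightarrow>\<^sub>E carrier UU. (\<forall>z\<in>carrier GTU. \<Psi> (\<psi>GTU z) = \<psi>TU (\<Phi> z)) \<longrightarrow> \<Psi> = \<Phi>U)"
proof -
  obtain \<Phi>U where starU: "starU \<Phi>U" using starU_ex by blast
  note \<Phi>U = is_starD(1)[OF starU] and eq = starU_\<psi>[OF star starU]
  have uniq: "\<Psi> = \<Phi>U"
    if \<Psi>: "\<Psi> \<in> carrier GUU \<rightarrow>\<^sub>E carrier UU" and "\<forall>z\<in>carrier GTU. \<Psi> (\<psi>GTU z) = \<psi>TU (\<Phi> z)" for \<Psi>
  proof (rule extensionalityI)
    show "\<Psi> \<in> extensional (carrier GUU)" using \<Psi> by (simp add: PiE_def)
    show "\<Phi>U \<in> extensional (carrier GUU)" using \<Phi>U by (simp add: linear_maps_iff)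
    fix y assume "y \<in> carrier GUU"
    then obtain z where "z \<in> carrier GTU" "y = \<psi>GTU z" unfolding \<psi>GTU_surj[symmetric] by blast
    then show "\<Psi> y = \<Phi>U y" using that(2) eq by simp
  qed
  show ?thesis
  proof (rule bexI[OF _ \<Phi>U], intro conjI ballI impI)
    show "\<Phi>U (\<psi>GTU z) = \<psi>TU (\<Phi> z)" if "z \<in> carrier GTU" for z using that by (rule eq)
  qed (rule uniq)
qed

end

theorem theorem3p1:
  fixes R :: "('k, 'r) ring_scheme" and L :: "('k, 'g, 'l) lie_algebra_scheme"
    and g1 g2 :: "'g set"
  assumes "cring R"
    and "lie_algebra R L"
    and "lie_subalgebra g1 R L"
    and "lie_subalgebra g2 R L"
    and "internal_direct_sum L g1 g2"
  shows
    "let L1 = L\<lparr>carrier := g1\<rparr>; L2 = L\<lparr>carrier := g2\<rparr>;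
         j1 = (\<lambda>x. x); j2 = (\<lambda>x. x);
         p1 = dsum_proj L g1 g2; p2 = dsum_proj L g2 g1;
         T = tensor_algebra R L1; T1 = tensor_incl R L1;
         U = uea R L; U1 = uea R L1; U2 = uea R L2;
         \<sigma> = uea_incl R L; \<sigma>2 = uea_incl R L2;
         Uj1 = uea_map R L1 L j1; Uj2 = uea_map R L2 L j2;
         \<psi>1 = uea_proj R L1;
         TU = tensor_prod R T U2; UU = tensor_prod R U1 U2;
         GTU = tensor_prod R L TU; GUU = tensor_prod R L UU;
         tens = pure_tensor R T U2;
         \<psi>TU = tensor_map R T U2 U1 U2 \<psi>1 (\<lambda>m. m);
         \<psi>GTU = tensor_map R L TU L UU (\<lambda>g. g) \<psi>TU;
         \<mu> = tensor_lift R U U U (\<lambda>a b. a \<otimes>\<^bsub>U\<^esub> b);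
         \<mu>state = (\<lambda>z. \<mu> (tensor_map R U1 U2 U U Uj1 Uj2 (\<psi>TU z)));
         act = (\<lambda>\<Phi> g z. \<Phi> (pure_tensor R L TU g z));
         isPhi = (\<lambda>\<Phi>. \<Phi> \<in> linear_maps R GTU TU \<and>
           (\<forall>g\<in>carrier L. \<forall>m\<in>carrier U2.
              act \<Phi> g (tens \<one>\<^bsub>T\<^esub> m) =
                tens (T1 (p1 g)) m \<oplus>\<^bsub>TU\<^esub> tens \<one>\<^bsub>T\<^esub> (\<sigma>2 (p2 g) \<otimes>\<^bsub>U2\<^esub> m)) \<and>
           (\<forall>g\<in>carrier L. \<forall>x\<in>g1. \<forall>t\<in>carrier T. \<forall>m\<in>carrier U2.
              act \<Phi> g (tens (T1 x \<otimes>\<^bsub>T\<^esub> t) m) =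
                act \<Phi> (bracket L g (j1 x)) (tens t m) \<oplus>\<^bsub>TU\<^esub>
                tensor_lmult R T U2 (T1 x) (act \<Phi> g (tens t m))))
     in (\<exists>!\<Phi>. isPhi \<Phi>) \<and>
        (\<forall>\<Phi>. isPhi \<Phi> \<longrightarrow>
          (\<forall>n. \<Phi> ` tensor_image R L TU (carrier L)
                    (tensor_image R T U2 (tensor_degree_le R L1 n) (carrier U2))
                 \<subseteq> tensor_image R T U2 (tensor_degree_le R L1 (n + 1)) (carrier U2)) \<and>
          (\<forall>g\<in>carrier L. \<forall>t\<in>carrier T. \<forall>m\<in>carrier U2.
             act \<Phi> g (tens t m) = tensor_rmult R T U2 (act \<Phi> g (tens t \<one>\<^bsub>U2\<^esub>)) m) \<and>
          (\<forall>g\<in>carrier L. \<forall>t\<in>carrier T. \<forall>m\<in>carrier U2.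
             \<mu>state (act \<Phi> g (tens t m)) = \<sigma> g \<otimes>\<^bsub>U\<^esub> \<mu>state (tens t m) \<and>
             \<sigma> g \<otimes>\<^bsub>U\<^esub> \<mu>state (tens t m) =
               \<sigma> g \<otimes>\<^bsub>U\<^esub> \<mu>state (tens t \<one>\<^bsub>U2\<^esub>) \<otimes>\<^bsub>U\<^esub> Uj2 m) \<and>
          (\<exists>\<Phi>U\<in>linear_maps R GUU UU.
             (\<forall>z\<in>carrier GTU. \<Phi>U (\<psi>GTU z) = \<psi>TU (\<Phi> z)) \<and>
             (\<forall>\<Psi>\<in>carrier GUU \<rightarrow>\<^sub>E carrier UU.
                (\<forall>z\<in>carrier GTU. \<Psi> (\<psi>GTU z) = \<psi>TU (\<Phi> z)) \<longrightarrow> \<Psi> = \<Phi>U)))"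
proof -
  interpret D: split_lie_algebra R L g1 g2
    by (intro split_lie_algebra.intro split_lie_algebra_axioms.intro assms)
  show ?thesis
    unfolding Let_def
  proof (intro conjI allI impI, goal_cases)
    case 1
    \<comment> \<open>With the local names expanded, \<open>isPhi\<close> is the predicate
      \<open>is_star\<close> for A = T(g1) and B = U(g2), with \<open>\<alpha>\<close> and
      \<open>\<beta>\<close> the projections followed by the canonical maps.\<close>
    then show ?case using D.star_ex1 unfolding is_star_def .
  next
    case (2 \<Phi> n)
    then have "D.star \<Phi>" unfolding is_star_def .
    then show ?case by (rule D.star_filtration)
  next
    case (3 \<Phi>)
    then have "D.star \<Phi>" unfolding is_star_def .
    from D.star_rmult[OF this] show ?case by (intro ballI)
  next
    case (4 \<Phi>)
    then have star: "D.star \<Phi>" unfolding is_star_def .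
    show ?case
    proof (intro ballI conjI)
      fix g t m assume gtm: "g \<in> carrier L" "t \<in> carrier D.T" "m \<in> carrier D.U2"
      show "D.\<mu>state (\<Phi> (D.pureG g (D.tens t m))) = D.\<sigma> g \<otimes>\<^bsub>D.U\<^esub> D.\<mu>state (D.tens t m)"
        by (rule D.star_state[OF star gtm])
      \<comment> \<open>The remaining equality is the splitting of the state map at \<open>m\<close>
        followed by associativity in U(g), for which the three factors must lie in the
        carrier.\<close>
      have "D.\<sigma> g \<in> carrier D.U" "D.\<mu>state (D.tens t \<one>\<^bsub>D.U2\<^esub>) \<in> carrier D.U" "D.Uj2 m \<in> carrier D.U"
        using D.\<sigma>_closed[OF gtm(1)] is_linearD(1)[OF D.\<mu>state_linear tensor_algebras_closed[OF D.algT D.algU2 gtm(2) D.U2.A.one_closed]]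
          is_linearD(1)[OF D.Uj2_hom(1) gtm(3)] .
      then show "D.\<sigma> g \<otimes>\<^bsub>D.U\<^esub> D.\<mu>state (D.tens t m) =
          D.\<sigma> g \<otimes>\<^bsub>D.U\<^esub> D.\<mu>state (D.tens t \<one>\<^bsub>D.U2\<^esub>) \<otimes>\<^bsub>D.U\<^esub> D.Uj2 m"
        unfolding D.\<mu>state_split[OF gtm(2,3)] by (rule D.U.A.m_assoc[symmetric])
    qed
  next
    case (5 \<Phi>)
    then have "D.star \<Phi>" unfolding is_star_def .
    then show ?case by (rule D.star_descends)
  qed
qed

end
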